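(* Let $\kappa$ be an a.e. continuous kernel on a generalized vertex space $\mathcal V$, and let $G_n=G^{\mathcal V}(n,\kappa)$. For $k\ge1$ let $$\alpha_k(\kappa)=\frac12\int_{\mathcal S^{k+1}}\kappa(x_0,x_1)\kappa(x_1,x_2)\cdots\kappa(x_{k-1},x_k)\,d\mu(x_0)\cdots d\mu(x_k),$$ $$\beta_k(\kappa)=\frac1{2k}\int_{\mathcal S^k}\kappa(x_1,x_2)\cdots\kappa(x_{k-1},x_k)\kappa(x_k,x_1)\,d\mu(x_1)\cdots d\mu(x_k),$$ which may be infinite. (i) For $k$ fixed, $$\liminf_{n\to\infty}\mathbb E P_k(G_n)/n\ge\alpha_k(\kappa),\quad k\ge1,\qquad \liminf_{n\to\infty}\mathbb E Q_k(G_n)\ge\beta_k(\kappa),\quad k\ge3.$$ (ii) Suppose further that $\mathcal V$ is a vertex space. If $\kappa$ is bounded, or if $x_1,\dots,x_n$ are i.i.d. random points with the distribution $\mu$, then $$\text{(a)}\quad \mathbb E P_k(G_n)/n\to\alpha_k(\kappa),\quad k\ge1,\qquad\qquad \text{(b)}\quad \mathbb E Q_k(G_n)\to\beta_k(\kappa),\quad k\ge3.$$ Moreover (for $\mathcal V$ a generalized vertex space), whenever (a) holds and $\alpha_k(\kappa)$ is finite, $P_k(G_n)/n\xrightarrow{p}\alpha_k(\kappa)$. Similarly, whenever (b) holds and the $\beta_k(\kappa)$ are finite, $Q_k(G_n)\xrightarrow{d}\mathrm{Po}(\beta_k(\kappa))$, $k\ge3$, jointly for all $k\ge3$ with independent 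limits.
   Context: Spaces. A generalized ground space is a pair $(\mathcal S,\mu)$, where $\mathcal S$ is a separable metric space and $\mu$ is a Borel measure on $\mathcal S$ with $0<\mu(\mathcal S)<\infty$. A $\mu$-continuity set is a Borel set $A\subseteq\mathcal S$ with $\mu(\partial A)=0$. A generalized vertex space is a triple $\mathcal V=(\mathcal S,\mu,(\mathbf x_n)_{n\in I})$, where $(\mathcal S,\mu)$ is a generalized ground space, $I\subset(0,\infty)$ is an unbounded index set, and for each $n\in I$, $\mathbf x_n=(x_1,\dots,x_{v_n})$ is a random sequence of points of $\mathcal S$ of random length $v_n\ge0$ (the $x_i$ depend on $n$), such that $\#\{i:x_i\in A\}/n\xrightarrow{p}\mu(A)$ as $n\to\infty$ in $I$ for every $\mu$-continuity set $A$. It is a vertex space if $\mu$ is a probability measure, $I$ is an infinite set of positive integers, and $v_n=n$ for every $n$. Kernels and graphs. A kernel on $\mathcal V$ is a symmetric non-negative Borel measurable function on $\mathcal S\times\mathcal S$; a.e. continuous means continuous at $(\mu\times\mu)$-a.e. point of $\mathcal S\times\mathcal S$. $G^{\mathcal V}(n,\kappa)$ is the random graph on $\{1,\dots,v_n\}$ in which, given $\mathbf x_n$, each possible edge $ij$, $i<j$, is present with probability $\min\{\kappa(x_i,x_j)/n,1\}$, independently of the others. $P_k(G)$ and $Q_k(G)$ are the numbers of paths and cycles, respectively, of length $k$ (i.e., with $k$ edges) in a graph $G$, counted as subgraphs. When $\alpha_k(\kappa)$ or $\beta_k(\kappa)$ is infinite the limiting statements have their natural interpretation. $\mathrm{Po}(\beta)$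 is the Poisson distribution with mean $\beta$. Limits are as $n\to\infty$ in $I$. *)

theory Defs
  imports "HOL-Probability.Probability"
begin

section \<open>Modes of convergence\<close>

text \<open>The random variables of a family may live on different probability spaces, and the
  family may be indexed by any type, with the limit taken along any filter.\<close>

definition conv_in_prob ::
  "('i \<Rightarrow> 'w measure) \<Rightarrow> ('i \<Rightarrow> 'w \<Rightarrow> real) \<Rightarrow> real \<Rightarrow> 'i filter \<Rightarrow> bool" where
  "conv_in_prob M X c F \<longleftrightarrow>
     (\<forall>\<epsilon>>0. ((\<lambda>n. measure (M n) {\<omega> \<in> space (M n). \<epsilon> < \<bar>X n \<omega> - c\<bar>}) \<longlongrightarrow> 0) F)"

text \<open>Weak convergence of the laws of \<open>X n\<close> to the Borel probability measure \<open>L\<close>, tested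
  against bounded continuous functions. For \<open>'b = nat\<close> the topology is discrete; for
  \<open>'b = nat \<Rightarrow> nat\<close> it is the product topology, so that this is joint convergence of
  a sequence of random variables.\<close>

definition conv_in_distr ::
  "('i \<Rightarrow> 'w measure) \<Rightarrow> ('i \<Rightarrow> 'w \<Rightarrow> 'b::topological_space) \<Rightarrow> 'b measure \<Rightarrow> 'i filter \<Rightarrow> bool"
  where
  "conv_in_distr M X L F \<longleftrightarrow>
     (\<forall>f :: 'b \<Rightarrow> real. continuous_on UNIV f \<and> bounded (range f) \<longrightarrow>
        ((\<lambda>n. \<integral>\<omega>. f (X n \<omega>) \<partial>M n) \<longlongrightarrow> (\<integral>y. f y \<partial>L)) F)"

text \<open>The library's \<^const>\<open>poisson_pmf\<close> is only specified for a positive rate;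
  \<open>Po(0)\<close> is the point mass at \<open>0\<close>.\<close>

definition Po :: "real \<Rightarrow> nat pmf" where
  "Po \<beta> = (if \<beta> = 0 then return_pmf 0 else poisson_pmf \<beta>)"

section \<open>Vertex spaces\<close>

definition at_top_in :: "real set \<Rightarrow> real filter" where
  "at_top_in I = inf at_top (principal I)"

definition continuity_set :: "'a::topological_space measure \<Rightarrow> 'a set \<Rightarrow> bool" where
  "continuity_set \<mu> A \<longleftrightarrow> A \<in> sets borel \<and> emeasure \<mu> (frontier A) = 0"

text \<open>A random finite sequence, of random length; the list entry at position \<open>i\<close> is a random
  variable defined on the event that the length exceeds \<open>i\<close>.\<close>

definition random_sequence ::
  "'w measure \<Rightarrow> ('w \<Rightarrow> 'a::topological_space list) \<Rightarrow> bool" where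
  "random_sequence M X \<longleftrightarrow>
     (\<lambda>\<omega>. length (X \<omega>)) \<in> measurable M (count_space UNIV) \<and>
     (\<forall>i. (\<lambda>\<omega>. X \<omega> ! i) \<in>
        measurable (restrict_space M {\<omega> \<in> space M. i < length (X \<omega>)}) borel)"

text \<open>The separable metric space is the whole type \<open>'a\<close> (for metric spaces, separability is
  second countability).\<close>

locale generalized_ground_space =
  fixes \<mu> :: "'a::{metric_space, second_countable_topology} measure"
  assumes sets_mu: "sets \<mu> = sets borel"
    and mu_pos: "0 < emeasure \<mu> (space \<mu>)"
    and mu_finite: "emeasure \<mu> (space \<mu>) < \<infinity>"

text \<open>\<open>M n\<close> is the probability space on which the random sequence \<open>x n\<close> is defined.
  Throughout, the points (and later the vertices) are numbered from \<open>0\<close>.\<close>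

locale generalized_vertex_space = generalized_ground_space \<mu>
  for \<mu> :: "'a::{metric_space, second_countable_topology} measure" +
  fixes I :: "real set"
    and M :: "real \<Rightarrow> 'w measure"
    and x :: "real \<Rightarrow> 'w \<Rightarrow> 'a list"
  assumes index_pos: "I \<subseteq> {0<..}"
    and index_unbounded: "\<not> bdd_above I"
    and prob_space_M: "n \<in> I \<Longrightarrow> prob_space (M n)"
    and random_sequence_x: "n \<in> I \<Longrightarrow> random_sequence (M n) (x n)"
    and empirical_conv: "continuity_set \<mu> A \<Longrightarrow>
      conv_in_prob M (\<lambda>n \<omega>. real (card {i. i < length (x n \<omega>) \<and> x n \<omega> ! i \<in> A}) / n)
        (measure \<mu> A) (at_top_in I)"

locale vertex_space = generalized_vertex_space \<mu> I M x
  for \<mu> :: "'a::{metric_space, second_countable_topology} measure"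
    and I :: "real set"
    and M :: "real \<Rightarrow> 'w measure"
    and x :: "real \<Rightarrow> 'w \<Rightarrow> 'a list" +
  assumes prob_space_mu: "prob_space \<mu>"
    and index_nat: "I \<subseteq> \<nat>"
    and length_x: "n \<in> I \<Longrightarrow> \<omega> \<in> space (M n) \<Longrightarrow> real (length (x n \<omega>)) = n"

text \<open>To be used for \<open>n \<in> \<nat>\<close> and sequences of length \<open>n\<close>.\<close>

definition iid_points ::
  "'a::topological_space measure \<Rightarrow> real \<Rightarrow> 'w measure \<Rightarrow> ('w \<Rightarrow> 'a list) \<Rightarrow> bool" where
  "iid_points \<mu> n M X \<longleftrightarrow>
     prob_space.indep_vars M (\<lambda>_. borel) (\<lambda>i \<omega>. X \<omega> ! i) {i. real i < n} \<and>
     (\<forall>i. real i < n \<longrightarrow> distr M borel (\<lambda>\<omega>. X \<omega> ! i) = \<mu>)"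

section \<open>Kernels\<close>

definition kernel :: "('a::topological_space \<Rightarrow> 'a \<Rightarrow> real) \<Rightarrow> bool" where
  "kernel \<kappa> \<longleftrightarrow>
     (\<forall>s t. \<kappa> s t = \<kappa> t s) \<and> (\<forall>s t. 0 \<le> \<kappa> s t) \<and>
     (\<lambda>(s, t). \<kappa> s t) \<in> borel_measurable borel"

definition ae_continuous ::
  "'a::t2_space measure \<Rightarrow> ('a \<Rightarrow> 'a \<Rightarrow> real) \<Rightarrow> bool" where
  "ae_continuous \<mu> \<kappa> \<longleftrightarrow> (AE z in \<mu> \<Otimes>\<^sub>M \<mu>. isCont (\<lambda>(s, t). \<kappa> s t) z)"

definition bounded_kernel :: "('a \<Rightarrow> 'a \<Rightarrow> real) \<Rightarrow> bool" where
  "bounded_kernel \<kappa> \<longleftrightarrow> (\<exists>B. \<forall>s t. \<kappa> s t \<le> B)"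

definition alpha :: "'a measure \<Rightarrow> ('a \<Rightarrow> 'a \<Rightarrow> real) \<Rightarrow> nat \<Rightarrow> ennreal" where
  "alpha \<mu> \<kappa> k =
     (\<integral>\<^sup>+ y. (\<Prod>i<k. ennreal (\<kappa> (y i) (y (Suc i)))) \<partial>(\<Pi>\<^sub>M i\<in>{0..k}. \<mu>)) / 2"

definition beta :: "'a measure \<Rightarrow> ('a \<Rightarrow> 'a \<Rightarrow> real) \<Rightarrow> nat \<Rightarrow> ennreal" where
  "beta \<mu> \<kappa> k =
     (\<integral>\<^sup>+ y. (\<Prod>i\<in>{1..<k}. ennreal (\<kappa> (y i) (y (Suc i)))) * ennreal (\<kappa> (y k) (y 1))
        \<partial>(\<Pi>\<^sub>M i\<in>{1..k}. \<mu>)) / of_nat (2 * k)"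

section \<open>Graphs, paths and cycles\<close>

text \<open>A simple graph is the pair of its vertex set and its set of edges, an edge being a
  two-element set of vertices.\<close>

type_synonym graph = "nat set \<times> nat set set"

definition path_graph :: "nat list \<Rightarrow> graph" where
  "path_graph vs = (set vs, {{vs ! i, vs ! Suc i} | i. Suc i < length vs})"

definition cycle_graph :: "nat list \<Rightarrow> graph" where
  "cycle_graph vs =
     (set vs, insert {last vs, hd vs} {{vs ! i, vs ! Suc i} | i. Suc i < length vs})"

definition subgraph :: "graph \<Rightarrow> graph \<Rightarrow> bool" where
  "subgraph H G \<longleftrightarrow> fst H \<subseteq> fst G \<and> snd H \<subseteq> snd G"

text \<open>Subgraphs are counted, not the vertex sequences that traverse them.\<close>

definition num_paths :: "nat \<Rightarrow> graph \<Rightarrow> nat" where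
  "num_paths k G =
     card {H. subgraph H G \<and> (\<exists>vs. length vs = Suc k \<and> distinct vs \<and> H = path_graph vs)}"

definition num_cycles :: "nat \<Rightarrow> graph \<Rightarrow> nat" where
  "num_cycles k G =
     card {H. subgraph H G \<and> (\<exists>vs. length vs = k \<and> distinct vs \<and> H = cycle_graph vs)}"

section \<open>The random graph\<close>

text \<open>The conditional law of the graph given that the sequence of points is \<open>xs\<close>.\<close>

definition graph_given :: "('a \<Rightarrow> 'a \<Rightarrow> real) \<Rightarrow> real \<Rightarrow> 'a list \<Rightarrow> graph pmf" where
  "graph_given \<kappa> n xs =
     map_pmf (\<lambda>b. ({..<length xs}, {{i, j} | i j. i < j \<and> j < length xs \<and> b (i, j)}))
       (Pi_pmf {(i, j). i < j \<and> j < length xs} False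
          (\<lambda>(i, j). bernoulli_pmf (min (\<kappa> (xs ! i) (xs ! j) / n) 1)))"

text \<open>The law of the random graph with parameter \<open>n\<close>: a mixture of the conditional laws.
  The graph itself is the identity map on this probability space.\<close>

definition random_graph ::
  "(real \<Rightarrow> 'w measure) \<Rightarrow> (real \<Rightarrow> 'w \<Rightarrow> 'a list) \<Rightarrow> ('a \<Rightarrow> 'a \<Rightarrow> real) \<Rightarrow> real \<Rightarrow> graph measure"
  where
  "random_graph M x \<kappa> n = Giry_Monad.bind (M n) (\<lambda>\<omega>. measure_pmf (graph_given \<kappa> n (x n \<omega>)))"

text \<open>The expectation of a count, possibly infinite.\<close>

definition mean_count :: "graph measure \<Rightarrow> (graph \<Rightarrow> nat) \<Rightarrow> ennreal" where
  "mean_count N X = (\<integral>\<^sup>+ G. of_nat (X G) \<partial>N)"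

definition paths_mean_conv ::
  "'a measure \<Rightarrow> real set \<Rightarrow> (real \<Rightarrow> 'w measure) \<Rightarrow> (real \<Rightarrow> 'w \<Rightarrow> 'a list) \<Rightarrow>
     ('a \<Rightarrow> 'a \<Rightarrow> real) \<Rightarrow> nat \<Rightarrow> bool" where
  "paths_mean_conv \<mu> I M x \<kappa> k \<longleftrightarrow>
     ((\<lambda>n. mean_count (random_graph M x \<kappa> n) (num_paths k) / ennreal n) \<longlongrightarrow> alpha \<mu> \<kappa> k)
       (at_top_in I)"

definition cycles_mean_conv ::
  "'a measure \<Rightarrow> real set \<Rightarrow> (real \<Rightarrow> 'w measure) \<Rightarrow> (real \<Rightarrow> 'w \<Rightarrow> 'a list) \<Rightarrow>
     ('a \<Rightarrow> 'a \<Rightarrow> real) \<Rightarrow> nat \<Rightarrow> bool" where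
  "cycles_mean_conv \<mu> I M x \<kappa> k \<longleftrightarrow>
     ((\<lambda>n. mean_count (random_graph M x \<kappa> n) (num_cycles k)) \<longlongrightarrow> beta \<mu> \<kappa> k)
       (at_top_in I)"

end

theory Submission
  imports Defs
begin

text \<open>Conditionally on the points, the edges are independent, so everything is expressed through the
  conditional means of the counts.

  Lower bounds: the empirical measure of the points converges on every continuity set. A
  nonnegative, bounded, almost everywhere continuous function of \<open>r\<close> points is bounded from below by
  step functions on finite partitions into continuity sets, so its empirical sum over injective
  \<open>r\<close>-tuples is with high probability not much smaller than its integral; unbounded kernels are
  truncated. This gives (i), even for the \<^emph>\<open>good\<close> copies, on whose edges the kernel is bounded.
  For bounded kernels on a vertex space the same argument applies to the complementary function; for
  i.i.d. points the mean is bounded by the integral directly.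

  Distributions: if the means converge to finite limits, then the expected number of copies that are
  not good is negligible. The number of good paths is concentrated by Chebyshev's inequality, and
  the numbers of good cycles are jointly Poisson by the Stein--Chen method, where only pairs of
  copies sharing an edge contribute. The Stein equation is solved with the limiting mean
  as parameter, so that no coupling is needed; joint convergence follows one coordinate at
  a time.\<close>

section \<open>Copies of paths and cycles\<close>

text \<open>The obstacle is an unbounded kernel: edge probabilities are then not of order
  \<open>1 / n\<close>, and neither a variance nor a Stein-Chen error can be bounded directly. Good
  copies have edge probabilities of order \<open>1 / n\<close>, and the lower bound shows that they
  alone account for almost all of a finite limit. About the remaining copies only their mean is
  known. Therefore every deviation is bounded by \<open>C * (excess + \<epsilon>)\<close>, where the
  excess is the conditional mean of the counts minus its limit. The excess is not shown to be small
  for a typical sample; it is integrated over the points, and its integral tends to 0 by the assumed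
  convergence of the means. This works because the bound is affine in the conditional mean, which is
  nonnegative and may be integrated over atypical samples too.

  Overlapping pairs of paths are too few to matter against the square of a mean of order
  \<open>n\<close>. For cycles the mean stays bounded, so a factor \<open>1 / n\<close> must be
  gained: two different overlapping cycles together have more edges than vertices.\<close>

text \<open>An undirected edge is encoded by the ordered pair of its ends. With \<open>r = k + 1\<close> the set
  \<open>walk_edges k vs\<close> is the edge set of a path, with \<open>r = k\<close> that of a cycle, where
  \<open>r\<close> is the length of \<open>vs\<close>.\<close>

definition ordered_edge :: "nat \<Rightarrow> nat \<Rightarrow> nat \<times> nat" where
  "ordered_edge a b = (min a b, max a b)"

definition walk_edges :: "nat \<Rightarrow> nat list \<Rightarrow> (nat \<times> nat) set" where
  "walk_edges k vs = (\<lambda>i. ordered_edge (vs ! i) (vs ! (Suc i mod length vs))) ` {..<k}"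

definition inj_lists :: "nat \<Rightarrow> nat \<Rightarrow> nat list set" where
  "inj_lists r v = {vs. length vs = r \<and> distinct vs \<and> set vs \<subseteq> {..<v}}"

definition copies :: "nat \<Rightarrow> nat \<Rightarrow> nat \<Rightarrow> (nat \<times> nat) set set" where
  "copies r k v = walk_edges k ` inj_lists r v"

definition pairs_below :: "nat \<Rightarrow> (nat \<times> nat) set" where
  "pairs_below v = {(i, j). i < j \<and> j < v}"

text \<open>The number \<open>\<sigma>\<close> counts the vertex sequences that traverse one copy:
  two directions for a path, and \<open>k\<close> starting points with two directions each for a
  cycle. The index \<open>Suc i mod r\<close> in \<open>walk_edges\<close> wraps around only for
  cycles, since a path has \<open>k = r - 1\<close>.\<close>

definition shape :: "nat \<Rightarrow> nat \<Rightarrow> nat \<Rightarrow> bool" where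
  "shape r k \<sigma> \<longleftrightarrow> (1 \<le> k \<and> r = Suc k \<and> \<sigma> = 2) \<or> (3 \<le> k \<and> r = k \<and> \<sigma> = 2 * k)"

lemma shape_path: "1 \<le> k \<Longrightarrow> shape (Suc k) k 2"
  and shape_cycle: "3 \<le> k \<Longrightarrow> shape k k (2 * k)"
  by (auto simp: shape_def)

lemma shapeD:
  assumes "shape r k \<sigma>"
  shows "1 \<le> k" "k \<le> r" "r \<le> Suc k" "2 \<le> r" "0 < \<sigma>"
  using assms by (auto simp: shape_def)

lemma ordered_edge_eq_iff:
  "ordered_edge a b = ordered_edge c d \<longleftrightarrow> (a = c \<and> b = d) \<or> (a = d \<and> b = c)"
  by (auto simp: ordered_edge_def min_def max_def split: if_splits)

lemma ordered_edge_commute: "ordered_edge a b = ordered_edge b a"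
  by (simp add: ordered_edge_eq_iff)

lemma mod_Suc_cases: "i < r \<Longrightarrow> Suc i mod r = (if Suc i = r then 0 else Suc i)" for r :: nat
  by auto

lemma finite_inj_lists [simp]: "finite (inj_lists r v)"
proof -
  have "inj_lists r v \<subseteq> {vs. set vs \<subseteq> {..<v} \<and> length vs = r}"
    by (auto simp: inj_lists_def)
  then show ?thesis using finite_lists_length_eq[of "{..<v}" r] finite_subset by blast
qed

lemma finite_copies [simp]: "finite (copies r k v)"
  by (simp add: copies_def)

lemma finite_pairs_below [simp]: "finite (pairs_below v)"
  by (rule finite_subset[of _ "{..<v} \<times> {..<v}"]) (auto simp: pairs_below_def)

lemma finite_walk_edges [simp]: "finite (walk_edges k vs)"
  by (simp add: walk_edges_def)

context
  fixes r k \<sigma> :: nat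
  assumes shape: "shape r k \<sigma>"
begin

text \<open>Steps of a path never wrap around. For a cycle the last claim is where
  \<open>3 \<le> k\<close> enters: in a closed walk of length 2 the two steps would traverse the
  same edge.\<close>

lemma walk_step:
  assumes "i < k" "j < k"
  shows "i < r" "Suc i mod r < r" "Suc i mod r \<noteq> i"
    "Suc i mod r = Suc j mod r \<Longrightarrow> i = j"
    "Suc i mod r = j \<Longrightarrow> Suc j mod r = i \<Longrightarrow> i = j"
proof -
  have r: "i < r" "j < r" using assms shape by (auto simp: shape_def)
  note m = mod_Suc_cases[OF r(1)] mod_Suc_cases[OF r(2)]
  show "i < r" "Suc i mod r < r" using r by auto
  show "Suc i mod r \<noteq> i" using assms shape unfolding m shape_def by auto
  show "Suc i mod r = Suc j mod r \<Longrightarrow> i = j" using r unfolding m by (auto split: if_splits)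
  show "i = j" if "Suc i mod r = j" "Suc j mod r = i"
  proof -
    have "(Suc i = r \<and> j = 0) \<or> j = Suc i" "(Suc j = r \<and> i = 0) \<or> i = Suc j"
      using that m by metis+
    then show "i = j" using assms shape unfolding shape_def by linarith
  qed
qed

lemma inj_on_walk:
  assumes "length vs = r" "distinct vs"
  shows "inj_on (\<lambda>i. ordered_edge (vs ! i) (vs ! (Suc i mod length vs))) {..<k}"
proof (rule inj_onI)
  fix i j
  assume ij: "i \<in> {..<k}" "j \<in> {..<k}"
    and eq: "ordered_edge (vs ! i) (vs ! (Suc i mod length vs))
      = ordered_edge (vs ! j) (vs ! (Suc j mod length vs))"
  have *: "i < r" "j < r" "Suc i mod r < r" "Suc j mod r < r"
    using ij walk_step(1,2)[of i i] walk_step(1,2)[of j j] by auto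
  have "i = j \<or> (i = Suc j mod r \<and> Suc i mod r = j)"
    using eq * assms by (auto simp: ordered_edge_eq_iff nth_eq_iff_index_eq)
  then show "i = j" using ij walk_step(5)[of i j] by auto
qed

lemma card_walk_edges:
  assumes "length vs = r" "distinct vs"
  shows "card (walk_edges k vs) = k"
  unfolding walk_edges_def using inj_on_walk[OF assms] by (simp add: card_image)

lemma prod_walk_edges:
  fixes q :: "nat \<times> nat \<Rightarrow> 'b::comm_monoid_mult"
  assumes "length vs = r" "distinct vs"
  shows "prod q (walk_edges k vs)
    = (\<Prod>i<k. q (ordered_edge (vs ! i) (vs ! (Suc i mod r))))"
  unfolding walk_edges_def using inj_on_walk[OF assms] assms(1) by (simp add: prod.reindex)

lemma walk_edges_subset:
  assumes "vs \<in> inj_lists r v"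
  shows "walk_edges k vs \<subseteq> pairs_below v"
proof
  fix e assume "e \<in> walk_edges k vs"
  then obtain i where i: "i < k" "e = ordered_edge (vs ! i) (vs ! (Suc i mod r))"
    using assms by (auto simp: walk_edges_def inj_lists_def)
  have ir: "i < r" "Suc i mod r < r" "Suc i mod r \<noteq> i" using walk_step(1-3)[OF i(1) i(1)] by auto
  have len: "length vs = r" "distinct vs" "set vs \<subseteq> {..<v}" using assms by (auto simp: inj_lists_def)
  have "vs ! i \<in> set vs" "vs ! (Suc i mod r) \<in> set vs" using ir len by (auto intro: nth_mem)
  moreover have "vs ! i \<noteq> vs ! (Suc i mod r)" using ir len by (simp add: nth_eq_iff_index_eq)
  ultimately have "vs ! i \<in> {..<v}" "vs ! (Suc i mod r) \<in> {..<v}" "vs ! i \<noteq> vs ! (Suc i mod r)"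
    using len(3) by blast+
  then show "e \<in> pairs_below v"
    unfolding i(2) ordered_edge_def pairs_below_def by (cases "vs ! i < vs ! (Suc i mod r)") auto
qed

lemma copies_subset: "S \<in> copies r k v \<Longrightarrow> S \<subseteq> pairs_below v"
  using walk_edges_subset by (auto simp: copies_def)

lemma copies_nonempty: "S \<in> copies r k v \<Longrightarrow> card S = k \<and> S \<noteq> {} \<and> finite S"
  using card_walk_edges shapeD(1)[OF shape] by (force simp: copies_def inj_lists_def)

text \<open>A copy has at most two edges at each vertex, so a traversal has no choice after its
  first step: the next edge is the one not just used.\<close>

lemma walk_edges_determined:
  assumes "length vs = r" "distinct vs" "length ws = r" "distinct ws"
    and eq: "walk_edges k vs = walk_edges k ws"
    and start: "vs ! 0 = ws ! 0" "vs ! 1 = ws ! 1"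
  shows "vs = ws"
proof -
  have "Suc i < r \<Longrightarrow> vs ! i = ws ! i \<and> vs ! Suc i = ws ! Suc i" for i
  proof (induction i)
    case 0 then show ?case using start by simp
  next
    case (Suc i)
    have si: "Suc i < k" "i < k" using Suc.prems shape by (auto simp: shape_def)
    have IH: "vs ! i = ws ! i" "vs ! Suc i = ws ! Suc i" using Suc by auto
    have "ordered_edge (vs ! Suc i) (vs ! (Suc (Suc i) mod r)) \<in> walk_edges k ws"
      using si assms(1) unfolding eq[symmetric] unfolding walk_edges_def by auto
    then obtain j where j: "j < k"
      "ordered_edge (ws ! Suc i) (vs ! Suc (Suc i)) = ordered_edge (ws ! j) (ws ! (Suc j mod r))"
      using Suc.prems IH assms(3) by (auto simp: walk_edges_def)
    have jr: "j < r" "Suc j mod r < r" using walk_step(1,2)[OF j(1) j(1)] by auto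
    show ?case
    proof (cases "ws ! Suc i = ws ! j")
      case True
      then have "j = Suc i" using jr Suc.prems assms(3,4) by (simp add: nth_eq_iff_index_eq)
      then show ?thesis using j(2) IH Suc.prems by (auto simp: ordered_edge_eq_iff)
    next
      \<comment> \<open>The edge is then the one just traversed, so \<open>vs\<close> would return
        to \<open>vs ! i\<close>.\<close>
      case False
      then have *: "ws ! Suc i = ws ! (Suc j mod r)" "vs ! Suc (Suc i) = ws ! j"
        using j(2) by (auto simp: ordered_edge_eq_iff)
      then have "Suc i = Suc j mod r"
        using jr Suc.prems assms(3,4) by (simp add: nth_eq_iff_index_eq)
      then have "j = i" using mod_Suc_cases[OF jr(1)] by (simp split: if_splits)
      then have "vs ! Suc (Suc i) = vs ! i" using * IH by simp
      then show ?thesis using Suc.prems assms(1,2) by (simp add: nth_eq_iff_index_eq)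
    qed
  qed note * = this
  show ?thesis
  proof (rule nth_equalityI)
    show "length vs = length ws" using assms by simp
    fix i assume "i < length vs"
    then show "vs ! i = ws ! i"
      using *[of i] *[of "i - 1"] shapeD(4)[OF shape] assms(1) by (cases i) auto
  qed
qed

end

text \<open>The first vertex of \<open>ws\<close> lies on only one edge, so along \<open>vs\<close>
  it can only be an end vertex, and its neighbour is then forced.\<close>

lemma fiber_le_path:
  assumes k: "1 \<le> k" and vs: "length vs = Suc k" "distinct vs"
    and ws: "length ws = Suc k" "distinct ws" and eq: "walk_edges k ws = walk_edges k vs"
  shows "(ws ! 0, ws ! 1) \<in> {(vs ! 0, vs ! 1), (vs ! k, vs ! (k - 1))}"
proof -
  have nb: "b = ws ! 1" if "ordered_edge (ws ! 0) b \<in> walk_edges k ws" for b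
    using that ws by (auto simp: walk_edges_def ordered_edge_eq_iff nth_eq_iff_index_eq)
  have in_vs: "ordered_edge (vs ! i) (vs ! Suc i) \<in> walk_edges k ws" if "i < k" for i
    using that vs(1) unfolding eq unfolding walk_edges_def by force
  have "ordered_edge (ws ! 0) (ws ! 1) \<in> walk_edges k vs"
    using k ws(1) unfolding eq[symmetric] unfolding walk_edges_def by force
  then obtain i where i: "i < k" "ordered_edge (ws ! 0) (ws ! 1) = ordered_edge (vs ! i) (vs ! Suc i)"
    using vs(1) by (auto simp: walk_edges_def)
  then have "ws ! 0 = vs ! i \<or> ws ! 0 = vs ! Suc i" by (auto simp: ordered_edge_eq_iff)
  with i(1) obtain j where j: "j \<le> k" "ws ! 0 = vs ! j" by (metis Suc_leI less_imp_le_nat)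
  have up: "ws ! 1 = vs ! Suc j" if "j < k"
    using nb[of "vs ! Suc j"] in_vs[of j] that j by auto
  have down: "ws ! 1 = vs ! (j - 1)" if "0 < j"
    using nb[of "vs ! (j - 1)"] in_vs[of "j - 1"] that j by (auto simp: ordered_edge_commute)
  \<comment> \<open>At an interior vertex of \<open>vs\<close> both neighbours would have to equal
    \<open>ws ! 1\<close>.\<close>
  have "j = 0 \<or> j = k"
  proof (rule ccontr)
    assume "\<not> (j = 0 \<or> j = k)"
    then have "vs ! Suc j = vs ! (j - 1)" "Suc j \<le> k" using up down j by auto
    then show False using vs by (simp add: nth_eq_iff_index_eq)
  qed
  then show ?thesis using up down j k by auto
qed

lemma walk_edges_rev_path:
  assumes "length vs = Suc k"
  shows "walk_edges k (rev vs) = walk_edges k vs"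
proof -
  have "walk_edges k (rev vs) = (\<lambda>i. ordered_edge (vs ! i) (vs ! Suc i)) ` (\<lambda>i. k - 1 - i) ` {..<k}"
    unfolding walk_edges_def image_image using assms
    by (intro image_cong) (auto simp: rev_nth ordered_edge_commute Suc_diff_Suc)
  also have "(\<lambda>i. k - 1 - i) ` {..<k} = {..<k}"
    by (rule endo_inj_surj) (auto simp: inj_on_def)
  finally show ?thesis using assms by (simp add: walk_edges_def)
qed

lemma walk_edges_rotate:
  assumes "length vs = k"
  shows "walk_edges k (rotate m vs) = walk_edges k vs"
proof (cases "k = 0")
  case False
  have "walk_edges k (rotate m vs)
      = (\<lambda>i. ordered_edge (vs ! i) (vs ! (Suc i mod k))) ` (\<lambda>i. (m + i) mod k) ` {..<k}"
    unfolding walk_edges_def image_image using assms False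
    by (intro image_cong) (auto simp: nth_rotate mod_Suc_eq mod_simps)
  also have "(\<lambda>i. (m + i) mod k) ` {..<k} = {..<k}"
  proof (rule endo_inj_surj)
    show "inj_on (\<lambda>i. (m + i) mod k) {..<k}"
    proof (rule inj_onI)
      fix i j assume ij: "i \<in> {..<k}" "j \<in> {..<k}" and eq: "(m + i) mod k = (m + j) mod k"
      have "rotate m [0..<k] ! i = rotate m [0..<k] ! j" using ij eq by (simp add: nth_rotate)
      then show "i = j" using ij by (simp add: nth_eq_iff_index_eq)
    qed
  qed (use False in auto)
  finally show ?thesis using assms by (simp add: walk_edges_def)
qed (simp add: walk_edges_def)

lemma walk_edges_rev_cycle:
  assumes "length vs = k" "0 < k"
  shows "walk_edges k (rev vs) = walk_edges k vs"
proof -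
  \<comment> \<open>Reversal sends edge \<open>i\<close> to edge \<open>k - 2 - i\<close> and fixes
    the closing edge \<open>k - 1\<close>.\<close>
  let ?h = "\<lambda>i. if Suc i = k then k - 1 else k - 2 - i"
  have "walk_edges k (rev vs) = (\<lambda>i. ordered_edge (vs ! i) (vs ! (Suc i mod k))) ` ?h ` {..<k}"
    unfolding walk_edges_def image_image
  proof (intro image_cong refl, goal_cases)
    case (1 i)
    then consider "Suc i = k" | j where "k = Suc (Suc (i + j))"
      by (metis Suc_lessI add_Suc less_iff_Suc_add lessThan_iff)
    then show ?case using assms
      by cases (auto simp: rev_nth ordered_edge_commute)
  qed
  also have "?h ` {..<k} = {..<k}"
    by (rule endo_inj_surj) (use assms in \<open>auto simp: inj_on_def split: if_splits\<close>)
  finally show ?thesis using assms by (simp add: walk_edges_def)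
qed

text \<open>By \<open>walk_edges_determined\<close> it suffices to count the possible first two
  vertices. For a path these are its two end edges, directed inwards; for a cycle every edge occurs
  in both directions.\<close>

lemma card_walk_fiber:
  assumes shape: "shape r k \<sigma>" and vs: "vs \<in> inj_lists r v"
  shows "card {ws \<in> inj_lists r v. walk_edges k ws = walk_edges k vs} = \<sigma>" (is "card ?F = _")
proof -
  have len: "length vs = r" "distinct vs" using vs by (auto simp: inj_lists_def)
  let ?s = "\<lambda>ws::nat list. (ws ! 0, ws ! 1)"
  have inj: "inj_on ?s ?F"
    using walk_edges_determined[OF shape] by (auto simp: inj_on_def inj_lists_def)
  consider "1 \<le> k" "r = Suc k" "\<sigma> = 2" | "3 \<le> k" "r = k" "\<sigma> = 2 * k"
    using shape by (auto simp: shape_def)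
  then have "?s ` ?F = ?s ` ?F \<and> card (?s ` ?F) = \<sigma>"
  proof cases
    case 1
    have "?s ` ?F \<subseteq> {(vs ! 0, vs ! 1), (vs ! k, vs ! (k - 1))}"
      using fiber_le_path[of k vs] len 1 by (auto simp: inj_lists_def)
    moreover have "vs \<in> ?F" "rev vs \<in> ?F"
      using vs 1 walk_edges_rev_path[of vs k] by (auto simp: inj_lists_def)
    then have "?s vs \<in> ?s ` ?F" "?s (rev vs) \<in> ?s ` ?F" by blast+
    moreover have "?s (rev vs) = (vs ! k, vs ! (k - 1))"
      using len 1 by (auto simp: rev_nth)
    ultimately have "?s ` ?F = {(vs ! 0, vs ! 1), (vs ! k, vs ! (k - 1))}"
      by (intro equalityI) auto
    moreover have "vs ! 0 \<noteq> vs ! k" using len 1 by (simp add: nth_eq_iff_index_eq)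
    ultimately show ?thesis using 1 by simp
  next
    case 2
    let ?nx = "\<lambda>i. Suc i mod k"
    let ?A = "(\<lambda>i. (vs ! i, vs ! ?nx i)) ` {..<k}" and ?B = "(\<lambda>i. (vs ! ?nx i, vs ! i)) ` {..<k}"
    have sub: "?s ` ?F \<subseteq> ?A \<union> ?B"
    proof (rule image_subsetI)
      fix ws assume ws: "ws \<in> ?F"
      have "ordered_edge (ws ! 0) (ws ! 1) \<in> walk_edges k ws"
        using ws 2 by (force simp: walk_edges_def inj_lists_def)
      then have "ordered_edge (ws ! 0) (ws ! 1) \<in> walk_edges k vs" using ws by simp
      then show "?s ws \<in> ?A \<union> ?B"
        using len 2 by (auto simp: walk_edges_def ordered_edge_eq_iff)
    qed
    have supA: "?A \<subseteq> ?s ` ?F"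
    proof (rule image_subsetI)
      fix i assume "i \<in> {..<k}"
      then have "?s (rotate i vs) = (vs ! i, vs ! ?nx i)" using len 2 by (simp add: nth_rotate)
      moreover have "rotate i vs \<in> ?F" using vs 2 len walk_edges_rotate[of vs k i]
        by (auto simp: inj_lists_def)
      ultimately show "(vs ! i, vs ! ?nx i) \<in> ?s ` ?F" by force
    qed
    have supB: "?B \<subseteq> ?s ` ?F"
    proof (rule image_subsetI)
      \<comment> \<open>Rotation by \<open>i + 2\<close> puts \<open>vs ! ?nx i\<close> last and
        \<open>vs ! i\<close> just before it; reversal turns them into the first two
        entries.\<close>
      fix i assume "i \<in> {..<k}"
      then have "?s (rev (rotate (i + 2) vs)) = (vs ! ?nx i, vs ! i)"
      proof -
        have a: "(i + 2 + (k - 1)) mod k = Suc i mod k"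
        proof -
          have "i + 2 + (k - 1) = Suc i + k" using 2 by simp
          then show ?thesis by (metis mod_add_self2)
        qed
        have b: "(i + 2 + (k - 2)) mod k = i"
        proof -
          have "i + 2 + (k - 2) = i + k" using 2 by simp
          then show ?thesis using \<open>i \<in> _\<close> by (metis mod_add_self2 mod_less lessThan_iff)
        qed
        have "rev (rotate m vs) ! 0 = vs ! ((m + (k - 1)) mod k)"
          "rev (rotate m vs) ! 1 = vs ! ((m + (k - 2)) mod k)" for m
          using len 2 by (auto simp: rev_nth nth_rotate numeral_2_eq_2)
        then show ?thesis using a b by (simp only:)
      qed
      moreover have "rev (rotate (i + 2) vs) \<in> ?F"
        using vs 2 len walk_edges_rotate[of vs k "i + 2"] walk_edges_rev_cycle[of "rotate (i + 2) vs" k]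
        by (auto simp: inj_lists_def simp del: rotate_Suc)
      ultimately show "(vs ! ?nx i, vs ! i) \<in> ?s ` ?F" by force
    qed
    have eq: "?s ` ?F = ?A \<union> ?B" using sub supA supB by blast
    have "?A \<inter> ?B = {}"
    proof -
      have False if "i < k" "j < k" "vs ! i = vs ! ?nx j" "vs ! ?nx i = vs ! j" for i j
      proof -
        have "i = ?nx j" "?nx i = j" using that len 2 by (auto simp: nth_eq_iff_index_eq)
        then show False using walk_step(3,5)[OF shape, of i j] that 2 by metis
      qed
      then show ?thesis by auto
    qed
    moreover have "inj_on (\<lambda>i. (vs ! i, vs ! ?nx i)) {..<k}" "inj_on (\<lambda>i. (vs ! ?nx i, vs ! i)) {..<k}"
      using len 2 by (auto simp: inj_on_def nth_eq_iff_index_eq)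
    ultimately show ?thesis unfolding eq using 2 by (simp add: card_Un_disjoint card_image)
  qed
  then show ?thesis using card_image[OF inj] by simp
qed

lemma sum_copies:
  fixes q :: "nat \<times> nat \<Rightarrow> real"
  assumes shape: "shape r k \<sigma>"
  shows "real \<sigma> * (\<Sum>S\<in>copies r k v. f S) = (\<Sum>vs\<in>inj_lists r v. f (walk_edges k vs))"
proof -
  have "(\<Sum>vs\<in>inj_lists r v. f (walk_edges k vs))
      = (\<Sum>S\<in>copies r k v. \<Sum>vs\<in>{vs \<in> inj_lists r v. walk_edges k vs = S}. f (walk_edges k vs))"
    unfolding copies_def by (rule sum.image_gen) simp
  also have "\<dots> = (\<Sum>S\<in>copies r k v. real \<sigma> * f S)"
    by (rule sum.cong) (use card_walk_fiber[OF shape] in \<open>auto simp: copies_def\<close>)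
  finally show ?thesis by (simp add: sum_distrib_left)
qed

text \<open>Counting one sequence per copy suffices where constants are irrelevant, as in the
  overlap estimates.\<close>

lemma sum_copies_le:
  fixes f :: "(nat \<times> nat) set \<Rightarrow> real"
  assumes "\<And>S. S \<in> copies r k v \<Longrightarrow> 0 \<le> f S"
  shows "(\<Sum>S\<in>copies r k v. f S) \<le> (\<Sum>vs\<in>inj_lists r v. f (walk_edges k vs))"
  unfolding copies_def
  using sum_image_le[of "inj_lists r v" f "walk_edges k"] assms by (simp add: copies_def o_def)

section \<open>Copies as subgraphs of a graph with coded edges\<close>

definition to_graph :: "nat \<Rightarrow> (nat \<times> nat) set \<Rightarrow> graph" where
  "to_graph v E = ({..<v}, {{i, j} | i j. (i, j) \<in> E})"

definition copy_graph :: "(nat \<times> nat) set \<Rightarrow> graph" where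
  "copy_graph S = (fst ` S \<union> snd ` S, {{i, j} | i j. (i, j) \<in> S})"

lemma doubleton_ordered_edge: "{{i, j} | i j. (i, j) \<in> walk_edges k vs}
    = (\<lambda>i. {vs ! i, vs ! (Suc i mod length vs)}) ` {..<k}"
proof -
  have "{{i, j} | i j. (i, j) \<in> walk_edges k vs} = (\<lambda>(i, j). {i, j}) ` walk_edges k vs" by auto
  also have "\<dots> = (\<lambda>i. {vs ! i, vs ! (Suc i mod length vs)}) ` {..<k}"
    unfolding walk_edges_def image_image
    by (intro image_cong) (auto simp: ordered_edge_def min_def max_def)
  finally show ?thesis .
qed

text \<open>A copy has no isolated vertices, so its edge set determines the whole subgraph.\<close>

lemma ends_walk_edges:
  assumes "shape (length vs) k \<sigma>"
  shows "fst ` walk_edges k vs \<union> snd ` walk_edges k vs = set vs"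
proof -
  let ?r = "length vs"
  have "fst ` walk_edges k vs \<union> snd ` walk_edges k vs
      = (\<Union>i<k. {fst (ordered_edge (vs ! i) (vs ! (Suc i mod ?r))),
          snd (ordered_edge (vs ! i) (vs ! (Suc i mod ?r)))})"
    by (auto simp: walk_edges_def)
  also have "\<dots> = (\<Union>i<k. {vs ! i, vs ! (Suc i mod ?r)})"
    by (intro SUP_cong refl) (auto simp: ordered_edge_def min_def max_def)
  also have "\<dots> = set vs"
  proof (intro equalityI subsetI)
    fix a assume "a \<in> (\<Union>i<k. {vs ! i, vs ! (Suc i mod ?r)})"
    then obtain i where i: "i < k" "a = vs ! i \<or> a = vs ! (Suc i mod ?r)" by auto
    have "i < ?r" "Suc i mod ?r < ?r" using walk_step(1,2)[OF assms, of i i] i by auto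
    then show "a \<in> set vs" using i nth_mem by metis
  next
    fix a assume "a \<in> set vs"
    then obtain i where i: "i < ?r" "a = vs ! i" by (auto simp: in_set_conv_nth)
    show "a \<in> (\<Union>i<k. {vs ! i, vs ! (Suc i mod ?r)})"
    proof (cases "i < k")
      \<comment> \<open>Only the last vertex of a path starts no edge; it is the end of edge
        \<open>k - 1\<close>.\<close>
      case False
      then have "i = k" "?r = Suc k" "1 \<le> k" using i assms by (auto simp: shape_def)
      then have "a = vs ! (Suc (k - 1) mod ?r)" "k - 1 < k" using i by auto
      then show ?thesis by blast
    qed (use i in auto)
  qed
  finally show ?thesis .
qed

lemma path_graph_eq:
  assumes "length vs = Suc k" "1 \<le> k"
  shows "path_graph vs = copy_graph (walk_edges k vs)"
proof -
  have "{{vs ! i, vs ! Suc i} | i. Suc i < length vs}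
      = (\<lambda>i. {vs ! i, vs ! (Suc i mod length vs)}) ` {..<k}"
    using assms by (auto simp: image_iff)
  then show ?thesis
    using ends_walk_edges[of vs k 2] assms
    by (simp add: path_graph_def copy_graph_def doubleton_ordered_edge shape_path)
qed

lemma cycle_graph_eq:
  assumes "length vs = k" "3 \<le> k"
  shows "cycle_graph vs = copy_graph (walk_edges k vs)"
proof -
  have ne: "vs \<noteq> []" using assms by auto
  have k: "{..<k} = insert (k - 1) {i. Suc i < k}" using assms by auto
  have "(\<lambda>i. {vs ! i, vs ! (Suc i mod length vs)}) ` {..<k}
      = insert {last vs, hd vs} ((\<lambda>i. {vs ! i, vs ! Suc i}) ` {i. Suc i < k})"
    unfolding k using assms ne by (auto simp: last_conv_nth hd_conv_nth)
  also have "(\<lambda>i. {vs ! i, vs ! Suc i}) ` {i. Suc i < k}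
      = {{vs ! i, vs ! Suc i} | i. Suc i < length vs}"
    using assms by auto
  finally show ?thesis
    using ends_walk_edges[of vs k "2 * k"] assms
    by (simp add: cycle_graph_def copy_graph_def doubleton_ordered_edge shape_cycle)
qed

text \<open>Pairs in \<open>pairs_below v\<close> are increasing, so each unordered edge has a
  single code.\<close>

lemma edges_subset_iff:
  assumes "S \<subseteq> pairs_below v" "E \<subseteq> pairs_below v"
  shows "{{i, j} | i j. (i, j) \<in> S} \<subseteq> {{i, j} | i j. (i, j) \<in> E} \<longleftrightarrow> S \<subseteq> E"
proof
  assume *: "{{i, j} | i j. (i, j) \<in> S} \<subseteq> {{i, j} | i j. (i, j) \<in> E}"
  show "S \<subseteq> E"
  proof
    fix e assume e: "e \<in> S"
    obtain i j where ij: "e = (i, j)" by fastforce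
    then have "{i, j} \<in> {{i, j} | i j. (i, j) \<in> E}" using * e by blast
    then obtain i' j' where "(i', j') \<in> E" "{i, j} = {i', j'}" by blast
    moreover have "i < j" "i' < j'" using e ij assms calculation by (auto simp: pairs_below_def)
    ultimately show "e \<in> E" using ij by (auto simp: doubleton_eq_iff)
  qed
qed blast

text \<open>Without isolated vertices a copy is a subgraph as soon as its edges are present, and
  \<open>copy_graph\<close> is injective on sets of increasing pairs. Hence subgraphs may be counted
  as edge sets.\<close>

lemma count_copies:
  assumes shape: "shape r k \<sigma>" and E: "E \<subseteq> pairs_below v"
  shows "card {H. subgraph H (to_graph v E) \<and>
        (\<exists>vs. length vs = r \<and> distinct vs \<and> H = copy_graph (walk_edges k vs))}
    = card {S \<in> copies r k v. S \<subseteq> E}" (is "card ?L = card ?R")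
proof -
  have inj: "inj_on copy_graph {S. S \<subseteq> pairs_below v}"
  proof (rule inj_onI)
    fix S T assume "S \<in> {S. S \<subseteq> pairs_below v}" "T \<in> {S. S \<subseteq> pairs_below v}"
      "copy_graph S = copy_graph T"
    then show "S = T"
      using edges_subset_iff[of S v T] edges_subset_iff[of T v S] by (auto simp: copy_graph_def)
  qed
  have "?L = copy_graph ` ?R"
  proof (intro equalityI subsetI)
    fix H assume "H \<in> ?L"
    then obtain vs where vs: "subgraph H (to_graph v E)" "length vs = r" "distinct vs"
      "H = copy_graph (walk_edges k vs)" by blast
    have "set vs \<subseteq> {..<v}"
      using vs ends_walk_edges[of vs k \<sigma>] shape by (simp add: subgraph_def to_graph_def copy_graph_def)
    then have inl: "vs \<in> inj_lists r v" using vs by (simp add: inj_lists_def)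
    then have "walk_edges k vs \<subseteq> E"
      using vs edges_subset_iff[OF walk_edges_subset[OF shape inl] E]
      by (simp add: subgraph_def to_graph_def copy_graph_def)
    then show "H \<in> copy_graph ` ?R" using vs inl by (auto simp: copies_def)
  next
    fix H assume "H \<in> copy_graph ` ?R"
    then obtain vs where vs: "vs \<in> inj_lists r v" "walk_edges k vs \<subseteq> E"
      "H = copy_graph (walk_edges k vs)" by (auto simp: copies_def)
    have "length vs = r" "distinct vs" "set vs \<subseteq> {..<v}" using vs(1) by (auto simp: inj_lists_def)
    moreover from this have "subgraph H (to_graph v E)"
      unfolding vs(3) subgraph_def to_graph_def copy_graph_def fst_conv snd_conv
      using ends_walk_edges[of vs k \<sigma>] shape vs(2) by blast
    ultimately show "H \<in> ?L" using vs(3) by blast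
  qed
  moreover have "inj_on copy_graph ?R"
    by (rule inj_on_subset[OF inj]) (use copies_subset[OF shape] in auto)
  ultimately show ?thesis by (simp add: card_image)
qed

lemma num_paths_eq:
  assumes "1 \<le> k" "E \<subseteq> pairs_below v"
  shows "num_paths k (to_graph v E) = card {S \<in> copies (Suc k) k v. S \<subseteq> E}"
proof -
  have "(\<exists>vs. length vs = Suc k \<and> distinct vs \<and> H = path_graph vs) \<longleftrightarrow>
      (\<exists>vs. length vs = Suc k \<and> distinct vs \<and> H = copy_graph (walk_edges k vs))" for H
    using path_graph_eq[OF _ assms(1)] by metis
  then show ?thesis
    using count_copies[OF shape_path[OF assms(1)] assms(2)] by (simp add: num_paths_def)
qed

lemma num_cycles_eq:
  assumes "3 \<le> k" "E \<subseteq> pairs_below v"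
  shows "num_cycles k (to_graph v E) = card {S \<in> copies k k v. S \<subseteq> E}"
proof -
  have "(\<exists>vs. length vs = k \<and> distinct vs \<and> H = cycle_graph vs) \<longleftrightarrow>
      (\<exists>vs. length vs = k \<and> distinct vs \<and> H = copy_graph (walk_edges k vs))" for H
    using cycle_graph_eq[OF _ assms(1)] by metis
  then show ?thesis
    using count_copies[OF shape_cycle[OF assms(1)] assms(2)] by (simp add: num_cycles_def)
qed

section \<open>Independent random subsets\<close>

definition random_subset :: "'e set \<Rightarrow> ('e \<Rightarrow> real) \<Rightarrow> 'e set pmf" where
  "random_subset U q = map_pmf (\<lambda>b. {e \<in> U. b e}) (Pi_pmf U False (\<lambda>e. bernoulli_pmf (q e)))"

lemma set_pmf_random_subset: "set_pmf (random_subset U q) \<subseteq> Pow U"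
  by (auto simp: random_subset_def)

lemma finite_set_pmf_random_subset [simp]: "finite U \<Longrightarrow> finite (set_pmf (random_subset U q))"
  by (rule finite_subset[OF set_pmf_random_subset]) simp

lemma integrable_random_subset [simp]:
  fixes f :: "'e set \<Rightarrow> real"
  shows "finite U \<Longrightarrow> integrable (measure_pmf (random_subset U q)) f"
  by (rule integrable_measure_pmf_finite) simp

lemma random_subset_insert:
  assumes "finite U" "e \<notin> U"
  shows "random_subset (insert e U) q
    = bernoulli_pmf (q e) \<bind> (\<lambda>c. map_pmf (\<lambda>E. if c then insert e E else E) (random_subset U q))"
proof -
  have "random_subset (insert e U) q
    = bernoulli_pmf (q e) \<bind> (\<lambda>c. Pi_pmf U False (\<lambda>e. bernoulli_pmf (q e)) \<bind>
        (\<lambda>b. return_pmf {x \<in> insert e U. (b(e := c)) x}))"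
    unfolding random_subset_def Pi_pmf_insert'[OF assms]
    by (simp add: map_bind_pmf)
  also have "\<dots> = bernoulli_pmf (q e) \<bind> (\<lambda>c. Pi_pmf U False (\<lambda>e. bernoulli_pmf (q e)) \<bind>
        (\<lambda>b. return_pmf (if c then insert e {e \<in> U. b e} else {e \<in> U. b e})))"
    using assms(2) by (intro bind_pmf_cong refl arg_cong[where f = return_pmf]) auto
  finally show ?thesis
    by (simp add: random_subset_def map_pmf_comp map_pmf_def bind_assoc_pmf bind_return_pmf)
qed

lemma expectation_random_subset_insert:
  fixes h :: "'e set \<Rightarrow> real"
  assumes "finite U" "e \<notin> U" "0 \<le> q e" "q e \<le> 1"
  shows "measure_pmf.expectation (random_subset (insert e U) q) h
    = q e * measure_pmf.expectation (random_subset U q) (\<lambda>E. h (insert e E))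
      + (1 - q e) * measure_pmf.expectation (random_subset U q) h"
  unfolding random_subset_insert[of U e q, OF assms(1,2)] using assms
  by (subst pmf_expectation_bind[of UNIV]) (auto simp: UNIV_bool)

lemma expectation_random_subset_mem:
  fixes h :: "'e set \<Rightarrow> real"
  assumes U: "finite U" "e \<in> U" and q: "0 \<le> q e" "q e \<le> 1"
    and h: "\<And>E. h (insert e E) = h E"
  shows "measure_pmf.expectation (random_subset U q) (\<lambda>E. of_bool (e \<in> E) * h E)
    = q e * measure_pmf.expectation (random_subset U q) h"
proof -
  obtain V where V: "U = insert e V" "e \<notin> V" "finite V"
    using U by (metis finite_insert mk_disjoint_insert)
  have "measure_pmf.expectation (random_subset V q) (\<lambda>E. of_bool (e \<in> E) * h E)
      = measure_pmf.expectation (random_subset V q) (\<lambda>E. 0)"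
    using set_pmf_random_subset[of V q] V(2)
    by (intro integral_cong_AE) (auto simp: AE_measure_pmf_iff)
  then show ?thesis
    unfolding V(1) using V q by (simp add: expectation_random_subset_insert h algebra_simps)
qed

text \<open>This is the form in which independence is used: that \<open>h\<close> ignores the edges
  of \<open>S\<close> is expressed by invariance under adding them, and then the event
  \<open>S \<subseteq> E\<close> factors out.\<close>

lemma expectation_random_subset_superset:
  fixes h :: "'e set \<Rightarrow> real"
  assumes U: "finite U" "S \<subseteq> U" and q: "\<And>e. e \<in> U \<Longrightarrow> 0 \<le> q e \<and> q e \<le> 1"
    and h: "\<And>E. h (E \<union> S) = h E"
  shows "measure_pmf.expectation (random_subset U q) (\<lambda>E. of_bool (S \<subseteq> E) * h E)
    = prod q S * measure_pmf.expectation (random_subset U q) h"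
proof -
  have "finite S" using U finite_subset by blast
  then show ?thesis using U(2) h
  proof (induction S)
    case (insert e S)
    \<comment> \<open>Invariance under adding \<open>insert e S\<close> implies invariance under
      adding \<open>S\<close> or \<open>e\<close> alone, by comparison with the larger set.\<close>
    have hS: "h (E \<union> S) = h E" for E
      using insert.prems(2)[of "E \<union> S"] insert.prems(2)[of E] by (simp add: Un_ac)
    have he: "h (insert e E) = h E" for E
      using insert.prems(2)[of "insert e E"] insert.prems(2)[of E] by simp
    have "measure_pmf.expectation (random_subset U q) (\<lambda>E. of_bool (insert e S \<subseteq> E) * h E)
        = measure_pmf.expectation (random_subset U q) (\<lambda>E. of_bool (e \<in> E) * (of_bool (S \<subseteq> E) * h E))"
      by (intro arg_cong[where f = "measure_pmf.expectation _"]) auto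
    also have "\<dots> = q e * measure_pmf.expectation (random_subset U q) (\<lambda>E. of_bool (S \<subseteq> E) * h E)"
    proof (rule expectation_random_subset_mem)
      have "S \<subseteq> insert e E \<longleftrightarrow> S \<subseteq> E" for E using insert.hyps(2) by auto
      then show "of_bool (S \<subseteq> insert e E) * h (insert e E) = of_bool (S \<subseteq> E) * h E" for E
        by (simp add: he)
    qed (use U insert.prems q[of e] in auto)
    also have "\<dots> = q e * (prod q S * measure_pmf.expectation (random_subset U q) h)"
      using insert.IH[OF _ hS] insert.prems(1) by simp
    finally show ?case using insert.hyps by simp
  qed simp
qed

lemma expectation_random_subset_prod:
  assumes "finite U" "S \<subseteq> U" "\<And>e. e \<in> U \<Longrightarrow> 0 \<le> q e \<and> q e \<le> 1"
  shows "measure_pmf.expectation (random_subset U q) (\<lambda>E. of_bool (S \<subseteq> E)) = prod q S"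
  using expectation_random_subset_superset[of U S q "\<lambda>_. 1"] assms by simp

definition copies_in :: "'e set set \<Rightarrow> 'e set \<Rightarrow> nat" where
  "copies_in F E = card {S \<in> F. S \<subseteq> E}"

lemma copies_in_sum: "finite F \<Longrightarrow> real (copies_in F E) = (\<Sum>S\<in>F. of_bool (S \<subseteq> E))"
  by (simp add: copies_in_def of_bool_def sum.If_cases Int_def)

text \<open>Two copies are dependent only if they share an edge.\<close>

definition overlap_sum :: "('e \<Rightarrow> real) \<Rightarrow> 'e set set \<Rightarrow> real" where
  "overlap_sum q F = (\<Sum>S\<in>F. \<Sum>T\<in>{T \<in> F. T \<noteq> S \<and> T \<inter> S \<noteq> {}}. prod q (S \<union> T))"

locale independent_edges =
  fixes U :: "'e set" and q :: "'e \<Rightarrow> real"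
  assumes finite_U: "finite U" and q01: "e \<in> U \<Longrightarrow> 0 \<le> q e \<and> q e \<le> 1"
begin

abbreviation "expect \<equiv> measure_pmf.expectation (random_subset U q)"

lemma prod_nonneg_le_1:
  assumes "S \<subseteq> U"
  shows "0 \<le> prod q S" "prod q S \<le> 1"
  using assms q01 by (auto intro!: prod_nonneg prod_le_1 simp: subset_iff)

lemma prod_mult_le_Un:
  assumes "S \<subseteq> U" "T \<subseteq> U"
  shows "prod q S * prod q T \<le> prod q (S \<union> T)"
proof -
  have fin: "finite S" "finite T" using assms finite_U finite_subset by blast+
  have "prod q S * prod q T = prod q (S \<union> T) * prod q (S \<inter> T)"
    using prod.union_inter[OF fin, of q] by simp
  also have "\<dots> \<le> prod q (S \<union> T) * 1"
    by (intro mult_left_mono prod_nonneg_le_1) (use assms in auto)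
  finally show ?thesis by simp
qed

lemma expect_copies_in:
  assumes "finite F" "\<And>S. S \<in> F \<Longrightarrow> S \<subseteq> U"
  shows "expect (\<lambda>E. real (copies_in F E)) = (\<Sum>S\<in>F. prod q S)"
proof -
  have "expect (\<lambda>E. real (copies_in F E)) = (\<Sum>S\<in>F. expect (\<lambda>E. of_bool (S \<subseteq> E)))"
    unfolding copies_in_sum[OF assms(1)]
    using finite_U by (intro Bochner_Integration.integral_sum) simp
  also have "\<dots> = (\<Sum>S\<in>F. prod q S)"
    by (intro sum.cong refl expectation_random_subset_prod) (use assms finite_U q01 in auto)
  finally show ?thesis .
qed

text \<open>The variance is the double sum of the covariances. Pairs of disjoint copies have
  covariance 0, the diagonal is at most \<open>m\<close>, and for the other overlapping pairs the
  subtracted product of probabilities is dropped.\<close>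

lemma variance_copies_in:
  assumes F: "finite F" "\<And>S. S \<in> F \<Longrightarrow> S \<subseteq> U"
  defines "m \<equiv> \<Sum>S\<in>F. prod q S"
  shows "expect (\<lambda>E. (real (copies_in F E) - m)\<^sup>2) \<le> m + overlap_sum q F"
proof -
  have sq: "(real (copies_in F E))\<^sup>2 = (\<Sum>S\<in>F. \<Sum>T\<in>F. of_bool (S \<union> T \<subseteq> E))" for E
    unfolding copies_in_sum[OF F(1)] power2_eq_square sum_product
    by (intro sum.cong refl) auto
  have "expect (\<lambda>E. (real (copies_in F E) - m)\<^sup>2)
      = expect (\<lambda>E. (\<Sum>S\<in>F. \<Sum>T\<in>F. of_bool (S \<union> T \<subseteq> E)) - 2 * m * real (copies_in F E) + m\<^sup>2)"
    unfolding sq[symmetric] by (simp add: power2_diff algebra_simps)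
  also have "\<dots> = expect (\<lambda>E. \<Sum>S\<in>F. \<Sum>T\<in>F. of_bool (S \<union> T \<subseteq> E))
      - expect (\<lambda>E. 2 * m * real (copies_in F E)) + m\<^sup>2"
    using finite_U
    by (subst Bochner_Integration.integral_add, simp, simp, subst Bochner_Integration.integral_diff) simp_all
  also have "expect (\<lambda>E. 2 * m * real (copies_in F E)) = 2 * m * m"
    using expect_copies_in[OF F] by (simp add: m_def)
  also have "expect (\<lambda>E. \<Sum>S\<in>F. \<Sum>T\<in>F. of_bool (S \<union> T \<subseteq> E)) = (\<Sum>S\<in>F. \<Sum>T\<in>F. prod q (S \<union> T))"
  proof -
    have "expect (\<lambda>E. \<Sum>S\<in>F. \<Sum>T\<in>F. of_bool (S \<union> T \<subseteq> E) :: real)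
        = (\<Sum>S\<in>F. \<Sum>T\<in>F. expect (\<lambda>E. of_bool (S \<union> T \<subseteq> E)))"
    proof (subst Bochner_Integration.integral_sum)
      show "(\<Sum>S\<in>F. expect (\<lambda>E. \<Sum>T\<in>F. of_bool (S \<union> T \<subseteq> E) :: real))
          = (\<Sum>S\<in>F. \<Sum>T\<in>F. expect (\<lambda>E. of_bool (S \<union> T \<subseteq> E)))"
        by (intro sum.cong refl Bochner_Integration.integral_sum integrable_random_subset[OF finite_U])
    qed (rule integrable_random_subset[OF finite_U])
    also have "\<dots> = (\<Sum>S\<in>F. \<Sum>T\<in>F. prod q (S \<union> T))"
      by (intro sum.cong refl expectation_random_subset_prod) (use F finite_U q01 in auto)
    finally show ?thesis .
  qed
  also have "(\<Sum>S\<in>F. \<Sum>T\<in>F. prod q (S \<union> T)) - 2 * m * m + m\<^sup>2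
      = (\<Sum>S\<in>F. \<Sum>T\<in>F. prod q (S \<union> T) - prod q S * prod q T)"
    by (simp add: m_def sum_subtractf sum_product power2_eq_square)
  also have "\<dots> \<le> (\<Sum>S\<in>F. prod q S + (\<Sum>T\<in>{T \<in> F. T \<noteq> S \<and> T \<inter> S \<noteq> {}}. prod q (S \<union> T)))"
  proof (rule sum_mono)
    fix S assume S: "S \<in> F"
    have "(\<Sum>T\<in>F. prod q (S \<union> T) - prod q S * prod q T)
        \<le> (\<Sum>T\<in>F. of_bool (T = S) * prod q S + of_bool (T \<noteq> S \<and> T \<inter> S \<noteq> {}) * prod q (S \<union> T))"
    proof (rule sum_mono)
      fix T assume T: "T \<in> F"
      have fin: "finite S" "finite T" using F finite_U S T finite_subset by blast+
      have nn: "0 \<le> prod q S * prod q T" "0 \<le> prod q S"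
        using prod_nonneg_le_1 F(2) S T by (auto intro!: mult_nonneg_nonneg)
      show "prod q (S \<union> T) - prod q S * prod q T
        \<le> of_bool (T = S) * prod q S + of_bool (T \<noteq> S \<and> T \<inter> S \<noteq> {}) * prod q (S \<union> T)"
      proof (cases "T \<inter> S = {}")
        case True
        then have "prod q (S \<union> T) = prod q S * prod q T"
          using fin by (intro prod.union_disjoint) auto
        then show ?thesis using nn by auto
      qed (use nn in auto)
    qed
    also have "\<dots> = prod q S + (\<Sum>T\<in>{T \<in> F. T \<noteq> S \<and> T \<inter> S \<noteq> {}}. prod q (S \<union> T))"
      using F(1) S by (simp add: sum.distrib of_bool_def if_distrib[of "\<lambda>x. x * _"]
          sum.inter_filter[symmetric] cong: if_cong)
    finally show "(\<Sum>T\<in>F. prod q (S \<union> T) - prod q S * prod q T)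
      \<le> prod q S + (\<Sum>T\<in>{T \<in> F. T \<noteq> S \<and> T \<inter> S \<noteq> {}}. prod q (S \<union> T))" .
  qed
  also have "\<dots> = m + overlap_sum q F"
    by (simp add: m_def overlap_sum_def sum.distrib)
  finally show ?thesis .
qed

lemma copies_in_lower_tail:
  assumes F: "finite F" "\<And>S. S \<in> F \<Longrightarrow> S \<subseteq> U" and t: "0 < t"
  shows "measure_pmf.prob (random_subset U q) {E. real (copies_in F E) \<le> (\<Sum>S\<in>F. prod q S) - t}
    \<le> ((\<Sum>S\<in>F. prod q S) + overlap_sum q F) / t\<^sup>2"
proof -
  define m where "m = (\<Sum>S\<in>F. prod q S)"
  have "measure_pmf.prob (random_subset U q) {E. real (copies_in F E) \<le> m - t}
      = expect (indicator {E. real (copies_in F E) \<le> m - t})"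
    by simp
  also have "\<dots> \<le> expect (\<lambda>E. (real (copies_in F E) - m)\<^sup>2 / t\<^sup>2)"
  proof (rule integral_mono)
    fix E
    show "indicator {E. real (copies_in F E) \<le> m - t} E \<le> (real (copies_in F E) - m)\<^sup>2 / t\<^sup>2"
    proof (cases "real (copies_in F E) \<le> m - t")
      case True
      then have "t\<^sup>2 \<le> (m - real (copies_in F E))\<^sup>2" using t by (intro power_mono) auto
      then show ?thesis using True t by (simp add: power2_commute divide_simps)
    qed auto
  qed (use finite_U in simp_all)
  also have "\<dots> = expect (\<lambda>E. (real (copies_in F E) - m)\<^sup>2) / t\<^sup>2" by simp
  also have "\<dots> \<le> (m + overlap_sum q F) / t\<^sup>2"
    using variance_copies_in[OF F] by (intro divide_right_mono) (auto simp: m_def)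
  finally show ?thesis by (simp add: m_def)
qed

section \<open>The Stein--Chen method\<close>

text \<open>The state of all copies outside the family \<open>F\<close> enters through \<open>\<rho>\<close>; this is what makes the
  bound usable for joint convergence.\<close>

lemma stein_chen_step:
  fixes g :: "nat \<Rightarrow> 'c \<Rightarrow> real" and \<rho> :: "'e set set \<Rightarrow> 'c"
  assumes A: "finite A" "\<And>S. S \<in> A \<Longrightarrow> S \<subseteq> U \<and> S \<noteq> {}"
    and F: "F \<subseteq> A" "F' \<subseteq> A" "F \<inter> F' = {}" and g: "\<And>w c. \<bar>g w c\<bar> \<le> G" and b: "0 \<le> b"
  defines "l \<equiv> \<Sum>S\<in>F. prod q S"
  defines "u \<equiv> \<lambda>j E. g (copies_in F E + j) (\<rho> {T \<in> F'. T \<subseteq> E})"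
  shows "\<bar>expect (\<lambda>E. b * u 1 E - real (copies_in F E) * u 0 E)\<bar>
    \<le> G * (\<bar>b - l\<bar> + 4 * (overlap_sum q A + (\<Sum>S\<in>A. (prod q S)\<^sup>2)))"
proof -
  have finF: "finite F" using A F finite_subset by blast
  have G0: "0 \<le> G" using g[of 0 undefined] by linarith
  have ug: "\<bar>u j E\<bar> \<le> G" for j E using g by (simp add: u_def)
  define nb where "nb S = {T \<in> A. T \<noteq> S \<and> T \<inter> S \<noteq> {}}" for S
  \<comment> \<open>\<open>v S\<close> is \<open>u\<close> with all copies meeting \<open>S\<close>
    ignored and \<open>S\<close> itself counted as present, whence the \<open>+ 1\<close>. It does
    not depend on the edges of \<open>S\<close>, which is what decouples it from the event
    \<open>S \<subseteq> E\<close>.\<close>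
  define v where "v S E = g (copies_in {T \<in> F. T \<inter> S = {}} E + 1)
    (\<rho> {T \<in> F'. T \<inter> S = {} \<and> T \<subseteq> E})" for S E
  have vg: "\<bar>v S E\<bar> \<le> G" for S E using g by (simp add: v_def)
  \<comment> \<open>Unless \<open>S\<close> or a copy meeting it is present, \<open>u 1\<close> and
    \<open>v S\<close> see the same copies and agree. Otherwise \<open>2 * G\<close> is the trivial
    bound, and the sum is at least 1.\<close>
  have near1: "\<bar>u 1 E - v S E\<bar> \<le> 2 * G * (\<Sum>T\<in>insert S (nb S). of_bool (T \<subseteq> E))"
    if S: "S \<in> F" for S E
  proof (cases "\<exists>T\<in>insert S (nb S). T \<subseteq> E")
    case True
    then obtain T where T: "T \<in> insert S (nb S)" "T \<subseteq> E" by blast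
    have "of_bool (T \<subseteq> E) \<le> (\<Sum>T\<in>insert S (nb S). of_bool (T \<subseteq> E) :: real)"
      by (rule member_le_sum[OF T(1)]) (use A(1) in \<open>auto simp: nb_def\<close>)
    then have "1 \<le> (\<Sum>T\<in>insert S (nb S). of_bool (T \<subseteq> E) :: real)" using T(2) by simp
    then have "2 * G * 1 \<le> 2 * G * (\<Sum>T\<in>insert S (nb S). of_bool (T \<subseteq> E))"
      using G0 by (intro mult_left_mono) auto
    then show ?thesis using ug[of 1 E] vg[of S E] by linarith
  next
    case False
    then have "T \<inter> S = {}" if "T \<in> A" "T \<subseteq> E" for T using that S F by (auto simp: nb_def)
    then have "{T \<in> F. T \<subseteq> E} = {T \<in> F. T \<inter> S = {} \<and> T \<subseteq> E}"
      "{T \<in> F'. T \<subseteq> E} = {T \<in> F'. T \<inter> S = {} \<and> T \<subseteq> E}" using F by blast+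
    then have "u 1 E = v S E" by (simp add: u_def v_def copies_in_def)
    then show ?thesis using G0 by (simp add: sum_nonneg)
  qed
  \<comment> \<open>Here \<open>S\<close> is present and accounts for the \<open>+ 1\<close> in
    \<open>v\<close>, so only other copies meeting it can cause a difference.\<close>
  have near0: "\<bar>of_bool (S \<subseteq> E) * (v S E - u 0 E)\<bar> \<le> 2 * G * (\<Sum>T\<in>nb S. of_bool (S \<union> T \<subseteq> E))"
    if S: "S \<in> F" for S E
  proof (cases "S \<subseteq> E")
    case SE: True
    show ?thesis
    proof (cases "\<exists>T\<in>nb S. T \<subseteq> E")
      case True
      then obtain T where T: "T \<in> nb S" "T \<subseteq> E" by blast
      have "of_bool (T \<subseteq> E) \<le> (\<Sum>T\<in>nb S. of_bool (T \<subseteq> E) :: real)"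
        by (rule member_le_sum[OF T(1)]) (use A(1) in \<open>auto simp: nb_def\<close>)
      then have "1 \<le> (\<Sum>T\<in>nb S. of_bool (T \<subseteq> E) :: real)" using T(2) by simp
      then have "2 * G * 1 \<le> 2 * G * (\<Sum>T\<in>nb S. of_bool (T \<subseteq> E))"
        using G0 by (intro mult_left_mono) auto
      then show ?thesis using ug[of 0 E] vg[of S E] SE by auto
    next
      case False
      then have T: "T = S \<or> T \<inter> S = {}" if "T \<in> A" "T \<subseteq> E" for T using that by (auto simp: nb_def)
      have SA: "S \<noteq> {}" "S \<notin> F'" using S F A by auto
      have "{T \<in> F. T \<subseteq> E} = insert S {T \<in> F. T \<inter> S = {} \<and> T \<subseteq> E}"
        using F T S SE by blast
      moreover have "S \<notin> {T \<in> F. T \<inter> S = {} \<and> T \<subseteq> E}" using SA by auto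
      ultimately have "copies_in F E = copies_in {T \<in> F. T \<inter> S = {}} E + 1"
        using finF by (simp add: copies_in_def conj_assoc)
      moreover have "{T \<in> F'. T \<subseteq> E} = {T \<in> F'. T \<inter> S = {} \<and> T \<subseteq> E}" using F T SA by blast
      ultimately have "u 0 E = v S E" by (simp add: u_def v_def)
      then show ?thesis using G0 by (simp add: sum_nonneg)
    qed
  qed (use G0 in \<open>simp add: sum_nonneg\<close>)
  have vE: "expect (\<lambda>E. of_bool (S \<subseteq> E) * v S E) = prod q S * expect (v S)" if "S \<in> F" for S
  proof (rule expectation_random_subset_superset)
    have "T \<inter> S = {} \<Longrightarrow> T \<subseteq> E \<union> S \<longleftrightarrow> T \<subseteq> E" for T E by blast
    then show "v S (E \<union> S) = v S E" for E
      by (simp add: v_def copies_in_def conj_assoc cong: conj_cong)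
  qed (use A F that finite_U q01 in auto)
  \<comment> \<open>By \<open>vE\<close> the terms with \<open>v S\<close> cancel, so
    \<open>v S\<close> may be inserted into both halves of the Stein expression. Apart from the
    mismatch \<open>b - l\<close> of the means, only a sum of local errors remains.\<close>
  let ?D = "\<Sum>S\<in>F. prod q S * expect (\<lambda>E. u 1 E - v S E) + expect (\<lambda>E. of_bool (S \<subseteq> E) * (v S E - u 0 E))"
  have "expect (\<lambda>E. b * u 1 E - real (copies_in F E) * u 0 E)
      = b * expect (u 1) - (\<Sum>S\<in>F. expect (\<lambda>E. of_bool (S \<subseteq> E) * u 0 E))"
    unfolding copies_in_sum[OF finF] sum_distrib_right
    using finite_U by (simp only: Bochner_Integration.integral_diff Bochner_Integration.integral_sum
        integrable_random_subset integral_mult_right_zero)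
  also have "\<dots> = (b - l) * expect (u 1) + ?D"
  proof -
    have "prod q S * expect (\<lambda>E. u 1 E - v S E) + expect (\<lambda>E. of_bool (S \<subseteq> E) * (v S E - u 0 E))
        = prod q S * expect (u 1) - expect (\<lambda>E. of_bool (S \<subseteq> E) * u 0 E)" if "S \<in> F" for S
      unfolding right_diff_distrib using finite_U vE[OF that]
      by (simp add: Bochner_Integration.integral_diff right_diff_distrib)
    then have "?D = (\<Sum>S\<in>F. prod q S * expect (u 1) - expect (\<lambda>E. of_bool (S \<subseteq> E) * u 0 E))"
      by (intro sum.cong refl)
    also have "\<dots> = l * expect (u 1) - (\<Sum>S\<in>F. expect (\<lambda>E. of_bool (S \<subseteq> E) * u 0 E))"
      by (simp only: l_def sum_subtractf sum_distrib_right)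
    finally show ?thesis by (simp add: algebra_simps)
  qed
  finally have eq: "expect (\<lambda>E. b * u 1 E - real (copies_in F E) * u 0 E)
    = (b - l) * expect (u 1) + ?D" .
  have abs_expect: "\<bar>expect h\<bar> \<le> expect (\<lambda>E. \<bar>h E\<bar>)" for h :: "'e set \<Rightarrow> real"
    using integral_norm_bound[of "measure_pmf (random_subset U q)" h] by simp
  have mono: "expect h \<le> expect h'" if "\<And>E. h E \<le> h' E" for h h' :: "'e set \<Rightarrow> real"
    using that finite_U by (intro integral_mono) auto
  \<comment> \<open>\<open>near1\<close> yields \<open>2 * G\<close> times the overlaps and the term
    \<open>T = S\<close>, which becomes the square; \<open>near0\<close> yields another
    \<open>2 * G\<close> times the overlaps. Products of two probabilities are majorized by
    \<open>prod q (S \<union> T)\<close>.\<close>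
  have one: "\<bar>prod q S * expect (\<lambda>E. u 1 E - v S E) + expect (\<lambda>E. of_bool (S \<subseteq> E) * (v S E - u 0 E))\<bar>
    \<le> 4 * G * ((\<Sum>T\<in>nb S. prod q (S \<union> T)) + (prod q S)\<^sup>2)" if S: "S \<in> F" for S
  proof -
    have SA: "S \<in> A" using S F(1) by blast
    have SU: "S \<subseteq> U" and TU: "\<And>T. T \<in> nb S \<Longrightarrow> T \<subseteq> U"
      using A(2)[OF SA] A(2) by (simp_all add: nb_def)
    have fin: "finite (nb S)" using A by (simp add: nb_def)
    have Snb: "S \<notin> nb S" by (simp add: nb_def)
    have "\<bar>expect (\<lambda>E. u 1 E - v S E)\<bar> \<le> expect (\<lambda>E. 2 * G * (\<Sum>T\<in>insert S (nb S). of_bool (T \<subseteq> E)))"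
      by (rule order_trans[OF abs_expect mono[OF near1[OF S]]])
    also have "\<dots> = 2 * G * (\<Sum>T\<in>insert S (nb S). prod q T)"
    proof -
      have "expect (\<lambda>E. 2 * G * (\<Sum>T\<in>insert S (nb S). of_bool (T \<subseteq> E)))
          = 2 * G * (\<Sum>T\<in>insert S (nb S). expect (\<lambda>E. of_bool (T \<subseteq> E)))"
        using finite_U
        by (simp only: integral_mult_right_zero Bochner_Integration.integral_sum integrable_random_subset)
      also have "(\<Sum>T\<in>insert S (nb S). expect (\<lambda>E. of_bool (T \<subseteq> E))) = (\<Sum>T\<in>insert S (nb S). prod q T)"
        using finite_U SU TU q01
        by (intro sum.cong refl expectation_random_subset_prod) auto
      finally show ?thesis .
    qed
    finally have "prod q S * \<bar>expect (\<lambda>E. u 1 E - v S E)\<bar>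
        \<le> prod q S * (2 * G * (\<Sum>T\<in>insert S (nb S). prod q T))"
      using prod_nonneg_le_1[OF SU] by (intro mult_left_mono) auto
    also have "\<dots> = 2 * G * ((\<Sum>T\<in>nb S. prod q S * prod q T) + (prod q S)\<^sup>2)"
      using Snb fin by (simp add: algebra_simps sum_distrib_left power2_eq_square)
    also have "\<dots> \<le> 2 * G * ((\<Sum>T\<in>nb S. prod q (S \<union> T)) + (prod q S)\<^sup>2)"
      using G0 prod_mult_le_Un SU TU by (intro mult_left_mono add_mono sum_mono) auto
    finally have 1: "\<bar>prod q S * expect (\<lambda>E. u 1 E - v S E)\<bar>
        \<le> 2 * G * ((\<Sum>T\<in>nb S. prod q (S \<union> T)) + (prod q S)\<^sup>2)"
      using prod_nonneg_le_1[OF SU] by (simp add: abs_mult)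
    have "\<bar>expect (\<lambda>E. of_bool (S \<subseteq> E) * (v S E - u 0 E))\<bar>
        \<le> expect (\<lambda>E. 2 * G * (\<Sum>T\<in>nb S. of_bool (S \<union> T \<subseteq> E)))"
      by (rule order_trans[OF abs_expect mono[OF near0[OF S]]])
    also have "\<dots> = 2 * G * (\<Sum>T\<in>nb S. expect (\<lambda>E. of_bool (S \<union> T \<subseteq> E)))"
      using finite_U by (simp only: integral_mult_right_zero Bochner_Integration.integral_sum integrable_random_subset)
    also have "\<dots> = 2 * G * (\<Sum>T\<in>nb S. prod q (S \<union> T))"
      using finite_U SU TU q01
      by (intro arg_cong[where f = "\<lambda>x. 2 * G * x"] sum.cong refl expectation_random_subset_prod) auto
    finally have 2: "\<bar>expect (\<lambda>E. of_bool (S \<subseteq> E) * (v S E - u 0 E))\<bar>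
        \<le> 2 * G * (\<Sum>T\<in>nb S. prod q (S \<union> T))" .
    have "0 \<le> G * (prod q S)\<^sup>2" using G0 by simp
    then show ?thesis using 1 2 by (simp add: algebra_simps)
  qed
  have u1: "\<bar>expect (u 1)\<bar> \<le> G"
  proof -
    have "\<bar>expect (u 1)\<bar> \<le> expect (\<lambda>E. G)"
      by (rule order_trans[OF abs_expect mono]) (rule ug)
    then show ?thesis by simp
  qed
  have "\<bar>?D\<bar> \<le> (\<Sum>S\<in>F. 4 * G * ((\<Sum>T\<in>nb S. prod q (S \<union> T)) + (prod q S)\<^sup>2))"
    by (rule order_trans[OF sum_abs sum_mono[OF one]])
  \<comment> \<open>Summing over all of \<open>A\<close> makes the error the same for every family
    \<open>F\<close> inside \<open>A\<close>.\<close>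
  also have "\<dots> \<le> (\<Sum>S\<in>A. 4 * G * ((\<Sum>T\<in>nb S. prod q (S \<union> T)) + (prod q S)\<^sup>2))"
  proof (rule sum_mono2)
    fix S assume "S \<in> A - F"
    then show "0 \<le> 4 * G * ((\<Sum>T\<in>nb S. prod q (S \<union> T)) + (prod q S)\<^sup>2)"
      using G0 A(2) by (intro mult_nonneg_nonneg add_nonneg_nonneg sum_nonneg prod_nonneg_le_1)
        (auto simp: nb_def)
  qed (use A F in auto)
  also have "\<dots> = G * (4 * (overlap_sum q A + (\<Sum>S\<in>A. (prod q S)\<^sup>2)))"
    by (simp add: overlap_sum_def nb_def sum.distrib sum_distrib_left algebra_simps)
  finally have "\<bar>?D\<bar> \<le> G * (4 * (overlap_sum q A + (\<Sum>S\<in>A. (prod q S)\<^sup>2)))" .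
  moreover have "\<bar>(b - l) * expect (u 1)\<bar> \<le> G * \<bar>b - l\<bar>"
    using mult_right_mono[OF u1, of "\<bar>b - l\<bar>"] by (simp add: abs_mult mult.commute)
  ultimately show ?thesis
    unfolding eq distrib_left by linarith
qed

end

section \<open>The Poisson law and its Stein equation\<close>

lemma pmf_Po: "0 \<le> b \<Longrightarrow> pmf (Po b) i = b ^ i / fact i * exp (- b)"
  by (auto simp: Po_def pmf_poisson indicator_def)

lemma expectation_Po:
  fixes h :: "nat \<Rightarrow> real"
  assumes b: "0 \<le> b" and h: "\<And>i. \<bar>h i\<bar> \<le> H"
  shows "(\<lambda>i. h i * (b ^ i / fact i * exp (- b))) sums measure_pmf.expectation (Po b) h"
proof -
  have int: "integrable (measure_pmf (Po b)) h"
    by (rule measure_pmf.integrable_const_bound[where B = H]) (use h in auto)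
  have int': "integrable (count_space UNIV) (\<lambda>i. pmf (Po b) i * h i)"
    using int unfolding measure_pmf_eq_density by (subst (asm) integrable_density) auto
  have "measure_pmf.expectation (Po b) h = integral\<^sup>L (count_space UNIV) (\<lambda>i. pmf (Po b) i * h i)"
    unfolding measure_pmf_eq_density by (subst integral_density) auto
  moreover have "(\<lambda>i. pmf (Po b) i * h i) sums integral\<^sup>L (count_space UNIV) (\<lambda>i. pmf (Po b) i * h i)"
    by (rule sums_integral_count_space_nat[OF int'])
  ultimately show ?thesis using b by (simp add: pmf_Po mult.commute)
qed

text \<open>The bounded solution of the Stein equation \<open>b g (w + 1) - w g w = h w - E h (Po b)\<close>.
  Its value at \<open>0\<close> is irrelevant.\<close>

definition stein_solution :: "real \<Rightarrow> (nat \<Rightarrow> real) \<Rightarrow> nat \<Rightarrow> real" where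
  "stein_solution b h w = - (\<Sum>i. (h (w + i) - measure_pmf.expectation (Po b) h) *
     (b ^ i * (fact (w - 1) / fact (w + i))))"

text \<open>This dominates the series of the Stein solution by an exponential series, uniformly in
  \<open>w\<close>. For \<open>w = 0\<close> the numerator is \<open>fact 0\<close>.\<close>

lemma fact_quotient_le: "fact (w - 1) / fact (w + i) \<le> 1 / (fact i :: real)"
proof -
  have "fact i * fact w \<le> (fact (w + i) :: nat)"
    using fact_fact_dvd_fact[of i w] by (intro dvd_imp_le) (auto simp: add.commute)
  then have "fact i * fact w \<le> (fact (w + i) :: real)"
    by (metis of_nat_fact of_nat_le_iff of_nat_mult)
  moreover have "fact (w - 1) \<le> (fact w :: real)" by (rule fact_mono) simp
  ultimately have "fact i * fact (w - 1) \<le> (fact (w + i) :: real)"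
    by (meson fact_ge_zero mult_left_mono order_trans)
  then show ?thesis by (simp add: field_simps)
qed

context
  fixes b H :: real and h :: "nat \<Rightarrow> real"
  assumes b: "0 \<le> b" and h: "\<And>i. \<bar>h i\<bar> \<le> H"
begin

lemma expectation_Po_bound: "\<bar>measure_pmf.expectation (Po b) h\<bar> \<le> H"
proof -
  have "\<bar>measure_pmf.expectation (Po b) h\<bar> \<le> measure_pmf.expectation (Po b) (\<lambda>i. \<bar>h i\<bar>)"
    using integral_norm_bound[of "measure_pmf (Po b)" h] by simp
  also have "\<dots> \<le> measure_pmf.expectation (Po b) (\<lambda>i. H)"
    by (rule integral_mono) (use h in \<open>auto intro!: measure_pmf.integrable_const_bound[where B = H]\<close>)
  finally show ?thesis by simp
qed

lemma stein_term_bound: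
  "norm ((h (w + i) - measure_pmf.expectation (Po b) h) * (b ^ i * (fact (w - 1) / fact (w + i))))
    \<le> 2 * H * (b ^ i / fact i)"
proof -
  have 1: "\<bar>h (w + i) - measure_pmf.expectation (Po b) h\<bar> \<le> 2 * H"
    using h[of "w + i"] expectation_Po_bound by linarith
  have 2: "b ^ i * (fact (w - 1) / fact (w + i)) \<le> b ^ i * (1 / fact i)"
    using b fact_quotient_le[of w i] by (intro mult_left_mono) auto
  have "\<bar>h (w + i) - measure_pmf.expectation (Po b) h\<bar> * (b ^ i * (fact (w - 1) / fact (w + i)))
      \<le> 2 * H * (b ^ i * (1 / fact i))"
    by (rule mult_mono[OF 1 2]) (use b 1 in auto)
  then show ?thesis using b by (simp add: abs_mult)
qed

lemma exp_series: "(\<lambda>i. 2 * H * (b ^ i / fact i)) sums (2 * H * exp b)"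
  using sums_mult[OF exp_converges[of b], of "2 * H"] by (simp add: divide_inverse mult.commute)

lemma stein_solution_bound: "\<bar>stein_solution b h w\<bar> \<le> 2 * H * exp b"
proof -
  have "norm (\<Sum>i. (h (w + i) - measure_pmf.expectation (Po b) h) * (b ^ i * (fact (w - 1) / fact (w + i))))
      \<le> (\<Sum>i. 2 * H * (b ^ i / fact i))"
    using exp_series by (intro norm_suminf_le stein_term_bound) (auto simp: sums_iff)
  then show ?thesis using exp_series by (simp add: stein_solution_def sums_iff)
qed

text \<open>Multiplying the series at \<open>Suc w\<close> by \<open>b\<close> shifts the series of
  the \<open>c i\<close> by one index, so the difference of the two series is the single term
  \<open>c 0\<close>. For \<open>w = 0\<close> the factor \<open>w\<close> makes one side vanish;
  the series vanishes as well, being \<open>exp b\<close> times the Poisson mean of the centred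
  function.\<close>

lemma stein_equation:
  "b * stein_solution b h (Suc w) - real w * stein_solution b h w
    = h w - measure_pmf.expectation (Po b) h"
proof -
  let ?m = "measure_pmf.expectation (Po b) h"
  have summable: "summable (\<lambda>i. (h (w + i) - ?m) * (b ^ i * (fact (w - 1) / fact (w + i))))" for w
    using exp_series by (intro summable_comparison_test'[OF _ stein_term_bound]) (auto simp: sums_iff)
  define c where "c i = (h (w + i) - ?m) * (b ^ i * (fact w / fact (w + i)))" for i
  have "(\<lambda>i. b * ((h (Suc w + i) - ?m) * (b ^ i * (fact (Suc w - 1) / fact (Suc w + i))))) = (\<lambda>i. c (Suc i))"
    by (auto simp: c_def)
  then have cS: "summable (\<lambda>i. c (Suc i))" "b * stein_solution b h (Suc w) = - (\<Sum>i. c (Suc i))"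
    using summable_mult[OF summable[of "Suc w"], of b] suminf_mult[OF summable[of "Suc w"], of b]
    by (auto simp: stein_solution_def)
  then have sc: "summable c" using summable_Suc_iff by blast
  have "real w * stein_solution b h w = - (\<Sum>i. c i)"
  proof (cases w)
    case 0
    have "(\<lambda>i. h i * (b ^ i / fact i * exp (- b)) - ?m * (1 * (b ^ i / fact i * exp (- b)))) sums (?m - ?m * 1)"
      using expectation_Po[OF b, of h H] expectation_Po[OF b, of "\<lambda>_. 1" 1] h
      by (intro sums_diff sums_mult) auto
    then have "(\<lambda>i. c i * exp (- b)) sums 0"
      by (simp add: c_def 0 algebra_simps)
    then have "(\<lambda>i. c i * exp (- b) * exp b) sums (0 * exp b)" by (rule sums_mult2)
    then have "c sums 0" by (simp add: mult.assoc flip: exp_add)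
    then show ?thesis using 0 by (simp add: sums_iff)
  next
    case (Suc w')
    have "(\<lambda>i. real w * ((h (w + i) - ?m) * (b ^ i * (fact (w - 1) / fact (w + i))))) = c"
      by (auto simp: c_def Suc fun_eq_iff field_simps)
    then show ?thesis using suminf_mult[OF summable[of w], of "real w"]
      by (simp add: stein_solution_def)
  qed
  moreover have "(\<Sum>i. c (Suc i)) = (\<Sum>i. c i) - c 0" by (rule suminf_split_head[OF sc])
  ultimately show ?thesis using cS by (simp add: c_def)
qed

end

section \<open>Joint approximation by independent Poisson variables\<close>

lemma Po_product_prob_space: "product_prob_space (\<lambda>j::nat. measure_pmf (Po (b j)))"
  by (simp add: product_prob_space_def product_prob_space_axioms_def product_sigma_finite_def
      measure_pmf.prob_space_axioms prob_space_imp_sigma_finite)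

text \<open>A product of finitely many countable discrete spaces is discrete.\<close>

lemma measurable_PiM_Po:
  fixes f :: "(nat \<Rightarrow> nat) \<Rightarrow> real"
  assumes "finite J"
  shows "f \<in> borel_measurable (PiM J (\<lambda>j. measure_pmf (Po (b j))))"
proof -
  have "sets (PiM J (\<lambda>j. measure_pmf (Po (b j)))) = sets (PiM J (\<lambda>j. count_space (UNIV :: nat set)))"
    by (rule sets_PiM_cong) auto
  also have "PiM J (\<lambda>j. count_space (UNIV :: nat set)) = count_space (PiE J (\<lambda>_. UNIV))"
    by (rule count_space_PiM_finite) (use assms in auto)
  finally have "sets (PiM J (\<lambda>j. measure_pmf (Po (b j)))) = Pow (PiE J (\<lambda>_. UNIV))" by simp
  then show ?thesis by (intro measurableI) (auto simp: space_PiM)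
qed

context independent_edges
begin

text \<open>The counts are exchanged for independent Poisson variables one at a time: averaging
  \<open>f\<close> over the last coordinate gives a function of the earlier counts with the same
  bound \<open>H\<close>. The set \<open>A\<close> contains all \<open>N\<close> families, so the
  overlap error does not change during the induction.\<close>

lemma stein_chen_joint:
  fixes F :: "nat \<Rightarrow> 'e set set" and b :: "nat \<Rightarrow> real" and f :: "(nat \<Rightarrow> nat) \<Rightarrow> real"
  assumes F: "\<And>j. j < N \<Longrightarrow> finite (F j)" "\<And>j S. j < N \<Longrightarrow> S \<in> F j \<Longrightarrow> S \<subseteq> U \<and> S \<noteq> {}"
    and disj: "\<And>i j. i < N \<Longrightarrow> j < N \<Longrightarrow> i \<noteq> j \<Longrightarrow> F i \<inter> F j = {}"
    and b: "\<And>j. 0 \<le> b j" and f: "\<And>w. \<bar>f w\<bar> \<le> H" and K: "K \<le> N"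
  defines "A \<equiv> \<Union>j<N. F j"
  shows "\<bar>expect (\<lambda>E. f (\<lambda>j\<in>{..<K}. copies_in (F j) E))
      - integral\<^sup>L (PiM {..<K} (\<lambda>j. measure_pmf (Po (b j)))) f\<bar>
    \<le> (\<Sum>j<K. 2 * H * exp (b j) * (\<bar>b j - (\<Sum>S\<in>F j. prod q S)\<bar>
        + 4 * (overlap_sum q A + (\<Sum>S\<in>A. (prod q S)\<^sup>2))))"
  using K f
proof (induction K arbitrary: f)
  case 0
  then show ?case by (simp add: restrict_def PiM_empty lebesgue_integral_count_space_finite)
next
  case (Suc K)
  interpret product_prob_space "\<lambda>j::nat. measure_pmf (Po (b j))" by (rule Po_product_prob_space)
  let ?P = "\<lambda>J. PiM J (\<lambda>j. measure_pmf (Po (b j)))"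
  define f' where "f' x = measure_pmf.expectation (Po (b K)) (\<lambda>t. f (x(K := t)))" for x
  have f'H: "\<bar>f' x\<bar> \<le> H" for x
    unfolding f'_def by (rule expectation_Po_bound[OF b]) (rule Suc.prems)
  have int: "integrable (?P J) f" if "finite J" for J
  proof -
    interpret pr: prob_space "?P J" by (rule prob_space_PiM) (simp add: measure_pmf.prob_space_axioms)
    show ?thesis by (rule pr.integrable_const_bound[where B = H])
      (use Suc.prems measurable_PiM_Po[OF that] in auto)
  qed
  have "integral\<^sup>L (?P {..<Suc K}) f = integral\<^sup>L (?P {..<K}) f'"
    using product_integral_insert[of "{..<K}" K f] int[of "{..<Suc K}"]
    by (simp add: lessThan_Suc f'_def[abs_def])
  moreover have "\<bar>expect (\<lambda>E. f' (\<lambda>j\<in>{..<K}. copies_in (F j) E)) - integral\<^sup>L (?P {..<K}) f'\<bar>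
      \<le> (\<Sum>j<K. 2 * H * exp (b j) * (\<bar>b j - (\<Sum>S\<in>F j. prod q S)\<bar>
        + 4 * (overlap_sum q A + (\<Sum>S\<in>A. (prod q S)\<^sup>2))))"
    using Suc.prems f'H by (intro Suc.IH) auto
  moreover have "\<bar>expect (\<lambda>E. f (\<lambda>j\<in>{..<Suc K}. copies_in (F j) E))
      - expect (\<lambda>E. f' (\<lambda>j\<in>{..<K}. copies_in (F j) E))\<bar>
    \<le> 2 * H * exp (b K) * (\<bar>b K - (\<Sum>S\<in>F K. prod q S)\<bar>
        + 4 * (overlap_sum q A + (\<Sum>S\<in>A. (prod q S)\<^sup>2)))"
  proof -
    \<comment> \<open>The vector of earlier counts, read off from the set of present earlier copies,
      as \<open>stein_chen_step\<close> expects.\<close>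
    define \<rho> where "\<rho> X = (\<lambda>j\<in>{..<K}. card (X \<inter> F j))" for X :: "'e set set"
    define F' where "F' = (\<Union>j<K. F j)"
    \<comment> \<open>The Stein equation is solved in the last coordinate, with the earlier counts
      as parameters.\<close>
    define g where "g w c = stein_solution (b K) (\<lambda>t. f (c(K := t))) w" for w c
    have \<rho>: "\<rho> {T \<in> F'. T \<subseteq> E} = (\<lambda>j\<in>{..<K}. copies_in (F j) E)" for E
    proof -
      have "{T \<in> F'. T \<subseteq> E} \<inter> F j = {T \<in> F j. T \<subseteq> E}" if "j < K" for j
        using that by (auto simp: F'_def)
      then show ?thesis by (auto simp: \<rho>_def copies_in_def)
    qed
    have "f (\<lambda>j\<in>{..<Suc K}. copies_in (F j) E) - f' (\<lambda>j\<in>{..<K}. copies_in (F j) E)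
      = b K * g (copies_in (F K) E + 1) (\<rho> {T \<in> F'. T \<subseteq> E})
        - real (copies_in (F K) E) * g (copies_in (F K) E + 0) (\<rho> {T \<in> F'. T \<subseteq> E})" for E
    proof -
      have "(\<lambda>j\<in>{..<Suc K}. copies_in (F j) E) = (\<lambda>j\<in>{..<K}. copies_in (F j) E)(K := copies_in (F K) E)"
        by (auto simp: restrict_def)
      then show ?thesis
        using stein_equation[OF b[of K], of "\<lambda>t. f ((\<lambda>j\<in>{..<K}. copies_in (F j) E)(K := t))" H "copies_in (F K) E"]
          Suc.prems(2) unfolding \<rho> g_def f'_def by (simp only: Suc_eq_plus1 add_0_right)
    qed
    then have eq: "expect (\<lambda>E. f (\<lambda>j\<in>{..<Suc K}. copies_in (F j) E))
      - expect (\<lambda>E. f' (\<lambda>j\<in>{..<K}. copies_in (F j) E))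
      = expect (\<lambda>E. b K * g (copies_in (F K) E + 1) (\<rho> {T \<in> F'. T \<subseteq> E})
        - real (copies_in (F K) E) * g (copies_in (F K) E + 0) (\<rho> {T \<in> F'. T \<subseteq> E}))"
      by (subst Bochner_Integration.integral_diff[symmetric]) (use finite_U in simp_all)
    show ?thesis unfolding eq
    proof (rule stein_chen_step)
      show "finite A" "\<And>S. S \<in> A \<Longrightarrow> S \<subseteq> U \<and> S \<noteq> {}"
        using F unfolding A_def by auto
      have "K \<in> {..<N}" "{..<K} \<subseteq> {..<N}" using Suc.prems(1) by auto
      then show "F K \<subseteq> A" "F' \<subseteq> A" unfolding A_def F'_def by (blast, meson UN_mono order_refl)
      have "F K \<inter> F j = {}" if "j < K" for j using disj[of K j] Suc.prems(1) that by simp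
      then show "F K \<inter> F' = {}" unfolding F'_def by blast
      show "\<bar>g w c\<bar> \<le> 2 * H * exp (b K)" for w c
        unfolding g_def by (rule stein_solution_bound[OF b]) (rule Suc.prems)
    qed (rule b)
  qed
  ultimately show ?case unfolding sum.lessThan_Suc by linarith
qed

end

section \<open>The conditional law of the graph as a random edge set\<close>

lemma graph_given_eq:
  "graph_given \<kappa> n xs = map_pmf (to_graph (length xs))
    (random_subset (pairs_below (length xs)) (\<lambda>(i, j). min (\<kappa> (xs ! i) (xs ! j) / n) 1))"
proof -
  have "(\<lambda>(i, j). bernoulli_pmf (min (\<kappa> (xs ! i) (xs ! j) / n) 1))
      = (\<lambda>e. bernoulli_pmf ((\<lambda>(i, j). min (\<kappa> (xs ! i) (xs ! j) / n) 1) e))" by auto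
  then show ?thesis
    unfolding graph_given_def random_subset_def map_pmf_comp
    by (intro map_pmf_cong) (auto simp: to_graph_def pairs_below_def)
qed

section \<open>Counting overlapping copies\<close>

lemma sum_lists_prod:
  fixes w :: "nat \<Rightarrow> 'b \<Rightarrow> real"
  assumes "finite V"
  shows "(\<Sum>vs | length vs = r \<and> set vs \<subseteq> V. \<Prod>i<r. w i (vs ! i)) = (\<Prod>i<r. \<Sum>a\<in>V. w i a)"
proof (induction r arbitrary: w)
  case (Suc r)
  have "{vs. length vs = Suc r \<and> set vs \<subseteq> V} = (\<lambda>(a, vs). a # vs) ` (V \<times> {vs. length vs = r \<and> set vs \<subseteq> V})"
    by (auto simp: length_Suc_conv image_iff)
  moreover have "inj_on (\<lambda>(a, vs). a # vs) (V \<times> {vs. length vs = r \<and> set vs \<subseteq> V})"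
    by (auto simp: inj_on_def)
  ultimately have "(\<Sum>vs | length vs = Suc r \<and> set vs \<subseteq> V. \<Prod>i<Suc r. w i (vs ! i))
      = (\<Sum>(a, vs)\<in>V \<times> {vs. length vs = r \<and> set vs \<subseteq> V}. w 0 a * (\<Prod>i<r. w (Suc i) (vs ! i)))"
    by (simp add: sum.reindex prod.lessThan_Suc_shift case_prod_beta' o_def del: prod.lessThan_Suc)
  also have "\<dots> = (\<Sum>a\<in>V. w 0 a) * (\<Sum>vs | length vs = r \<and> set vs \<subseteq> V. \<Prod>i<r. w (Suc i) (vs ! i))"
    by (simp add: sum_product sum.cartesian_product)
  finally show ?case using Suc[of "\<lambda>i. w (Suc i)"]
    by (simp add: prod.lessThan_Suc_shift del: prod.lessThan_Suc)
next
  case 0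
  have "{vs. length vs = 0 \<and> set vs \<subseteq> V} = {[]}" by auto
  then show ?case by simp
qed

lemma sum_inj_lists_le:
  fixes w :: "nat \<Rightarrow> real"
  assumes "\<And>a. 0 \<le> w a"
  shows "(\<Sum>vs\<in>inj_lists r v. \<Prod>i<r. w (vs ! i)) \<le> (\<Sum>a<v. w a) ^ r"
proof -
  have "finite {vs. length vs = r \<and> set vs \<subseteq> {..<v}}"
    using finite_lists_length_eq[of "{..<v}" r] by (simp add: conj_commute)
  then have "(\<Sum>vs\<in>inj_lists r v. \<Prod>i<r. w (vs ! i))
      \<le> (\<Sum>vs | length vs = r \<and> set vs \<subseteq> {..<v}. \<Prod>i<r. w (vs ! i))"
    using assms by (intro sum_mono2 prod_nonneg) (auto simp: inj_lists_def)
  then show ?thesis by (simp add: sum_lists_prod[where w = "\<lambda>_. w"])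
qed

lemma card_inj_lists_le: "real (card (inj_lists r v)) \<le> real v ^ r"
  using sum_inj_lists_le[of "\<lambda>_. 1" r v] by simp

lemma card_copies_le: "real (card (copies r k v)) \<le> real v ^ r"
proof -
  have "card (copies r k v) \<le> card (inj_lists r v)" unfolding copies_def by (rule card_image_le) simp
  then show ?thesis using card_inj_lists_le[of r v] by linarith
qed

text \<open>Every vertex outside \<open>A\<close> can be charged to its own edge with an end outside
  \<open>A\<close>, and such an edge is not in \<open>S\<close>. On a cycle each vertex is charged
  to the edge that leaves it, so an edge leading from \<open>A\<close> to its complement is a
  surplus; if the cycle stays in \<open>A\<close>, any edge outside \<open>S\<close> is.\<close>

lemma card_new_edges:
  assumes shape: "shape r k \<sigma>" and ws: "ws \<in> inj_lists r v"
    and S: "\<And>a b. (a, b) \<in> S \<Longrightarrow> a \<in> A \<and> b \<in> A" and meet: "\<exists>i<r. ws ! i \<in> A"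
  shows "card {i. i < r \<and> ws ! i \<notin> A} \<le> card (walk_edges k ws - S)"
    and "r = k \<Longrightarrow> \<not> walk_edges k ws \<subseteq> S \<Longrightarrow>
      card {i. i < r \<and> ws ! i \<notin> A} < card (walk_edges k ws - S)"
proof -
  have len: "length ws = r" "distinct ws" using ws by (auto simp: inj_lists_def)
  define e where "e i = ordered_edge (ws ! i) (ws ! (Suc i mod r))" for i
  define X where "X = {i. i < k \<and> (ws ! i \<notin> A \<or> ws ! (Suc i mod r) \<notin> A)}"
  let ?O = "{i. i < r \<and> ws ! i \<notin> A}"
  have finX: "finite X" by (simp add: X_def)
  have inj: "inj_on e {..<k}" using inj_on_walk[OF shape len] len by (simp add: e_def[abs_def])
  have "e ` X \<subseteq> walk_edges k ws - S"
  proof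
    fix y assume "y \<in> e ` X"
    then obtain i where i: "i < k" "ws ! i \<notin> A \<or> ws ! (Suc i mod r) \<notin> A" "y = e i"
      by (auto simp: X_def)
    have "e i \<notin> S"
      using S[of "fst (e i)" "snd (e i)"] i(2) by (auto simp: e_def ordered_edge_def min_def max_def split: if_splits)
    moreover have "e i \<in> walk_edges k ws" using i(1) len by (simp add: e_def walk_edges_def)
    ultimately show "y \<in> walk_edges k ws - S" using i(3) by simp
  qed
  then have "card (e ` X) \<le> card (walk_edges k ws - S)" by (intro card_mono) auto
  moreover have "inj_on e X" by (rule inj_on_subset[OF inj]) (auto simp: X_def)
  ultimately have cX: "card X \<le> card (walk_edges k ws - S)" by (simp add: card_image)
  obtain j where j: "j < r" "ws ! j \<in> A" using meet by blast
  have cycle: "card ?O < card (walk_edges k ws - S)" if rk: "r = k" and nsub: "\<not> walk_edges k ws \<subseteq> S"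
  proof (cases "?O = {}")
    case True
    have "0 < card (walk_edges k ws - S)" using nsub by (simp add: card_gt_0_iff)
    then show ?thesis unfolding True by simp
  next
    case False
    \<comment> \<open>Going around from position \<open>j\<close> without ever leaving
      \<open>A\<close> would place all vertices in \<open>A\<close>.\<close>
    have "\<exists>i<r. ws ! i \<in> A \<and> ws ! (Suc i mod r) \<notin> A"
    proof (rule ccontr)
      assume *: "\<not> ?thesis"
      have all: "ws ! ((j + m) mod r) \<in> A" for m
      proof (induction m)
        case (Suc m)
        have "(j + m) mod r < r" using j by simp
        then have "ws ! (Suc ((j + m) mod r) mod r) \<in> A" using * Suc by blast
        then show ?case by (simp add: mod_Suc_eq)
      qed (use j in simp)
      obtain i where i: "i < r" "ws ! i \<notin> A" using False by blast
      have "(j + (r - j + i)) mod r = i" using i j by simp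
      then show False using all[of "r - j + i"] i by simp
    qed
    then obtain i where "i \<in> X" "i \<notin> ?O" using rk by (auto simp: X_def)
    moreover have "?O \<subseteq> X" using rk by (auto simp: X_def)
    ultimately have "?O \<subset> X" by blast
    then have "card ?O < card X" by (rule psubset_card_mono[OF finX])
    then show ?thesis using cX by linarith
  qed
  show "r = k \<Longrightarrow> \<not> walk_edges k ws \<subseteq> S \<Longrightarrow> card ?O < card (walk_edges k ws - S)"
    by (rule cycle)
  consider "r = Suc k" | "r = k" using shape by (auto simp: shape_def)
  then have "card ?O \<le> card X"
  proof cases
    case 1
    \<comment> \<open>Vertex \<open>i\<close> is charged to the edge next to it on the side of
      \<open>j\<close>, so the index shifts by one beyond \<open>j\<close>.\<close>
    let ?f = "\<lambda>i. if i < j then i else i - 1"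
    have ne: "i \<noteq> j" if "i \<in> ?O" for i using that j by auto
    have "inj_on ?f ?O"
    proof (rule inj_onI)
      fix x y assume xy: "x \<in> ?O" "y \<in> ?O" and eq: "?f x = ?f y"
      have "x \<noteq> j" "y \<noteq> j" using ne xy by blast+
      then show "x = y" using eq by (cases "x < j"; cases "y < j") auto
    qed
    moreover have "?f ` ?O \<subseteq> X"
    proof (rule image_subsetI)
      fix i assume i: "i \<in> ?O"
      show "?f i \<in> X"
      proof (cases "i < j")
        case False
        then have "Suc (i - 1) = i" "i - 1 < k" using ne[OF i] i 1 by auto
        then show ?thesis using False i 1 by (auto simp: X_def)
      qed (use i j 1 in \<open>auto simp: X_def\<close>)
    qed
    ultimately show ?thesis using card_inj_on_le finX by blast
  next
    case 2
    then show ?thesis using finX by (intro card_mono) (auto simp: X_def)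
  qed
  then show "card ?O \<le> card (walk_edges k ws - S)" using cX by linarith
qed

text \<open>With weight 1 for vertices of \<open>S\<close> and weight \<open>p\<close> for all
  others, \<open>card_new_edges\<close> bounds \<open>p ^ card (T - S)\<close> by the product of the
  vertex weights along \<open>T\<close>. The sum of these products is at most the power
  \<open>r'\<close> of the total weight, which is at most \<open>real r + c\<close>. For cycles the
  surplus edge leaves a factor \<open>p\<close>.\<close>

lemma sum_overlapping_copies:
  assumes shape: "shape r k \<sigma>" "shape r' k' \<sigma>'" and S: "S \<in> copies r k v"
    and p: "0 \<le> p" "p \<le> 1" and c: "p * real v \<le> c"
  shows "(\<Sum>T\<in>{T \<in> copies r' k' v. T \<inter> S \<noteq> {}}. p ^ card (T - S)) \<le> (real r + c) ^ r'"
    and "r' = k' \<Longrightarrow> (\<Sum>T\<in>{T \<in> copies r' k' v. T \<inter> S \<noteq> {} \<and> \<not> T \<subseteq> S}. p ^ card (T - S))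
      \<le> p * (real r + c) ^ r'"
proof -
  obtain vs where vs: "vs \<in> inj_lists r v" "S = walk_edges k vs" using S by (auto simp: copies_def)
  define A where "A = set vs"
  have lenvs: "length vs = r" using vs by (simp add: inj_lists_def)
  have ends: "fst ` S \<union> snd ` S = A"
    using ends_walk_edges[of vs k \<sigma>] shape lenvs vs by (simp add: A_def)
  have SA: "a \<in> A \<and> b \<in> A" if "(a, b) \<in> S" for a b using that ends by force
  have cardA: "card A \<le> r" using lenvs card_length[of vs] by (simp add: A_def)
  define w where "w a = (if a \<in> A then 1 else p)" for a :: nat
  have w0: "0 \<le> w a" for a using p by (simp add: w_def)
  have "(\<Sum>a<v. w a) \<le> (\<Sum>a<v. of_bool (a \<in> A) + p)"
    using p by (intro sum_mono) (simp add: w_def)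
  also have "\<dots> = real (card ({..<v} \<inter> A)) + p * real v"
    by (simp add: sum.distrib mult.commute of_bool_def sum.If_cases)
  also have "\<dots> \<le> real r + c"
  proof -
    have "card ({..<v} \<inter> A) \<le> card A" by (rule card_mono) (auto simp: A_def)
    then show ?thesis using cardA c by linarith
  qed
  finally have sw: "(\<Sum>a<v. w a) \<le> real r + c" .
  have "(\<Sum>vs\<in>inj_lists r' v. \<Prod>i<r'. w (vs ! i)) \<le> (\<Sum>a<v. w a) ^ r'"
    by (rule sum_inj_lists_le) (rule w0)
  also have "\<dots> \<le> (real r + c) ^ r'"
    by (rule power_mono[OF sw]) (simp add: sum_nonneg w0)
  finally have total: "(\<Sum>vs\<in>inj_lists r' v. \<Prod>i<r'. w (vs ! i)) \<le> (real r + c) ^ r'" .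
  have pw: "(\<Prod>i<r'. w (ws ! i)) = p ^ card {i. i < r' \<and> ws ! i \<notin> A}" for ws
  proof -
    have "{..<r'} \<inter> {x. ws ! x \<notin> A} = {i. i < r' \<and> ws ! i \<notin> A}" by auto
    then show ?thesis by (simp add: w_def prod.If_cases Compl_eq)
  qed
  have meet: "\<exists>i<r'. ws ! i \<in> A" if ws: "ws \<in> inj_lists r' v" "walk_edges k' ws \<inter> S \<noteq> {}" for ws
  proof -
    obtain x where x: "x \<in> walk_edges k' ws" "x \<in> S" using ws by blast
    have "fst x \<in> set ws" using x ends_walk_edges[of ws k' \<sigma>'] shape ws by (auto simp: inj_lists_def)
    moreover have "fst x \<in> A" using x SA[of "fst x" "snd x"] by simp
    ultimately show ?thesis using ws by (auto simp: inj_lists_def in_set_conv_nth)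
  qed
  have "(\<Sum>T\<in>{T \<in> copies r' k' v. T \<inter> S \<noteq> {}}. p ^ card (T - S))
      = (\<Sum>T\<in>copies r' k' v. if T \<inter> S \<noteq> {} then p ^ card (T - S) else 0)"
    by (rule sum.inter_filter) simp
  also have "\<dots> \<le> (\<Sum>ws\<in>inj_lists r' v. if walk_edges k' ws \<inter> S \<noteq> {} then p ^ card (walk_edges k' ws - S) else 0)"
    by (rule sum_copies_le) (use p in simp)
  also have "\<dots> \<le> (\<Sum>vs\<in>inj_lists r' v. \<Prod>i<r'. w (vs ! i))"
  proof (rule sum_mono)
    fix ws assume ws: "ws \<in> inj_lists r' v"
    show "(if walk_edges k' ws \<inter> S \<noteq> {} then p ^ card (walk_edges k' ws - S) else 0) \<le> (\<Prod>i<r'. w (ws ! i))"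
    proof (cases "walk_edges k' ws \<inter> S = {}")
      case False
      have "card {i. i < r' \<and> ws ! i \<notin> A} \<le> card (walk_edges k' ws - S)"
        by (rule card_new_edges(1)[OF shape(2) ws SA meet[OF ws False]])
      then show ?thesis using p False by (simp add: pw power_decreasing)
    qed (simp add: w0 prod_nonneg)
  qed
  finally show "(\<Sum>T\<in>{T \<in> copies r' k' v. T \<inter> S \<noteq> {}}. p ^ card (T - S)) \<le> (real r + c) ^ r'"
    using total by linarith
  assume rk: "r' = k'"
  have "(\<Sum>T\<in>{T \<in> copies r' k' v. T \<inter> S \<noteq> {} \<and> \<not> T \<subseteq> S}. p ^ card (T - S))
      = (\<Sum>T\<in>copies r' k' v. if T \<inter> S \<noteq> {} \<and> \<not> T \<subseteq> S then p ^ card (T - S) else 0)"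
    by (rule sum.inter_filter) simp
  also have "\<dots> \<le> (\<Sum>ws\<in>inj_lists r' v. if walk_edges k' ws \<inter> S \<noteq> {} \<and> \<not> walk_edges k' ws \<subseteq> S
      then p ^ card (walk_edges k' ws - S) else 0)"
    by (rule sum_copies_le) (use p in simp)
  also have "\<dots> \<le> (\<Sum>vs\<in>inj_lists r' v. p * (\<Prod>i<r'. w (vs ! i)))"
  proof (rule sum_mono)
    fix ws assume ws: "ws \<in> inj_lists r' v"
    show "(if walk_edges k' ws \<inter> S \<noteq> {} \<and> \<not> walk_edges k' ws \<subseteq> S then p ^ card (walk_edges k' ws - S) else 0)
        \<le> p * (\<Prod>i<r'. w (ws ! i))"
    proof (cases "walk_edges k' ws \<inter> S \<noteq> {} \<and> \<not> walk_edges k' ws \<subseteq> S")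
      case True
      have "card {i. i < r' \<and> ws ! i \<notin> A} < card (walk_edges k' ws - S)"
        by (rule card_new_edges(2)[OF shape(2) ws SA meet[OF ws] rk]) (use True in auto)
      then have "p ^ card (walk_edges k' ws - S) \<le> p ^ Suc (card {i. i < r' \<and> ws ! i \<notin> A})"
        using p by (intro power_decreasing) auto
      then show ?thesis using True by (simp add: pw)
    next
      case False
      then show ?thesis by (simp only: if_False) (simp add: w0 p prod_nonneg)
    qed
  qed
  also have "\<dots> = p * (\<Sum>vs\<in>inj_lists r' v. \<Prod>i<r'. w (vs ! i))" by (simp add: sum_distrib_left)
  also have "\<dots> \<le> p * (real r + c) ^ r'" using total p by (intro mult_left_mono)
  finally show "(\<Sum>T\<in>{T \<in> copies r' k' v. T \<inter> S \<noteq> {} \<and> \<not> T \<subseteq> S}. p ^ card (T - S))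
      \<le> p * (real r + c) ^ r'" .
qed

lemma sum_UN_le:
  fixes f :: "'b \<Rightarrow> real"
  assumes "finite J" "\<And>j. j \<in> J \<Longrightarrow> finite (F j)" "\<And>x. 0 \<le> f x"
  shows "sum f (\<Union>j\<in>J. F j) \<le> (\<Sum>j\<in>J. sum f (F j))"
  using assms
proof (induction J)
  case (insert j J)
  have "sum f (F j \<union> (\<Union>j\<in>J. F j)) \<le> sum f (F j) + sum f (\<Union>j\<in>J. F j)"
    using insert by (subst sum_Un) (auto intro!: sum_nonneg)
  then show ?case using insert by (simp add: sum.insert)
qed simp

context
  fixes q :: "nat \<times> nat \<Rightarrow> real" and p c :: real and v :: nat
  assumes p: "0 \<le> p" "p \<le> 1" and c: "p * real v \<le> c"
begin

lemma c_nonneg: "0 \<le> c"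
proof -
  have "0 \<le> p * real v" using p by simp
  then show ?thesis using c by linarith
qed

lemma prod_Un_le:
  assumes "finite S" "finite T" and q: "\<And>e. e \<in> S \<union> T \<Longrightarrow> 0 \<le> q e \<and> q e \<le> p"
  shows "prod q (S \<union> T) \<le> p ^ card S * p ^ card (T - S)" "0 \<le> prod q (S \<union> T)"
proof -
  have "prod q (S \<union> T) \<le> (\<Prod>e\<in>S \<union> T. p)" using q by (intro prod_mono) auto
  also have "\<dots> = p ^ (card S + card (T - S))"
    using card_Un_disjoint[of S "T - S"] assms by (simp add: Un_Diff_cancel)
  finally show "prod q (S \<union> T) \<le> p ^ card S * p ^ card (T - S)" by (simp add: power_add)
  show "0 \<le> prod q (S \<union> T)" using q by (intro prod_nonneg) auto
qed

text \<open>In the applications \<open>p\<close> is of order \<open>1 / n\<close> and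
  \<open>v\<close> of order \<open>n\<close>, so \<open>c\<close> is a constant and only the power
  of \<open>v\<close> grows.\<close>

lemma sum_power_copies:
  assumes "shape r k \<sigma>" "F \<subseteq> copies r k v"
  shows "(\<Sum>S\<in>F. p ^ card S) \<le> real v ^ (r - k) * c ^ k"
proof -
  have "(\<Sum>S\<in>F. p ^ card S) \<le> (\<Sum>S\<in>copies r k v. p ^ card S)"
    using assms p by (intro sum_mono2) auto
  also have "\<dots> = real (card (copies r k v)) * p ^ k"
    using copies_nonempty[OF assms(1)] by simp
  also have "\<dots> \<le> real v ^ r * p ^ k"
    using card_copies_le p by (intro mult_right_mono) auto
  also have "\<dots> = real v ^ (r - k) * (p * real v) ^ k"
    using shapeD[OF assms(1)] by (simp add: power_mult_distrib flip: power_add)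
  also have "\<dots> \<le> real v ^ (r - k) * c ^ k"
    using c p by (intro mult_left_mono power_mono) auto
  finally show ?thesis .
qed

text \<open>Applied to paths, where \<open>r - k = 1\<close> makes the bound linear in
  \<open>v\<close>: negligible against the square of a mean of order \<open>n\<close>.\<close>

lemma overlap_sum_copies:
  assumes shape: "shape r k \<sigma>" and F: "F \<subseteq> copies r k v"
    and q: "\<And>e. e \<in> \<Union>F \<Longrightarrow> 0 \<le> q e \<and> q e \<le> p"
  shows "overlap_sum q F \<le> real v ^ (r - k) * c ^ k * (real r + c) ^ r"
proof -
  have "overlap_sum q F \<le> (\<Sum>S\<in>F. p ^ card S * (real r + c) ^ r)"
    unfolding overlap_sum_def
  proof (rule sum_mono)
    fix S assume S: "S \<in> F"
    have SC: "S \<in> copies r k v" using S F by blast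
    have finS: "finite S'" if "S' \<in> F" for S'
      using copies_nonempty[OF shape, of S' v] that F by blast
    have qF: "0 \<le> q e \<and> q e \<le> p" if "e \<in> S'" "S' \<in> F" for e S' using q that by blast
    have "(\<Sum>T\<in>{T \<in> F. T \<noteq> S \<and> T \<inter> S \<noteq> {}}. prod q (S \<union> T))
        \<le> (\<Sum>T\<in>{T \<in> F. T \<noteq> S \<and> T \<inter> S \<noteq> {}}. p ^ card S * p ^ card (T - S))"
    proof (intro sum_mono prod_Un_le)
      fix T assume "T \<in> {T \<in> F. T \<noteq> S \<and> T \<inter> S \<noteq> {}}"
      then show "finite S" "finite T" "\<And>e. e \<in> S \<union> T \<Longrightarrow> 0 \<le> q e \<and> q e \<le> p"
        using finS qF S by blast+
    qed
    also have "\<dots> = p ^ card S * (\<Sum>T\<in>{T \<in> F. T \<noteq> S \<and> T \<inter> S \<noteq> {}}. p ^ card (T - S))"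
      by (simp add: sum_distrib_left)
    also have "\<dots> \<le> p ^ card S * (\<Sum>T\<in>{T \<in> copies r k v. T \<inter> S \<noteq> {}}. p ^ card (T - S))"
    proof (intro mult_left_mono sum_mono2)
      show "{T \<in> F. T \<noteq> S \<and> T \<inter> S \<noteq> {}} \<subseteq> {T \<in> copies r k v. T \<inter> S \<noteq> {}}" using F by blast
    qed (use p in auto)
    also have "\<dots> \<le> p ^ card S * (real r + c) ^ r"
      using sum_overlapping_copies(1)[OF shape shape SC p c] p by (intro mult_left_mono) auto
    finally show "(\<Sum>T\<in>{T \<in> F. T \<noteq> S \<and> T \<inter> S \<noteq> {}}. prod q (S \<union> T)) \<le> p ^ card S * (real r + c) ^ r" .
  qed
  also have "\<dots> = (\<Sum>S\<in>F. p ^ card S) * (real r + c) ^ r" by (simp add: sum_distrib_right)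
  also have "\<dots> \<le> real v ^ (r - k) * c ^ k * (real r + c) ^ r"
    using sum_power_copies[OF shape F] c_nonneg by (intro mult_right_mono) auto
  finally show ?thesis .
qed

text \<open>Of two different overlapping cycles, one is not contained in the other, so that it has more
  new edges than new vertices.\<close>

lemma overlap_sum_cycles:
  fixes ks :: "nat \<Rightarrow> nat"
  assumes ks: "\<And>j. j < N \<Longrightarrow> 3 \<le> ks j" and F: "\<And>j. j < N \<Longrightarrow> F j \<subseteq> copies (ks j) (ks j) v"
    and q: "\<And>j S e. j < N \<Longrightarrow> S \<in> F j \<Longrightarrow> e \<in> S \<Longrightarrow> 0 \<le> q e \<and> q e \<le> p"
  defines "A \<equiv> \<Union>j<N. F j"
  shows "overlap_sum q A \<le> p * (2 * (\<Sum>i<N. \<Sum>j<N. c ^ ks i * (real (ks i) + c) ^ ks j))"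
    and "(\<Sum>S\<in>A. (prod q S)\<^sup>2) \<le> p * (\<Sum>i<N. c ^ ks i)"
proof -
  have finF: "finite (F j)" if "j < N" for j by (rule finite_subset[OF F[OF that]]) simp
  have fin: "finite A" using finF by (simp add: A_def)
  have finS: "finite S" if "S \<in> A" for S
    using that F copies_nonempty[OF shape_cycle[OF ks]] unfolding A_def by blast
  have qA: "0 \<le> q e \<and> q e \<le> p" if Se: "S \<in> A" "e \<in> S" for S e
  proof -
    obtain j where "j < N" "S \<in> F j" using Se(1) by (auto simp: A_def)
    then show ?thesis using q Se(2) by blast
  qed
  \<comment> \<open>The bound for an overlapping pair with \<open>S\<close> chosen first. It gains a
    factor \<open>p\<close> only if \<open>T\<close> adds an edge, which is true in at least one of
    the two orders; hence the symmetrized sum below.\<close>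
  define h where "h S T = (if T \<inter> S \<noteq> {} \<and> \<not> T \<subseteq> S then p ^ card S * p ^ card (T - S) else 0)"
    for S T :: "(nat \<times> nat) set"
  have h0: "0 \<le> h S T" for S T using p by (simp add: h_def)
  have "overlap_sum q A \<le> (\<Sum>S\<in>A. \<Sum>T\<in>A. h S T + h T S)"
    unfolding overlap_sum_def
  proof (rule sum_mono)
    fix S assume S: "S \<in> A"
    have "(\<Sum>T\<in>{T \<in> A. T \<noteq> S \<and> T \<inter> S \<noteq> {}}. prod q (S \<union> T))
        \<le> (\<Sum>T\<in>{T \<in> A. T \<noteq> S \<and> T \<inter> S \<noteq> {}}. h S T + h T S)"
    proof (rule sum_mono)
      fix T assume T: "T \<in> {T \<in> A. T \<noteq> S \<and> T \<inter> S \<noteq> {}}"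
      have "prod q (S \<union> T) \<le> p ^ card S * p ^ card (T - S)" "prod q (T \<union> S) \<le> p ^ card T * p ^ card (S - T)"
        using T S finS qA by (auto intro!: prod_Un_le)
      moreover have "\<not> T \<subseteq> S \<or> \<not> S \<subseteq> T" using T by blast
      ultimately show "prod q (S \<union> T) \<le> h S T + h T S"
        using T h0[of S T] h0[of T S] by (auto simp: h_def Un_commute Int_commute)
    qed
    also have "\<dots> \<le> (\<Sum>T\<in>A. h S T + h T S)"
      using fin h0 by (intro sum_mono2) (auto intro: add_nonneg_nonneg)
    finally show "(\<Sum>T\<in>{T \<in> A. T \<noteq> S \<and> T \<inter> S \<noteq> {}}. prod q (S \<union> T)) \<le> (\<Sum>T\<in>A. h S T + h T S)" .
  qed
  also have "\<dots> = 2 * (\<Sum>S\<in>A. \<Sum>T\<in>A. h S T)"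
    using sum.swap[of "\<lambda>S T. h T S" A A] by (simp add: sum.distrib)
  also have "\<dots> \<le> 2 * (\<Sum>i<N. \<Sum>j<N. p * (c ^ ks i * (real (ks i) + c) ^ ks j))"
  proof -
    have "(\<Sum>S\<in>A. \<Sum>T\<in>A. h S T) \<le> (\<Sum>i<N. \<Sum>S\<in>F i. \<Sum>T\<in>A. h S T)"
      unfolding A_def by (rule sum_UN_le) (use finF h0 in \<open>auto intro: sum_nonneg\<close>)
    also have "\<dots> \<le> (\<Sum>i<N. \<Sum>S\<in>F i. \<Sum>j<N. \<Sum>T\<in>F j. h S T)"
      unfolding A_def by (intro sum_mono sum_UN_le) (use finF h0 in auto)
    also have "\<dots> = (\<Sum>i<N. \<Sum>j<N. \<Sum>S\<in>F i. \<Sum>T\<in>F j. h S T)"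
      by (intro sum.cong refl sum.swap)
    also have "\<dots> \<le> (\<Sum>i<N. \<Sum>j<N. p * (c ^ ks i * (real (ks i) + c) ^ ks j))"
    proof (intro sum_mono)
      fix i j assume "i \<in> {..<N}" "j \<in> {..<N}"
      then have ij: "i < N" "j < N" by auto
      have "(\<Sum>S\<in>F i. \<Sum>T\<in>F j. h S T) \<le> (\<Sum>S\<in>F i. p ^ card S * (p * (real (ks i) + c) ^ ks j))"
      proof (rule sum_mono)
        fix S assume S: "S \<in> F i"
        have "(\<Sum>T\<in>F j. h S T) \<le> (\<Sum>T\<in>copies (ks j) (ks j) v. h S T)"
          using F ij h0 by (intro sum_mono2) auto
        also have "\<dots> = (\<Sum>T\<in>{T \<in> copies (ks j) (ks j) v. T \<inter> S \<noteq> {} \<and> \<not> T \<subseteq> S}. p ^ card S * p ^ card (T - S))"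
          unfolding h_def by (rule sum.inter_filter[symmetric]) simp
        also have "\<dots> = p ^ card S * (\<Sum>T\<in>{T \<in> copies (ks j) (ks j) v. T \<inter> S \<noteq> {} \<and> \<not> T \<subseteq> S}. p ^ card (T - S))"
          by (simp add: sum_distrib_left)
        also have "\<dots> \<le> p ^ card S * (p * (real (ks i) + c) ^ ks j)"
          using S F ij p
          by (intro mult_left_mono sum_overlapping_copies(2)[OF shape_cycle[OF ks] shape_cycle[OF ks] _ p c]) auto
        finally show "(\<Sum>T\<in>F j. h S T) \<le> p ^ card S * (p * (real (ks i) + c) ^ ks j)" .
      qed
      also have "\<dots> = (\<Sum>S\<in>F i. p ^ card S) * (p * (real (ks i) + c) ^ ks j)"
        by (simp add: sum_distrib_right)
      also have "\<dots> \<le> c ^ ks i * (p * (real (ks i) + c) ^ ks j)"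
        using sum_power_copies[OF shape_cycle[OF ks[OF ij(1)]] F[OF ij(1)]] p c_nonneg
        by (intro mult_right_mono) auto
      finally show "(\<Sum>S\<in>F i. \<Sum>T\<in>F j. h S T) \<le> p * (c ^ ks i * (real (ks i) + c) ^ ks j)"
        by (simp add: mult_ac)
    qed
    finally show ?thesis by simp
  qed
  finally show "overlap_sum q A \<le> p * (2 * (\<Sum>i<N. \<Sum>j<N. c ^ ks i * (real (ks i) + c) ^ ks j))"
    by (simp add: sum_distrib_left mult_ac)
  \<comment> \<open>One of the two factors \<open>prod q S\<close> is at most \<open>p\<close>,
    because a cycle has an edge.\<close>
  have sq: "(prod q S)\<^sup>2 \<le> p * p ^ card S" if "j < N" "S \<in> F j" for j S
  proof -
    have S: "S \<in> A" "finite S" "card S = ks j"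
      using that F[OF that(1)] copies_nonempty[OF shape_cycle[OF ks[OF that(1)]]] by (auto simp: A_def)
    have le: "prod q S \<le> p ^ card S" "0 \<le> prod q S"
      using prod_Un_le[of S "{}"] S qA by auto
    have "p ^ card S \<le> p ^ 1" using ks[OF that(1)] S p by (intro power_decreasing) auto
    then have "prod q S * prod q S \<le> p * p ^ card S" using le p by (intro mult_mono) auto
    then show ?thesis by (simp add: power2_eq_square)
  qed
  have "(\<Sum>S\<in>A. (prod q S)\<^sup>2) \<le> (\<Sum>i<N. \<Sum>S\<in>F i. (prod q S)\<^sup>2)"
    unfolding A_def by (rule sum_UN_le) (use finF in auto)
  also have "\<dots> \<le> (\<Sum>i<N. \<Sum>S\<in>F i. p * p ^ card S)"
    using sq by (intro sum_mono) auto
  also have "\<dots> = p * (\<Sum>i<N. \<Sum>S\<in>F i. p ^ card S)" by (simp add: sum_distrib_left)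
  also have "\<dots> \<le> p * (\<Sum>i<N. c ^ ks i)"
  proof (intro mult_left_mono sum_mono)
    fix i assume "i \<in> {..<N}"
    then have i: "i < N" by simp
    show "(\<Sum>S\<in>F i. p ^ card S) \<le> c ^ ks i"
      using sum_power_copies[OF shape_cycle[OF ks[OF i]] F[OF i]] by simp
  qed (rule p)
  finally show "(\<Sum>S\<in>A. (prod q S)\<^sup>2) \<le> p * (\<Sum>i<N. c ^ ks i)" .
qed

end

section \<open>Samples with good empirical distribution\<close>

definition hits :: "'a set \<Rightarrow> 'a list \<Rightarrow> nat" where
  "hits A xs = card {i. i < length xs \<and> xs ! i \<in> A}"

text \<open>A property of pairs of a sample and a parameter \<open>n\<close> holds eventually along this filter if it
  holds whenever \<open>n\<close> is large and the empirical frequencies of finitely many continuity sets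
  are close to their measures. All deterministic limit statements are made along it.\<close>

definition sample_filter :: "'a::topological_space measure \<Rightarrow> ('a list \<times> real) filter" where
  "sample_filter \<mu> = inf (filtercomap snd at_top)
     (INF A\<in>{A. continuity_set \<mu> A}.
        filtercomap (\<lambda>(xs, n). real (hits A xs) / n) (nhds (measure \<mu> A)))"

lemma filterlim_parameter: "filterlim snd at_top (sample_filter \<mu>)"
  by (rule filterlim_mono[OF filterlim_filtercomap order_refl]) (simp add: sample_filter_def)

lemma tendsto_hits:
  assumes "continuity_set \<mu> A"
  shows "((\<lambda>(xs, n). real (hits A xs) / n) \<longlongrightarrow> measure \<mu> A) (sample_filter \<mu>)"
proof -
  have "sample_filter \<mu> \<le> filtercomap (\<lambda>(xs, n). real (hits A xs) / n) (nhds (measure \<mu> A))"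
    unfolding sample_filter_def by (rule le_infI2, rule INF_lower) (use assms in simp)
  then show ?thesis by (rule filterlim_mono[OF filterlim_filtercomap order_refl])
qed

lemma eventually_parameter_ge: "eventually (\<lambda>(xs, n). N \<le> n) (sample_filter \<mu>)"
  using filterlim_parameter[of \<mu>] by (simp add: filterlim_at_top case_prod_beta')

text \<open>Only finitely many sets enter, so a union bound can later turn convergence in
  probability for each of them into one event of probability near 1.\<close>

lemma eventually_sample_filterD:
  assumes "eventually P (sample_filter \<mu>)"
  obtains \<A> d N where "finite \<A>" "\<And>A. A \<in> \<A> \<Longrightarrow> continuity_set \<mu> A" "\<And>A. A \<in> \<A> \<Longrightarrow> 0 < d A"
    "\<And>xs n. N \<le> n \<Longrightarrow> (\<And>A. A \<in> \<A> \<Longrightarrow> \<bar>real (hits A xs) / n - measure \<mu> A\<bar> \<le> d A) \<Longrightarrow> P (xs, n)"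
proof -
  let ?f = "\<lambda>A (xs, n). real (hits A xs) / n"
  obtain P1 P2 where P12: "eventually P1 (filtercomap snd at_top)"
    "eventually P2 (INF A\<in>{A. continuity_set \<mu> A}. filtercomap (?f A) (nhds (measure \<mu> A)))"
    "\<And>z. P1 z \<Longrightarrow> P2 z \<Longrightarrow> P z"
    using assms unfolding sample_filter_def eventually_inf by auto
  obtain N where N: "\<And>z. N \<le> snd z \<Longrightarrow> P1 z"
  proof -
    obtain Q where Q: "eventually Q at_top" "\<And>z. Q (snd z) \<Longrightarrow> P1 z"
      using P12(1) by (auto simp: eventually_filtercomap)
    obtain N where "\<And>n. N \<le> n \<Longrightarrow> Q n" using Q(1) by (auto simp: eventually_at_top_linorder)
    then show thesis using that Q(2) by blast
  qed
  obtain \<A> where \<A>': "\<A> \<subseteq> {A. continuity_set \<mu> A} \<and> finite \<A> \<and>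
      eventually P2 (INF A\<in>\<A>. filtercomap (?f A) (nhds (measure \<mu> A)))"
    using iffD1[OF eventually_INF P12(2)] by (rule exE)
  note \<A> = \<A>'[THEN conjunct1] \<A>'[THEN conjunct2, THEN conjunct1] \<A>'[THEN conjunct2, THEN conjunct2]
  obtain Q where Q': "(\<forall>A\<in>\<A>. eventually (Q A) (filtercomap (?f A) (nhds (measure \<mu> A)))) \<and>
      (\<forall>z. (\<forall>A\<in>\<A>. Q A z) \<longrightarrow> P2 z)"
    using iffD1[OF eventually_INF_finite[OF \<A>(2)] \<A>(3)] by (rule exE)
  then have Q: "\<And>A. A \<in> \<A> \<Longrightarrow> eventually (Q A) (filtercomap (?f A) (nhds (measure \<mu> A)))"
    "\<And>z. (\<And>A. A \<in> \<A> \<Longrightarrow> Q A z) \<Longrightarrow> P2 z" by auto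
  have "\<exists>d>0. \<forall>z. \<bar>?f A z - measure \<mu> A\<bar> \<le> d \<longrightarrow> Q A z" if A: "A \<in> \<A>" for A
  proof -
    obtain R where R: "eventually R (nhds (measure \<mu> A))" "\<And>z. R (?f A z) \<Longrightarrow> Q A z"
      using Q(1)[OF A] unfolding eventually_filtercomap by blast
    obtain e where e: "0 < e" "\<And>t. dist t (measure \<mu> A) < e \<Longrightarrow> R t"
      using R(1) unfolding eventually_nhds_metric by auto
    \<comment> \<open>Half of \<open>e\<close>, because the claim has a non-strict bound.\<close>
    show ?thesis
      by (rule exI[of _ "e / 2"]) (use e R in \<open>auto simp: dist_real_def\<close>)
  qed
  then obtain d where d: "\<And>A. A \<in> \<A> \<Longrightarrow> 0 < d A \<and> (\<forall>z. \<bar>?f A z - measure \<mu> A\<bar> \<le> d A \<longrightarrow> Q A z)"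
    by metis
  show thesis
  proof (rule that)
    show "finite \<A>" "\<And>A. A \<in> \<A> \<Longrightarrow> continuity_set \<mu> A" "\<And>A. A \<in> \<A> \<Longrightarrow> 0 < d A"
      using \<A> d by auto
    fix xs n assume *: "N \<le> n" "\<And>A. A \<in> \<A> \<Longrightarrow> \<bar>real (hits A xs) / n - measure \<mu> A\<bar> \<le> d A"
    have "Q A (xs, n)" if "A \<in> \<A>" for A using d[OF that] *(2)[OF that] by simp
    then show "P (xs, n)" using P12(3) N[of "(xs, n)"] Q(2) *(1) by simp
  qed
qed

lemma continuity_set_UNIV: "continuity_set \<mu> UNIV"
  by (simp add: continuity_set_def)

lemma hits_UNIV: "hits UNIV xs = length xs"
  by (simp add: hits_def)

lemma hits_sum: "real (hits A xs) = (\<Sum>i<length xs. indicator A (xs ! i))"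
proof -
  have "{i. i < length xs \<and> xs ! i \<in> A} = {i \<in> {..<length xs}. xs ! i \<in> A}" by auto
  then show ?thesis by (simp add: hits_def indicator_def sum.If_cases Int_def)
qed

lemma card_inj_lists_ge: "real (v - r) ^ r \<le> real (card (inj_lists r v))"
proof (cases "r \<le> v")
  case True
  have "inj_lists r v = {vs. length vs = r \<and> distinct vs \<and> set vs \<subseteq> {..<v}}"
    by (simp add: inj_lists_def)
  then have "card (inj_lists r v) = \<Prod>{v - r + 1..v}"
    using card_lists_distinct_length_eq[of "{..<v}" r] True by simp
  moreover have "(\<Prod>j\<in>{v - r + 1..v}. v - r) \<le> (\<Prod>j\<in>{v - r + 1..v}. j)"
    by (rule prod_mono) auto
  then have "(v - r) ^ r \<le> \<Prod>{v - r + 1..v}" using True by simp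
  ultimately show ?thesis by (metis of_nat_le_iff of_nat_power)
next
  case False
  then have "v - r = 0" "r \<noteq> 0" by auto
  then show ?thesis by (simp add: zero_power)
qed

section \<open>Continuity sets and lower bounds for empirical sums\<close>

context generalized_ground_space
begin

lemma space_mu: "space \<mu> = UNIV"
  using sets_eq_imp_space_eq[OF sets_mu] by simp

sublocale finite_measure \<mu>
  by standard (use mu_finite in simp)

sublocale product_sigma_finite "\<lambda>_::nat. \<mu>"
  by (simp add: product_sigma_finite_def sigma_finite_measure_axioms)

lemma continuity_set_Int:
  assumes "continuity_set \<mu> A" "continuity_set \<mu> B"
  shows "continuity_set \<mu> (A \<inter> B)"
proof -
  have "emeasure \<mu> (frontier (A \<inter> B)) \<le> emeasure \<mu> (frontier A \<union> frontier B)"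
    by (rule emeasure_mono[OF frontier_Int_subset]) (simp add: sets_mu borel_closed frontier_closed closed_Un)
  also have "\<dots> \<le> emeasure \<mu> (frontier A) + emeasure \<mu> (frontier B)"
    by (rule emeasure_subadditive) (simp_all add: sets_mu borel_closed frontier_closed)
  finally show ?thesis using assms unfolding continuity_set_def by (simp add: borel_comp sets.Int[of A borel B])
qed

lemma continuity_set_Compl: "continuity_set \<mu> A \<Longrightarrow> continuity_set \<mu> (- A)"
  by (simp add: continuity_set_def borel_comp)

text \<open>The frontier of a ball lies in the sphere of the same radius. Spheres of different radii
  are disjoint, so a finite measure charges only countably many of them, while the interval is
  uncountable.\<close>

lemma continuity_ball:
  fixes s :: 'a
  assumes "0 \<le> a" "a < b"
  shows "\<exists>t. a < t \<and> t < b \<and> continuity_set \<mu> (ball s t)"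
proof -
  let ?D = "distr \<mu> borel (dist s)"
  have meas: "dist s \<in> measurable \<mu> borel"
    by (simp add: sets_mu borel_measurable_continuous_onI continuous_intros cong: measurable_cong_sets)
  interpret D: finite_measure ?D by (rule finite_measure_distr[OF meas])
  have "\<not> {a<..<b} \<subseteq> {t. measure ?D {t} \<noteq> 0}"
    using D.countable_support countable_subset uncountable_open_interval[of a b] assms by blast
  then obtain t where t: "a < t" "t < b" "measure ?D {t} = 0" by auto
  then have "emeasure ?D {t} = 0" by (simp add: D.emeasure_eq_measure)
  then have sphere: "emeasure \<mu> {y. dist s y = t} = 0"
    by (subst (asm) emeasure_distr[OF meas]) (auto simp: space_mu vimage_def)
  have "frontier (ball s t) \<subseteq> {y. dist s y = t}"
  proof -
    have "closure (ball s t) \<subseteq> cball s t" by (rule closure_minimal) (auto simp: mem_ball mem_cball)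
    then show ?thesis by (auto simp: frontier_def mem_ball mem_cball interior_open)
  qed
  then have "emeasure \<mu> (frontier (ball s t)) \<le> emeasure \<mu> {y. dist s y = t}"
  proof (rule emeasure_mono)
    have "{y. dist s y = t} = dist s -` {t} \<inter> space \<mu>" by (auto simp: space_mu)
    also have "\<dots> \<in> sets \<mu>" by (rule measurable_sets[OF meas]) simp
    finally show "{y. dist s y = t} \<in> sets \<mu>" .
  qed
  then show ?thesis using t sphere by (auto simp: continuity_set_def)
qed

text \<open>The centres run through a countable dense set. A radius above \<open>1 / (m + 1)\<close>
  makes the ball reach \<open>s\<close> from a centre that close, and a radius below
  \<open>2 / (m + 1)\<close> keeps the ball inside \<open>U\<close>; between these values
  \<open>continuity_ball\<close> provides a radius.\<close>

lemma continuity_base: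
  "\<exists>B :: nat \<Rightarrow> 'a set. (\<forall>i. continuity_set \<mu> (B i)) \<and>
    (\<forall>s U. open U \<longrightarrow> s \<in> U \<longrightarrow> (\<exists>i. s \<in> B i \<and> B i \<subseteq> U))"
proof -
  obtain D :: "'a set" where D: "countable D" "\<And>X. open X \<Longrightarrow> X \<noteq> {} \<Longrightarrow> \<exists>d\<in>D. d \<in> X"
    using countable_dense_setE by blast
  have ex: "\<exists>t. 1 / real (Suc m) < t \<and> t < 2 / real (Suc m) \<and> continuity_set \<mu> (ball s t)" for s :: 'a and m
    by (rule continuity_ball) (auto simp: divide_strict_right_mono)
  define t where "t s m = (SOME t. 1 / real (Suc m) < t \<and> t < 2 / real (Suc m) \<and> continuity_set \<mu> (ball s t))"
    for s :: 'a and m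
  have t: "1 / real (Suc m) < t s m" "t s m < 2 / real (Suc m)" "continuity_set \<mu> (ball s (t s m))" for s m
    using someI_ex[OF ex[of m s]] by (simp_all add: t_def)
  define \<B> where "\<B> = (\<lambda>(s, m). ball s (t s m)) ` (D \<times> (UNIV :: nat set))"
  have "countable \<B>" using D(1) by (simp add: \<B>_def)
  moreover have "\<B> \<noteq> {}" using D(2)[of UNIV] by (auto simp: \<B>_def)
  ultimately obtain B :: "nat \<Rightarrow> 'a set" where B: "range B = \<B>" by (metis range_from_nat_into)
  show ?thesis
  proof (intro exI[of _ B] conjI allI impI)
    fix i have "B i \<in> \<B>" using B by blast
    then show "continuity_set \<mu> (B i)" using t(3) by (auto simp: \<B>_def)
  next
    fix s :: 'a and U assume "open U" "s \<in> U"
    then obtain e where e: "0 < e" "ball s e \<subseteq> U" by (meson openE)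
    \<comment> \<open>Points of the chosen ball are within \<open>3 / (m + 1)\<close> of
      \<open>s\<close>, so \<open>4 / e\<close> leaves some room.\<close>
    obtain m where m: "4 / e < real (Suc m)" by (meson reals_Archimedean2 less_trans of_nat_less_iff lessI)
    obtain d where d: "d \<in> D" "d \<in> ball s (1 / real (Suc m))"
      using D(2)[of "ball s (1 / real (Suc m))"] by auto
    have "s \<in> ball d (t d m)" using d(2) t(1)[of m d] by (auto simp: mem_ball dist_commute)
    moreover have "ball d (t d m) \<subseteq> ball s e"
    proof
      fix y assume "y \<in> ball d (t d m)"
      then have "dist s y < 1 / real (Suc m) + 2 / real (Suc m)"
        using dist_triangle[of s y d] d(2) t(2)[of d m] by (auto simp: mem_ball)
      also have "\<dots> \<le> e" using m e(1) by (simp add: field_simps)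
      finally show "y \<in> ball s e" by (simp add: mem_ball)
    qed
    moreover have "ball d (t d m) \<in> range B" unfolding B \<B>_def using d(1) by auto
    ultimately show "\<exists>i. s \<in> B i \<and> B i \<subseteq> U" using e(2) by (metis image_iff order_trans)
  qed
qed

text \<open>The lower bound for empirical sums: \<open>\<Psi>\<close> is approximated from below by its infimum over the
  cells of the finite partition generated by the first \<open>N\<close> sets of a base of continuity sets.\<close>

lemma eventually_sum_lists:
  fixes \<Psi> :: "(nat \<Rightarrow> 'a) \<Rightarrow> real" and c :: real
  assumes \<Psi>0: "\<And>y. 0 \<le> \<Psi> y"
    and dep: "\<And>y z. (\<And>i. i < r \<Longrightarrow> y i = z i) \<Longrightarrow> \<Psi> y = \<Psi> z"
    and cont: "AE y in PiM {..<r} (\<lambda>_. \<mu>). isCont \<Psi> y"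
    and c: "ennreal c < (\<integral>\<^sup>+ y. ennreal (\<Psi> y) \<partial>PiM {..<r} (\<lambda>_. \<mu>))" "0 \<le> c"
  shows "eventually (\<lambda>(xs, n). c < (\<Sum>vs | length vs = r \<and> set vs \<subseteq> {..<length xs}. \<Psi> (\<lambda>i. xs ! (vs ! i))) / n ^ r)
    (sample_filter \<mu>)"
proof -
  obtain B :: "nat \<Rightarrow> 'a set" where B': "(\<forall>i. continuity_set \<mu> (B i)) \<and>
    (\<forall>s U. open U \<longrightarrow> s \<in> U \<longrightarrow> (\<exists>i. s \<in> B i \<and> B i \<subseteq> U))"
    using continuity_base by (rule exE)
  then have B: "\<And>i. continuity_set \<mu> (B i)"
    "\<And>s U. open U \<Longrightarrow> s \<in> U \<Longrightarrow> \<exists>i. s \<in> B i \<and> B i \<subseteq> U"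
    by simp_all
  \<comment> \<open>Points with equal codes are not separated by the first \<open>N\<close> base
    sets; the classes are the cells of the partition.\<close>
  define code where "code N s = {i. i < N \<and> s \<in> B i}" for N :: nat and s
  define cell where "cell N C = {s. code N s = C}" for N C
  have cell: "continuity_set \<mu> (cell N C)" for N C
  proof (induction N arbitrary: C)
    case 0
    have "cell 0 C = (if C = {} then UNIV else - UNIV)" by (auto simp: cell_def code_def)
    then show ?case using continuity_set_UNIV[of \<mu>] continuity_set_Compl[OF continuity_set_UNIV] by simp
  next
    case (Suc N)
    have *: "code (Suc N) s = (if s \<in> B N then insert N (code N s) else code N s)" "N \<notin> code N s" for s
      by (auto simp: code_def less_Suc_eq)
    have "cell (Suc N) C = (if N \<in> C then cell N (C - {N}) \<inter> B N else cell N C \<inter> - B N)"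
      using * by (auto simp: cell_def split: if_splits)
    then show ?case using Suc B(1) by (simp add: continuity_set_Int continuity_set_Compl)
  qed
  have cell_sets: "cell N C \<in> sets \<mu>" for N C using cell by (simp add: continuity_set_def sets_mu)
  define \<Psi>N where "\<Psi>N N y = Inf {\<Psi> z | z. \<forall>i<r. code N (z i) = code N (y i)}" for N y
  have bdd: "bdd_below {\<Psi> z | z. \<forall>i<r. code N (z i) = code N (y i)}" for N y
    using \<Psi>0 by (auto intro: bdd_belowI[of _ 0])
  have \<Psi>N_le: "\<Psi>N N y \<le> \<Psi> y" for N y
    unfolding \<Psi>N_def by (rule cInf_lower[OF _ bdd]) auto
  have \<Psi>N_ge: "e \<le> \<Psi>N N y" if "\<And>z. \<forall>i<r. code N (z i) = code N (y i) \<Longrightarrow> e \<le> \<Psi> z" for e N y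
    unfolding \<Psi>N_def by (rule cInf_greatest) (use that in auto)
  have \<Psi>N0: "0 \<le> \<Psi>N N y" for N y using \<Psi>0 by (intro \<Psi>N_ge)
  \<comment> \<open>The value of \<open>\<Psi>N N\<close> on a product of cells. For an empty cell
    the chosen point is arbitrary, but then the product of indicators vanishes.\<close>
  define h where "h N C = \<Psi>N N (\<lambda>i. SOME s. code N s = C i)" for N and C :: "nat \<Rightarrow> nat set"
  have h0: "0 \<le> h N C" for N C using \<Psi>N0 by (simp add: h_def)
  have \<Psi>N_h: "\<Psi>N N y = h N C" if "\<And>i. i < r \<Longrightarrow> C i = code N (y i)" for N y C
  proof -
    have "code N (SOME s. code N s = C i) = code N (y i)" if "i < r" for i
      using someI[of "\<lambda>s. code N s = C i" "y i"] \<open>\<And>i. i < r \<Longrightarrow> C i = code N (y i)\<close>[OF that] by simp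
    then show ?thesis by (simp add: h_def \<Psi>N_def)
  qed
  define CC where "CC N = PiE {..<r} (\<lambda>_. Pow {..<N})" for N :: nat
  have finCC: "finite (CC N)" for N by (auto simp: CC_def intro!: finite_PiE)
  have \<Psi>N_sum: "\<Psi>N N y = (\<Sum>C\<in>CC N. h N C * (\<Prod>i<r. indicator (cell N (C i)) (y i)))" for N y
  proof -
    let ?C = "\<lambda>i\<in>{..<r}. code N (y i)"
    have inCC: "?C \<in> CC N" by (auto simp: CC_def code_def)
    have "(\<Prod>i<r. indicator (cell N (C i)) (y i) :: real) = of_bool (C = ?C)" if C: "C \<in> CC N" for C
    proof (cases "\<forall>i<r. C i = code N (y i)")
      case True
      then have "C = ?C" using C by (auto simp: CC_def PiE_def extensional_def fun_eq_iff)
      moreover have "(\<Prod>i<r. indicator (cell N (C i)) (y i) :: real) = 1"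
        by (rule prod.neutral) (use True in \<open>auto simp: cell_def\<close>)
      ultimately show ?thesis by simp
    next
      case False
      then have "C \<noteq> ?C" by auto
      moreover have "\<exists>i\<in>{..<r}. indicator (cell N (C i)) (y i) = (0::real)"
        using False by (auto simp: cell_def indicator_def)
      then have "(\<Prod>i<r. indicator (cell N (C i)) (y i) :: real) = 0"
        by (simp add: prod_zero)
      ultimately show ?thesis by simp
    qed
    then have "(\<Sum>C\<in>CC N. h N C * (\<Prod>i<r. indicator (cell N (C i)) (y i)))
        = (\<Sum>C\<in>CC N. h N C * of_bool (C = ?C))"
      by (intro sum.cong) auto
    also have "\<dots> = h N ?C"
      using inCC finCC[of N] by (simp add: of_bool_def if_distrib[of "\<lambda>x. _ * x"] cong: if_cong)
    finally show ?thesis using \<Psi>N_h[of ?C N y] by simp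
  qed
  have meas: "(\<lambda>y. ennreal (\<Psi>N N y)) \<in> borel_measurable (PiM {..<r} (\<lambda>_. \<mu>))" for N
    unfolding \<Psi>N_sum using cell_sets by measurable
  have int\<Psi>N: "(\<integral>\<^sup>+ y. ennreal (\<Psi>N N y) \<partial>PiM {..<r} (\<lambda>_. \<mu>))
      = ennreal (\<Sum>C\<in>CC N. h N C * (\<Prod>i<r. measure \<mu> (cell N (C i))))" for N
  proof -
    have "ennreal (\<Psi>N N y) = (\<Sum>C\<in>CC N. ennreal (h N C) * (\<Prod>i<r. indicator (cell N (C i)) (y i)))" for y
      unfolding \<Psi>N_sum using h0
      by (simp add: ennreal_mult prod_nonneg prod_ennreal[symmetric] ennreal_indicator flip: sum_ennreal)
    then have "(\<integral>\<^sup>+ y. ennreal (\<Psi>N N y) \<partial>PiM {..<r} (\<lambda>_. \<mu>))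
        = (\<Sum>C\<in>CC N. ennreal (h N C) * (\<integral>\<^sup>+ y. (\<Prod>i<r. indicator (cell N (C i)) (y i)) \<partial>PiM {..<r} (\<lambda>_. \<mu>)))"
      using cell_sets by (simp add: nn_integral_sum nn_integral_cmult)
    also have "\<dots> = (\<Sum>C\<in>CC N. ennreal (h N C) * (\<Prod>i<r. emeasure \<mu> (cell N (C i))))"
      using cell_sets by (subst product_nn_integral_prod) auto
    also have "\<dots> = ennreal (\<Sum>C\<in>CC N. h N C * (\<Prod>i<r. measure \<mu> (cell N (C i))))"
      using h0 by (simp add: emeasure_eq_measure prod_ennreal ennreal_mult prod_nonneg flip: sum_ennreal)
    finally show ?thesis .
  qed
  \<comment> \<open>A neighbourhood of \<open>y\<close> on which \<open>\<Psi>\<close> varies by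
    less than \<open>e\<close> contains an open box. Base sets \<open>B (m i)\<close> fit into its
    first \<open>r\<close> sides, and once \<open>N\<close> exceeds all \<open>m i\<close> the cells
    of \<open>y\<close> lie in them.\<close>
  have lim: "ennreal (\<Psi> y) \<le> liminf (\<lambda>N. ennreal (\<Psi>N N y))" if y: "isCont \<Psi> y" for y
  proof (rule ennreal_le_epsilon)
    fix e :: real assume e: "0 < e"
    obtain W where W: "open W" "y \<in> W" "\<And>z. z \<in> W \<Longrightarrow> dist (\<Psi> z) (\<Psi> y) < e"
    proof -
      have "eventually (\<lambda>z. dist (\<Psi> z) (\<Psi> y) < e) (at y)"
        using y e by (simp add: isCont_def tendstoD)
      then obtain W where "open W" "y \<in> W" "\<forall>z\<in>W. z \<noteq> y \<longrightarrow> z \<in> UNIV \<longrightarrow> dist (\<Psi> z) (\<Psi> y) < e"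
        unfolding eventually_at_topological by blast
      then show thesis using that[of W] e by (metis UNIV_I dist_self)
    qed
    have "openin (product_topology (\<lambda>_. euclidean) UNIV) W" using W(1) by (simp add: open_fun_def)
    from product_topology_open_contains_basis[OF this W(2)]
    obtain X where X': "y \<in> (\<Pi>\<^sub>E i\<in>UNIV. X i) \<and> (\<forall>i. openin euclidean (X i)) \<and>
        finite {i. X i \<noteq> topspace euclidean} \<and> (\<Pi>\<^sub>E i\<in>UNIV. X i) \<subseteq> W" by (rule exE)
    then have X: "\<And>i. y i \<in> X i" "\<And>i. open (X i)" "(\<Pi>\<^sub>E i\<in>UNIV. X i) \<subseteq> W"
      by (auto simp: PiE_def Pi_def)
    have "\<exists>m. \<forall>i<r. y i \<in> B (m i) \<and> B (m i) \<subseteq> X i"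
      using B(2)[OF X(2) X(1)] by metis
    then obtain m where m: "\<And>i. i < r \<Longrightarrow> y i \<in> B (m i)" "\<And>i. i < r \<Longrightarrow> B (m i) \<subseteq> X i" by auto
    have ge: "\<Psi> y - e \<le> \<Psi>N N y" if N: "N \<ge> Suc (\<Sum>i<r. m i)" for N
    proof (rule \<Psi>N_ge)
      fix z assume z: "\<forall>i<r. code N (z i) = code N (y i)"
      have zX: "z i \<in> X i" if i: "i < r" for i
      proof -
        have "m i \<le> (\<Sum>i<r. m i)" by (rule member_le_sum) (use i in auto)
        then have "m i \<in> code N (y i)" using m(1)[OF i] N by (simp add: code_def)
        then have "m i \<in> code N (z i)" using z i by simp
        then show ?thesis using m(2)[OF i] by (auto simp: code_def)
      qed
      \<comment> \<open>The coordinates from \<open>r\<close> on are taken from \<open>y\<close>, so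
        that \<open>z'\<close> lies in the whole box; by \<open>dep\<close> the value is that of
        \<open>z\<close>.\<close>
      define z' where "z' i = (if i < r then z i else y i)" for i
      have "z' \<in> (\<Pi>\<^sub>E i\<in>UNIV. X i)" using X(1) zX by (auto simp: z'_def)
      then have "z' \<in> W" using X(3) by blast
      then have "dist (\<Psi> z') (\<Psi> y) < e" by (rule W(3))
      moreover have "\<Psi> z' = \<Psi> z" by (rule dep) (simp add: z'_def)
      ultimately show "\<Psi> y - e \<le> \<Psi> z" by (simp add: dist_real_def)
    qed
    have "ennreal (\<Psi> y) - ennreal e \<le> ennreal (\<Psi>N N y)" if "N \<ge> Suc (\<Sum>i<r. m i)" for N
      using ge[OF that] e by (subst ennreal_minus) (auto intro: ennreal_leI)
    then have "ennreal (\<Psi> y) - ennreal e \<le> liminf (\<lambda>N. ennreal (\<Psi>N N y))"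
      by (intro Liminf_bounded eventually_sequentiallyI)
    then show "ennreal (\<Psi> y) \<le> liminf (\<lambda>N. ennreal (\<Psi>N N y)) + ennreal e"
      by (simp add: ennreal_minus_le_iff add.commute)
  qed
  have "(\<integral>\<^sup>+ y. ennreal (\<Psi> y) \<partial>PiM {..<r} (\<lambda>_. \<mu>))
      \<le> (\<integral>\<^sup>+ y. liminf (\<lambda>N. ennreal (\<Psi>N N y)) \<partial>PiM {..<r} (\<lambda>_. \<mu>))"
    by (rule nn_integral_mono_AE) (use cont lim in auto)
  also have "\<dots> \<le> liminf (\<lambda>N. \<integral>\<^sup>+ y. ennreal (\<Psi>N N y) \<partial>PiM {..<r} (\<lambda>_. \<mu>))"
    by (rule nn_integral_liminf) (rule meas)
  finally have "ennreal c < liminf (\<lambda>N. \<integral>\<^sup>+ y. ennreal (\<Psi>N N y) \<partial>PiM {..<r} (\<lambda>_. \<mu>))"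
    using c(1) by simp
  then have "eventually (\<lambda>N. ennreal c < (\<integral>\<^sup>+ y. ennreal (\<Psi>N N y) \<partial>PiM {..<r} (\<lambda>_. \<mu>))) sequentially"
    by (rule less_LiminfD)
  then obtain N where "ennreal c < (\<integral>\<^sup>+ y. ennreal (\<Psi>N N y) \<partial>PiM {..<r} (\<lambda>_. \<mu>))"
    by (auto simp: eventually_sequentially)
  then have cN: "c < (\<Sum>C\<in>CC N. h N C * (\<Prod>i<r. measure \<mu> (cell N (C i))))"
    unfolding int\<Psi>N using c(2) by (simp add: ennreal_less_iff)
  have "((\<lambda>z. \<Sum>C\<in>CC N. h N C * (\<Prod>i<r. (\<lambda>(xs, n). real (hits (cell N (C i)) xs) / n) z)) \<longlongrightarrow>
      (\<Sum>C\<in>CC N. h N C * (\<Prod>i<r. measure \<mu> (cell N (C i))))) (sample_filter \<mu>)"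
    by (intro tendsto_intros tendsto_hits cell)
  then have "eventually (\<lambda>z. c < (\<Sum>C\<in>CC N. h N C * (\<Prod>i<r. (\<lambda>(xs, n). real (hits (cell N (C i)) xs) / n) z)))
      (sample_filter \<mu>)"
    using cN by (rule order_tendstoD)
  moreover have "eventually (\<lambda>(xs, n). 1 \<le> n) (sample_filter \<mu>)" by (rule eventually_parameter_ge)
  ultimately show ?thesis
  proof eventually_elim
    case (elim z)
    obtain xs n where z: "z = (xs, n)" by fastforce
    have n: "1 \<le> n" using elim z by simp
    let ?L = "{vs. length vs = r \<and> set vs \<subseteq> {..<length xs}}"
    have "(\<Sum>C\<in>CC N. h N C * (\<Prod>i<r. real (hits (cell N (C i)) xs) / n))
        = (\<Sum>C\<in>CC N. h N C * (\<Prod>i<r. real (hits (cell N (C i)) xs))) / n ^ r"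
      by (simp add: prod_dividef sum_divide_distrib)
    also have "(\<Sum>C\<in>CC N. h N C * (\<Prod>i<r. real (hits (cell N (C i)) xs)))
        = (\<Sum>C\<in>CC N. h N C * (\<Sum>vs\<in>?L. \<Prod>i<r. indicator (cell N (C i)) (xs ! (vs ! i))))"
      unfolding hits_sum by (subst sum_lists_prod) auto
    also have "\<dots> = (\<Sum>vs\<in>?L. \<Sum>C\<in>CC N. h N C * (\<Prod>i<r. indicator (cell N (C i)) (xs ! (vs ! i))))"
      by (subst sum.swap) (simp add: sum_distrib_left)
    also have "\<dots> = (\<Sum>vs\<in>?L. \<Psi>N N (\<lambda>i. xs ! (vs ! i)))" by (simp add: \<Psi>N_sum)
    finally have "c < (\<Sum>vs\<in>?L. \<Psi>N N (\<lambda>i. xs ! (vs ! i))) / n ^ r" using elim z by simp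
    also have "\<dots> \<le> (\<Sum>vs\<in>?L. \<Psi> (\<lambda>i. xs ! (vs ! i))) / n ^ r"
      using n by (intro divide_right_mono sum_mono \<Psi>N_le) auto
    finally show ?case by (simp add: z)
  qed
qed

lemma tendsto_length: "((\<lambda>(xs, n). real (length xs) / n) \<longlongrightarrow> measure \<mu> UNIV) (sample_filter \<mu>)"
  using tendsto_hits[OF continuity_set_UNIV[of \<mu>]] by (simp add: hits_UNIV)

text \<open>At most \<open>v ^ r - (v - r) ^ r\<close> tuples have a repeated entry, which is of
  smaller order than \<open>n ^ r\<close> since \<open>v / n\<close> converges. Each of them
  contributes at most \<open>H\<close>.\<close>

lemma eventually_sum_inj_lists:
  fixes \<Psi> :: "(nat \<Rightarrow> 'a) \<Rightarrow> real" and c :: real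
  assumes \<Psi>0: "\<And>y. 0 \<le> \<Psi> y" and \<Psi>H: "\<And>y. \<Psi> y \<le> H"
    and dep: "\<And>y z. (\<And>i. i < r \<Longrightarrow> y i = z i) \<Longrightarrow> \<Psi> y = \<Psi> z"
    and cont: "AE y in PiM {..<r} (\<lambda>_. \<mu>). isCont \<Psi> y"
    and c: "ennreal c < (\<integral>\<^sup>+ y. ennreal (\<Psi> y) \<partial>PiM {..<r} (\<lambda>_. \<mu>))" "0 \<le> c"
  shows "eventually (\<lambda>(xs, n). c < (\<Sum>vs\<in>inj_lists r (length xs). \<Psi> (\<lambda>i. xs ! (vs ! i))) / n ^ r)
    (sample_filter \<mu>)"
proof -
  have H: "0 \<le> H" using \<Psi>0[of undefined] \<Psi>H[of undefined] by linarith
  obtain d where d: "ennreal c < d" "d < (\<integral>\<^sup>+ y. ennreal (\<Psi> y) \<partial>PiM {..<r} (\<lambda>_. \<mu>))"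
    using dense[OF c(1)] by blast
  obtain c' where c': "d = ennreal c'" "0 \<le> c'"
    using d(2) by (metis ennreal_cases top.not_eq_extremum not_less_iff_gr_or_eq order_less_trans)
  have cc': "c < c'" using d(1) c(2) c' by (simp add: ennreal_less_iff)
  have ev: "eventually (\<lambda>(xs, n). c' < (\<Sum>vs | length vs = r \<and> set vs \<subseteq> {..<length xs}. \<Psi> (\<lambda>i. xs ! (vs ! i))) / n ^ r)
    (sample_filter \<mu>)"
    by (rule eventually_sum_lists[OF \<Psi>0 dep cont]) (use d(2) c' in auto)
  have n: "((\<lambda>(xs, n). real r / n) \<longlongrightarrow> 0) (sample_filter \<mu>)"
    using real_tendsto_divide_at_top[OF tendsto_const filterlim_parameter, of "real r" \<mu>]
    by (simp add: case_prod_beta')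
  \<comment> \<open>The normalized bound on the discarded tuples tends to 0; \<open>max 0\<close>
    reproduces the truncated subtraction of natural numbers.\<close>
  have "((\<lambda>z. H * ((\<lambda>(xs, n). real (length xs) / n) z ^ r
        - (max 0 ((\<lambda>(xs, n). real (length xs) / n) z - (\<lambda>(xs, n). real r / n) z)) ^ r))
      \<longlongrightarrow> H * (measure \<mu> UNIV ^ r - (max 0 (measure \<mu> UNIV - 0)) ^ r)) (sample_filter \<mu>)"
    by (intro tendsto_intros tendsto_length n)
  then have "eventually (\<lambda>z. H * ((\<lambda>(xs, n). real (length xs) / n) z ^ r
        - (max 0 ((\<lambda>(xs, n). real (length xs) / n) z - (\<lambda>(xs, n). real r / n) z)) ^ r) < c' - c) (sample_filter \<mu>)"
    by (rule order_tendstoD) (use cc' in simp)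
  moreover have "eventually (\<lambda>(xs, n). 1 \<le> n) (sample_filter \<mu>)" by (rule eventually_parameter_ge)
  ultimately show ?thesis using ev
  proof eventually_elim
    case (elim z)
    obtain xs n where z: "z = (xs, n)" by fastforce
    have n: "1 \<le> n" using elim z by simp
    let ?v = "length xs"
    let ?L = "{vs. length vs = r \<and> set vs \<subseteq> {..<?v}}"
    have fin: "finite ?L" using finite_lists_length_eq[of "{..<?v}" r] by (simp add: conj_commute)
    have cL: "card ?L = ?v ^ r" using card_lists_length_eq[of "{..<?v}" r] by (simp add: conj_commute)
    have sub: "inj_lists r ?v \<subseteq> ?L" by (auto simp: inj_lists_def)
    have "(\<Sum>vs\<in>?L. \<Psi> (\<lambda>i. xs ! (vs ! i))) - (\<Sum>vs\<in>inj_lists r ?v. \<Psi> (\<lambda>i. xs ! (vs ! i)))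
        = (\<Sum>vs\<in>?L - inj_lists r ?v. \<Psi> (\<lambda>i. xs ! (vs ! i)))"
      using sum.subset_diff[OF sub fin, of "\<lambda>vs. \<Psi> (\<lambda>i. xs ! (vs ! i))"] by simp
    also have "\<dots> \<le> H * real (card (?L - inj_lists r ?v))"
      using sum_bounded_above[of "?L - inj_lists r ?v" "\<lambda>vs. \<Psi> (\<lambda>i. xs ! (vs ! i))" H] \<Psi>H
      by (simp add: mult.commute)
    also have "real (card (?L - inj_lists r ?v)) = real ?v ^ r - real (card (inj_lists r ?v))"
      using card_mono[OF fin sub] sub by (simp add: card_Diff_subset cL of_nat_diff)
    also have "H * (real ?v ^ r - real (card (inj_lists r ?v))) \<le> H * (real ?v ^ r - real (?v - r) ^ r)"
      using H card_inj_lists_ge[of ?v r] by (intro mult_left_mono) auto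
    finally have "(\<Sum>vs\<in>?L. \<Psi> (\<lambda>i. xs ! (vs ! i))) / n ^ r - (\<Sum>vs\<in>inj_lists r ?v. \<Psi> (\<lambda>i. xs ! (vs ! i))) / n ^ r
        \<le> H * (real ?v ^ r - real (?v - r) ^ r) / n ^ r"
      using n by (simp add: divide_right_mono flip: diff_divide_distrib)
    also have "\<dots> = H * ((real ?v / n) ^ r - (max 0 (real ?v / n - real r / n)) ^ r)"
    proof -
      have "real (?v - r) / n = max 0 (real ?v / n - real r / n)"
      proof (cases "r \<le> ?v")
        case True
        then have "real r / n \<le> real ?v / n" using n by (simp add: divide_right_mono)
        then show ?thesis using True by (simp add: of_nat_diff diff_divide_distrib)
      next
        case False
        then have "real ?v / n \<le> real r / n" using n by (simp add: divide_right_mono)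
        then show ?thesis using False by simp
      qed
      then have "(max 0 (real ?v / n - real r / n)) ^ r = real (?v - r) ^ r / n ^ r"
        by (metis power_divide)
      then show ?thesis by (simp add: power_divide diff_divide_distrib right_diff_distrib)
    qed
    also have "\<dots> < c' - c" using elim z by simp
    finally show ?case using elim z by simp
  qed
qed

end

section \<open>Conditional means of the counts\<close>

text \<open>The common form of both integrals before division by \<open>\<sigma>\<close>: twice
  \<open>alpha\<close> for \<open>r = Suc k\<close>, and \<open>2 * k\<close> times
  \<open>beta\<close> for \<open>r = k\<close>.\<close>

definition walk_integral :: "'a measure \<Rightarrow> ('a \<Rightarrow> 'a \<Rightarrow> real) \<Rightarrow> nat \<Rightarrow> nat \<Rightarrow> ennreal" where
  "walk_integral \<mu> \<kappa> r k =
     (\<integral>\<^sup>+ y. (\<Prod>i<k. ennreal (\<kappa> (y i) (y (Suc i mod r)))) \<partial>(\<Pi>\<^sub>M i\<in>{..<r}. \<mu>))"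

definition edge_prob :: "('a \<Rightarrow> 'a \<Rightarrow> real) \<Rightarrow> real \<Rightarrow> 'a list \<Rightarrow> nat \<times> nat \<Rightarrow> real" where
  "edge_prob \<kappa> n xs = (\<lambda>(i, j). min (\<kappa> (xs ! i) (xs ! j) / n) 1)"

definition mean_copies :: "nat \<Rightarrow> nat \<Rightarrow> ('a \<Rightarrow> 'a \<Rightarrow> real) \<Rightarrow> real \<Rightarrow> 'a list \<Rightarrow> real" where
  "mean_copies r k \<kappa> n xs = (\<Sum>S\<in>copies r k (length xs). prod (edge_prob \<kappa> n xs) S)"

text \<open>The threshold is the point from which \<open>cutoff B\<close> vanishes, so products of
  truncated kernel values charge good copies only.\<close>

definition good_copies ::
  "nat \<Rightarrow> nat \<Rightarrow> ('a \<Rightarrow> 'a \<Rightarrow> real) \<Rightarrow> 'a list \<Rightarrow> nat \<Rightarrow> (nat \<times> nat) set set" where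
  "good_copies r k \<kappa> xs B =
     {S \<in> copies r k (length xs). \<forall>(i, j)\<in>S. \<kappa> (xs ! i) (xs ! j) < real B + 1}"

text \<open>A continuous truncation: it vanishes above \<open>B + 1\<close> and is the identity below \<open>B\<close>.\<close>

definition cutoff :: "nat \<Rightarrow> real \<Rightarrow> real" where
  "cutoff B t = max 0 (min t (real B * (real B + 1 - t)))"

lemma cutoff_nonneg: "0 \<le> cutoff B t"
  by (simp add: cutoff_def)

lemma cutoff_le_self: "0 \<le> t \<Longrightarrow> cutoff B t \<le> t"
  by (simp add: cutoff_def)

lemma cutoff_eq_0: "real B + 1 \<le> t \<Longrightarrow> cutoff B t = 0"
proof -
  assume "real B + 1 \<le> t"
  then have "real B * (real B + 1 - t) \<le> 0" by (intro mult_nonneg_nonpos) auto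
  then have "min t (real B * (real B + 1 - t)) \<le> 0" by linarith
  then show ?thesis by (simp add: cutoff_def)
qed

lemma cutoff_eq_self: "0 \<le> t \<Longrightarrow> t \<le> real B \<Longrightarrow> cutoff B t = t"
proof -
  assume t: "0 \<le> t" "t \<le> real B"
  have "real B * 1 \<le> real B * (real B + 1 - t)" using t by (intro mult_left_mono) auto
  then show ?thesis using t by (simp add: cutoff_def)
qed

lemma cutoff_le: "cutoff B t \<le> real B + 1"
proof (cases "real B + 1 \<le> t")
  case True then show ?thesis by (simp add: cutoff_eq_0)
qed (simp add: cutoff_def)

lemma isCont_cutoff: "isCont f x \<Longrightarrow> isCont (\<lambda>x. cutoff B (f x)) x"
  unfolding cutoff_def by (intro continuous_intros) auto

section \<open>Walk integrals and their truncated lower bounds\<close>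

context generalized_ground_space
begin

lemma alpha_eq_walk_integral: "1 \<le> k \<Longrightarrow> alpha \<mu> \<kappa> k = walk_integral \<mu> \<kappa> (Suc k) k / 2"
proof -
  have "{0..k} = {..<Suc k}" by auto
  then show ?thesis unfolding alpha_def walk_integral_def
    by (auto intro!: arg_cong2[where f = "(/)"] nn_integral_cong prod.cong)
qed

lemma measurable_kernel:
  assumes "kernel \<kappa>" "i \<in> J" "j \<in> J"
  shows "(\<lambda>y. \<kappa> (y i) (y j)) \<in> borel_measurable (PiM J (\<lambda>_. \<mu>))"
proof -
  have "(\<lambda>y. (y i, y j)) \<in> measurable (PiM J (\<lambda>_. \<mu>)) (borel \<Otimes>\<^sub>M borel)"
  proof (rule measurable_Pair)
    show "(\<lambda>y. y i) \<in> measurable (PiM J (\<lambda>_. \<mu>)) borel"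
      using measurable_component_singleton[OF assms(2), of "\<lambda>_. \<mu>"] measurable_cong_sets[OF refl sets_mu] by blast
    show "(\<lambda>y. y j) \<in> measurable (PiM J (\<lambda>_. \<mu>)) borel"
      using measurable_component_singleton[OF assms(3), of "\<lambda>_. \<mu>"] measurable_cong_sets[OF refl sets_mu] by blast
  qed
  then have "(\<lambda>y. (y i, y j)) \<in> measurable (PiM J (\<lambda>_. \<mu>)) borel" by (simp only: borel_prod)
  moreover have "(\<lambda>(s, t). \<kappa> s t) \<in> borel_measurable borel" using assms(1) by (simp add: kernel_def)
  ultimately have "(\<lambda>(s, t). \<kappa> s t) \<circ> (\<lambda>y. (y i, y j)) \<in> borel_measurable (PiM J (\<lambda>_. \<mu>))"
    by (rule measurable_comp)
  then show ?thesis by (simp add: o_def)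
qed

text \<open>Only indices are shifted, but the two integrals live on different product spaces, so the
  shift is first shown to carry one product measure to the other.\<close>

lemma beta_eq_walk_integral:
  assumes \<kappa>: "kernel \<kappa>" and k: "1 \<le> k"
  shows "beta \<mu> \<kappa> k = walk_integral \<mu> \<kappa> k k / of_nat (2 * k)"
proof -
  let ?t = "\<lambda>\<omega>. \<lambda>i\<in>{1..k}. \<omega> (i - 1)"
  have t: "?t \<in> measurable (PiM {..<k} (\<lambda>_. \<mu>)) (PiM {1..k} (\<lambda>_. \<mu>))"
    by (rule measurable_restrict) (rule measurable_component_singleton, use k in auto)
  have D: "distr (PiM {..<k} (\<lambda>_. \<mu>)) (PiM {1..k} (\<lambda>_. \<mu>)) ?t = PiM {1..k} (\<lambda>_. \<mu>)"
  proof (rule PiM_eqI)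
    fix A :: "nat \<Rightarrow> 'a set" assume A: "\<And>i. i \<in> {1..k} \<Longrightarrow> A i \<in> sets \<mu>"
    have "?t -` PiE {1..k} A \<inter> space (PiM {..<k} (\<lambda>_. \<mu>)) = PiE {..<k} (\<lambda>i. A (Suc i))"
    proof (intro equalityI subsetI)
      fix \<omega> assume w: "\<omega> \<in> ?t -` PiE {1..k} A \<inter> space (PiM {..<k} (\<lambda>_. \<mu>))"
      have "\<omega> i \<in> A (Suc i)" if "i < k" for i
        using w that PiE_mem[of "?t \<omega>" "{1..k}" A "Suc i"] by auto
      then show "\<omega> \<in> PiE {..<k} (\<lambda>i. A (Suc i))" using w by (auto simp: space_PiM PiE_def)
    next
      fix \<omega> assume w: "\<omega> \<in> PiE {..<k} (\<lambda>i. A (Suc i))"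
      have "\<omega> (i - 1) \<in> A i" if "i \<in> {1..k}" for i
        using PiE_mem[OF w, of "i - 1"] that by auto
      then show "\<omega> \<in> ?t -` PiE {1..k} A \<inter> space (PiM {..<k} (\<lambda>_. \<mu>))"
        using w by (auto simp: space_PiM PiE_def space_mu)
    qed
    then have "emeasure (distr (PiM {..<k} (\<lambda>_. \<mu>)) (PiM {1..k} (\<lambda>_. \<mu>)) ?t) (PiE {1..k} A)
        = emeasure (PiM {..<k} (\<lambda>_. \<mu>)) (PiE {..<k} (\<lambda>i. A (Suc i)))"
      using A by (subst emeasure_distr[OF t]) (auto intro!: sets_PiM_I_finite)
    also have "\<dots> = (\<Prod>i<k. emeasure \<mu> (A (Suc i)))"
      using A by (subst emeasure_PiM) auto
    also have "\<dots> = (\<Prod>i\<in>{1..k}. emeasure \<mu> (A i))"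
      by (rule prod.reindex_bij_witness[of _ "\<lambda>i. i - 1" Suc]) auto
    finally show "emeasure (distr (PiM {..<k} (\<lambda>_. \<mu>)) (PiM {1..k} (\<lambda>_. \<mu>)) ?t) (PiE {1..k} A)
        = (\<Prod>i\<in>{1..k}. emeasure \<mu> (A i))" .
  qed simp_all
  let ?f = "\<lambda>y. (\<Prod>i\<in>{1..<k}. ennreal (\<kappa> (y i) (y (Suc i)))) * ennreal (\<kappa> (y k) (y 1))"
  have meas: "?f \<in> borel_measurable (PiM {1..k} (\<lambda>_. \<mu>))"
    by (intro borel_measurable_times_ennreal borel_measurable_prod_ennreal
        measurable_compose[OF measurable_kernel[OF \<kappa>] measurable_ennreal]) (use k in auto)
  have "(\<integral>\<^sup>+ y. ?f y \<partial>PiM {1..k} (\<lambda>_. \<mu>)) = (\<integral>\<^sup>+ y. ?f (?t y) \<partial>PiM {..<k} (\<lambda>_. \<mu>))"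
    by (subst D[symmetric], rule nn_integral_distr[OF t]) (use meas in simp)
  also have "\<dots> = walk_integral \<mu> \<kappa> k k"
    unfolding walk_integral_def
  proof (rule nn_integral_cong)
    fix y :: "nat \<Rightarrow> 'a"
    obtain m where m: "k = Suc m" using k by (cases k) auto
    have "(\<Prod>i\<in>{1..<k}. ennreal (\<kappa> (?t y i) (?t y (Suc i)))) = (\<Prod>i<m. ennreal (\<kappa> (y i) (y (Suc i))))"
      by (rule prod.reindex_bij_witness[of _ Suc "\<lambda>i. i - 1"]) (auto simp: m)
    also have "\<dots> = (\<Prod>i<m. ennreal (\<kappa> (y i) (y (Suc i mod k))))"
      by (rule prod.cong) (auto simp: m)
    finally show "?f (?t y) = (\<Prod>i<k. ennreal (\<kappa> (y i) (y (Suc i mod k))))"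
      by (simp add: m)
  qed
  finally show ?thesis by (simp add: beta_def)
qed

text \<open>By Fubini with coordinates \<open>i\<close> and \<open>j\<close> integrated first, the
  exceptional set has the measure of \<open>N\<close> as inner integral. This requires the two
  coordinates to be different.\<close>

lemma AE_PiM_pair:
  fixes r i j :: nat
  assumes P: "AE z in \<mu> \<Otimes>\<^sub>M \<mu>. P z" and ij: "i < r" "j < r" "i \<noteq> j"
  shows "AE y in PiM {..<r} (\<lambda>_. \<mu>). P (y i, y j)"
proof -
  interpret pr: pair_sigma_finite \<mu> \<mu>
    by (simp add: pair_sigma_finite_def sigma_finite_measure_axioms)
  obtain N where N: "N \<in> sets (\<mu> \<Otimes>\<^sub>M \<mu>)" "emeasure (\<mu> \<Otimes>\<^sub>M \<mu>) N = 0"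
    "{z \<in> space (\<mu> \<Otimes>\<^sub>M \<mu>). \<not> P z} \<subseteq> N"
    using P by (auto elim!: AE_E)
  define R where "R = {..<r} - {i, j}"
  have r: "{..<r} = insert i (insert j R)" and R: "finite R" "i \<notin> insert j R" "j \<notin> R"
    using ij by (auto simp: R_def)
  have meas: "(\<lambda>y. indicator N (y a, y b) :: ennreal) \<in> borel_measurable (PiM J (\<lambda>_. \<mu>))"
    if "a \<in> J" "b \<in> J" for a b J
  proof -
    have "(\<lambda>y. (y a, y b)) \<in> measurable (PiM J (\<lambda>_. \<mu>)) (\<mu> \<Otimes>\<^sub>M \<mu>)"
      using that by (intro measurable_Pair measurable_component_singleton)
    then show ?thesis using N(1) by (rule measurable_compose[OF _ borel_measurable_indicator])
  qed
  have "(\<integral>\<^sup>+ y. indicator N (y i, y j) \<partial>PiM {..<r} (\<lambda>_. \<mu>))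
      = (\<integral>\<^sup>+ y. (\<integral>\<^sup>+ s. indicator N (s, y j) \<partial>\<mu>) \<partial>PiM (insert j R) (\<lambda>_. \<mu>))"
    unfolding r using R ij(3) by (subst product_nn_integral_insert) (auto intro!: meas)
  also have "\<dots> = (\<integral>\<^sup>+ y. (\<integral>\<^sup>+ t. (\<integral>\<^sup>+ s. indicator N (s, t) \<partial>\<mu>) \<partial>\<mu>) \<partial>PiM R (\<lambda>_. \<mu>))"
  proof (subst product_nn_integral_insert)
    have *: "(\<lambda>t. \<integral>\<^sup>+ s. indicator N (s, t) \<partial>\<mu>) \<in> borel_measurable \<mu>"
      using N(1) by (intro borel_measurable_nn_integral) (simp add: measurable_split_conv)
    show "(\<lambda>y. \<integral>\<^sup>+ s. indicator N (s, y j) \<partial>\<mu>) \<in> borel_measurable (PiM (insert j R) (\<lambda>_. \<mu>))"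
      using measurable_comp[OF measurable_component_singleton[of j "insert j R" "\<lambda>_. \<mu>"] *]
      by (simp add: o_def)
  qed (use R in auto)
  also have "(\<integral>\<^sup>+ t. (\<integral>\<^sup>+ s. indicator N (s, t) \<partial>\<mu>) \<partial>\<mu>) = 0"
    using pr.nn_integral_snd[of "indicator N"] N by simp
  finally have "(\<integral>\<^sup>+ y. indicator N (y i, y j) \<partial>PiM {..<r} (\<lambda>_. \<mu>)) = 0" by simp
  then have "AE y in PiM {..<r} (\<lambda>_. \<mu>). indicator N (y i, y j) = (0::ennreal)"
    using ij by (subst (asm) nn_integral_0_iff_AE) (auto intro!: meas)
  then show ?thesis
  proof (rule AE_mp, intro AE_I2 impI)
    fix y :: "nat \<Rightarrow> 'a" assume "indicator N (y i, y j) = (0::ennreal)"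
    then show "P (y i, y j)" using N(3) by (auto simp: space_pair_measure space_mu indicator_def split: if_splits)
  qed
qed

text \<open>Consecutive positions of a walk are different, so each of the finitely many factors
  falls under \<open>AE_PiM_pair\<close>.\<close>

lemma AE_isCont_walk:
  assumes \<kappa>: "ae_continuous \<mu> \<kappa>" and shape: "shape r k \<sigma>"
  shows "AE y in PiM {..<r} (\<lambda>_. \<mu>). \<forall>i<k. isCont (\<lambda>y. \<kappa> (y i) (y (Suc i mod r))) y"
proof -
  have "AE y in PiM {..<r} (\<lambda>_. \<mu>). isCont (\<lambda>(s, t). \<kappa> s t) (y i, y (Suc i mod r))" if "i < k" for i
    using walk_step(1-3)[OF shape that that] \<kappa> by (intro AE_PiM_pair) (auto simp: ae_continuous_def)
  then have "AE y in PiM {..<r} (\<lambda>_. \<mu>). \<forall>i\<in>{..<k}. isCont (\<lambda>(s, t). \<kappa> s t) (y i, y (Suc i mod r))"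
    by (intro AE_finite_allI) auto
  then show ?thesis
  proof (rule AE_mp, intro AE_I2 impI allI)
    fix y :: "nat \<Rightarrow> 'a" and i
    assume "\<forall>i\<in>{..<k}. isCont (\<lambda>(s, t). \<kappa> s t) (y i, y (Suc i mod r))" "i < k"
    then have c: "isCont (\<lambda>(s, t). \<kappa> s t) (y i, y (Suc i mod r))" by blast
    have coord: "isCont (\<lambda>y::nat \<Rightarrow> 'a. y m) y" for m
      using continuous_on_product_coordinates[of m] continuous_on_eq_continuous_at[OF open_UNIV] by blast
    have "((\<lambda>y. (y i, y (Suc i mod r))) \<longlongrightarrow> (y i, y (Suc i mod r))) (at y)"
      using coord[of i] coord[of "Suc i mod r"] by (intro tendsto_Pair) (simp_all add: isCont_def)
    from isCont_tendsto_compose[OF c this]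
    show "isCont (\<lambda>y. \<kappa> (y i) (y (Suc i mod r))) y" by (simp add: isCont_def)
  qed
qed

text \<open>The truncated products converge pointwise to the full one, so by Fatou some level
  \<open>B\<close> already has an integral above \<open>c\<close>, even if the walk integral is
  infinite. Continuity of the truncation keeps the integrand almost everywhere continuous.\<close>

lemma eventually_sum_cutoff:
  assumes \<kappa>: "kernel \<kappa>" "ae_continuous \<mu> \<kappa>" and shape: "shape r k \<sigma>"
    and c: "ennreal c < walk_integral \<mu> \<kappa> r k" "0 \<le> c"
  shows "\<exists>B. eventually (\<lambda>(xs, n). c < (\<Sum>vs\<in>inj_lists r (length xs).
      \<Prod>i<k. cutoff B (\<kappa> (xs ! (vs ! i)) (xs ! (vs ! (Suc i mod r))))) / n ^ r) (sample_filter \<mu>)"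
proof -
  have \<kappa>0: "0 \<le> \<kappa> s t" for s t using \<kappa>(1) by (simp add: kernel_def)
  define \<Psi> where "\<Psi> B y = (\<Prod>i<k. cutoff B (\<kappa> (y i) (y (Suc i mod r))))" for B and y :: "nat \<Rightarrow> 'a"
  have \<Psi>0: "0 \<le> \<Psi> B y" for B y by (simp add: \<Psi>_def prod_nonneg cutoff_nonneg)
  have rp: "0 < r" using shapeD(4)[OF shape] by simp
  have "walk_integral \<mu> \<kappa> r k = (\<integral>\<^sup>+ y. liminf (\<lambda>B. ennreal (\<Psi> B y)) \<partial>PiM {..<r} (\<lambda>_. \<mu>))"
    unfolding walk_integral_def
  proof (rule nn_integral_cong)
    fix y :: "nat \<Rightarrow> 'a"
    let ?P = "\<Prod>i<k. \<kappa> (y i) (y (Suc i mod r))"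
    \<comment> \<open>From this level on none of the factors at \<open>y\<close> is
      truncated.\<close>
    obtain B0 :: nat where B0: "(\<Sum>i<k. \<kappa> (y i) (y (Suc i mod r))) \<le> real B0"
      using real_arch_simple by blast
    have "\<Psi> B y = ?P" if "B0 \<le> B" for B
      unfolding \<Psi>_def
    proof (rule prod.cong[OF refl])
      fix i assume i: "i \<in> {..<k}"
      have "\<kappa> (y i) (y (Suc i mod r)) \<le> (\<Sum>i<k. \<kappa> (y i) (y (Suc i mod r)))"
        by (rule member_le_sum[OF i]) (auto simp: \<kappa>0)
      then show "cutoff B (\<kappa> (y i) (y (Suc i mod r))) = \<kappa> (y i) (y (Suc i mod r))"
        using B0 that by (intro cutoff_eq_self) (auto simp: \<kappa>0)
    qed
    then have "(\<lambda>B. ennreal (\<Psi> B y)) \<longlonglongrightarrow> ennreal ?P"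
      by (intro tendsto_eventually eventually_sequentiallyI[of B0]) simp
    then show "(\<Prod>i<k. ennreal (\<kappa> (y i) (y (Suc i mod r)))) = liminf (\<lambda>B. ennreal (\<Psi> B y))"
      by (subst lim_imp_Liminf) (auto simp: prod_ennreal \<kappa>0)
  qed
  also have "\<dots> \<le> liminf (\<lambda>B. \<integral>\<^sup>+ y. ennreal (\<Psi> B y) \<partial>PiM {..<r} (\<lambda>_. \<mu>))"
  proof (rule nn_integral_liminf)
    fix B
    have "(\<lambda>y. \<Psi> B y) \<in> borel_measurable (PiM {..<r} (\<lambda>_. \<mu>))"
      unfolding \<Psi>_def cutoff_def
      by (intro borel_measurable_prod borel_measurable_max borel_measurable_min borel_measurable_const
          borel_measurable_times borel_measurable_diff measurable_kernel[OF \<kappa>(1)])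
        (use walk_step(1,2)[OF shape] in auto)
    then show "(\<lambda>y. ennreal (\<Psi> B y)) \<in> borel_measurable (PiM {..<r} (\<lambda>_. \<mu>))" by simp
  qed
  finally have "ennreal c < liminf (\<lambda>B. \<integral>\<^sup>+ y. ennreal (\<Psi> B y) \<partial>PiM {..<r} (\<lambda>_. \<mu>))"
    using c(1) by simp
  from less_LiminfD[OF this] obtain B where B: "ennreal c < (\<integral>\<^sup>+ y. ennreal (\<Psi> B y) \<partial>PiM {..<r} (\<lambda>_. \<mu>))"
    by (auto simp: eventually_sequentially)
  have "eventually (\<lambda>(xs, n). c < (\<Sum>vs\<in>inj_lists r (length xs). \<Psi> B (\<lambda>i. xs ! (vs ! i))) / n ^ r) (sample_filter \<mu>)"
  proof (rule eventually_sum_inj_lists[OF \<Psi>0 _ _ _ B c(2)])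
    show "\<Psi> B y \<le> (real B + 1) ^ k" for y
      unfolding \<Psi>_def using prod_mono[of "{..<k}" "\<lambda>i. cutoff B (\<kappa> (y i) (y (Suc i mod r)))" "\<lambda>_. real B + 1"]
      by (simp add: cutoff_nonneg cutoff_le)
    show "\<Psi> B y = \<Psi> B z" if *: "\<And>i. i < r \<Longrightarrow> y i = z i" for y z
      unfolding \<Psi>_def by (rule prod.cong) (use * walk_step(1,2)[OF shape] in auto)
    show "AE y in PiM {..<r} (\<lambda>_. \<mu>). isCont (\<Psi> B) y"
      using AE_isCont_walk[OF \<kappa>(2) shape]
    proof (rule AE_mp, intro AE_I2 impI)
      fix y :: "nat \<Rightarrow> 'a" assume "\<forall>i<k. isCont (\<lambda>y. \<kappa> (y i) (y (Suc i mod r))) y"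
      then show "isCont (\<Psi> B) y"
        unfolding \<Psi>_def[abs_def] by (intro continuous_prod isCont_cutoff) auto
    qed
  qed
  then show ?thesis unfolding \<Psi>_def by blast
qed

lemma sum_inj_lists_edge_prob:
  assumes \<kappa>: "kernel \<kappa>" and shape: "shape r k \<sigma>"
  shows "real \<sigma> * mean_copies r k \<kappa> n xs = (\<Sum>vs\<in>inj_lists r (length xs).
      \<Prod>i<k. min (\<kappa> (xs ! (vs ! i)) (xs ! (vs ! (Suc i mod r))) / n) 1)"
  unfolding mean_copies_def sum_copies[OF shape]
proof (rule sum.cong[OF refl])
  fix vs assume vs: "vs \<in> inj_lists r (length xs)"
  have "\<kappa> s t = \<kappa> t s" for s t using \<kappa> by (simp add: kernel_def)
  then have "edge_prob \<kappa> n xs (ordered_edge a b) = min (\<kappa> (xs ! a) (xs ! b) / n) 1" for a b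
    by (simp add: edge_prob_def ordered_edge_def min_def max_def)
  then show "prod (edge_prob \<kappa> n xs) (walk_edges k vs)
      = (\<Prod>i<k. min (\<kappa> (xs ! (vs ! i)) (xs ! (vs ! (Suc i mod r))) / n) 1)"
    using prod_walk_edges[OF shape, of vs "edge_prob \<kappa> n xs"] vs by (simp add: inj_lists_def)
qed

text \<open>For \<open>n \<ge> real B + 1\<close> the minimum in the edge probability is inactive on
  good copies, and there \<open>\<kappa>\<close> dominates its truncation; on the other copies the
  truncated product is zero. The power \<open>n ^ (r - k)\<close> is what remains of
  \<open>n ^ r\<close> after a division by \<open>n\<close> for each edge.\<close>

lemma eventually_good_copies:
  assumes \<kappa>: "kernel \<kappa>" "ae_continuous \<mu> \<kappa>" and shape: "shape r k \<sigma>"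
    and c: "ennreal c < walk_integral \<mu> \<kappa> r k / of_nat \<sigma>" "0 \<le> c"
  shows "\<exists>B. eventually (\<lambda>(xs, n). c * n ^ (r - k) < (\<Sum>S\<in>good_copies r k \<kappa> xs B. prod (edge_prob \<kappa> n xs) S))
    (sample_filter \<mu>)"
proof -
  have sym: "\<kappa> s t = \<kappa> t s" and \<kappa>0: "0 \<le> \<kappa> s t" for s t using \<kappa>(1) by (auto simp: kernel_def)
  have \<sigma>: "0 < \<sigma>" using shapeD(5)[OF shape] .
  have "ennreal (c * real \<sigma>) < walk_integral \<mu> \<kappa> r k"
  proof -
    have "ennreal c * of_nat \<sigma> < walk_integral \<mu> \<kappa> r k / of_nat \<sigma> * of_nat \<sigma>"
      using c(1) \<sigma> by (intro ennreal_mult_strict_right_mono) (auto simp: ennreal_of_nat_eq_real_of_nat)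
    also have "\<dots> = walk_integral \<mu> \<kappa> r k"
      using \<sigma> by (simp add: divide_ennreal_def mult.assoc ennreal_of_nat_eq_real_of_nat inverse_ennreal flip: ennreal_mult)
    finally show ?thesis using c(2) by (simp add: ennreal_mult ennreal_of_nat_eq_real_of_nat)
  qed
  from eventually_sum_cutoff[OF \<kappa> shape this] c(2) obtain B where
    B: "eventually (\<lambda>(xs, n). c * real \<sigma> < (\<Sum>vs\<in>inj_lists r (length xs).
      \<Prod>i<k. cutoff B (\<kappa> (xs ! (vs ! i)) (xs ! (vs ! (Suc i mod r))))) / n ^ r) (sample_filter \<mu>)"
    by auto
  have "eventually (\<lambda>(xs, n). real B + 1 \<le> n) (sample_filter \<mu>)" by (rule eventually_parameter_ge)
  then have "eventually (\<lambda>(xs, n). c * n ^ (r - k) < (\<Sum>S\<in>good_copies r k \<kappa> xs B. prod (edge_prob \<kappa> n xs) S))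
    (sample_filter \<mu>)" using B
  proof eventually_elim
    case (elim z)
    obtain xs n where z: "z = (xs, n)" by fastforce
    have n: "real B + 1 \<le> n" "0 < n" using elim z by auto
    let ?good = "\<lambda>S. \<forall>(i, j)\<in>S. \<kappa> (xs ! i) (xs ! j) < real B + 1"
    have "(\<Sum>S\<in>good_copies r k \<kappa> xs B. prod (edge_prob \<kappa> n xs) S)
        = (\<Sum>S\<in>copies r k (length xs). if ?good S then prod (edge_prob \<kappa> n xs) S else 0)"
      unfolding good_copies_def by (rule sum.inter_filter) simp
    then have "real \<sigma> * (\<Sum>S\<in>good_copies r k \<kappa> xs B. prod (edge_prob \<kappa> n xs) S)
        = (\<Sum>vs\<in>inj_lists r (length xs). if ?good (walk_edges k vs) then prod (edge_prob \<kappa> n xs) (walk_edges k vs) else 0)"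
      using sum_copies[OF shape, of "\<lambda>S. if ?good S then prod (edge_prob \<kappa> n xs) S else 0"] by simp
    moreover have "(\<Sum>vs\<in>inj_lists r (length xs). (\<Prod>i<k. cutoff B (\<kappa> (xs ! (vs ! i)) (xs ! (vs ! (Suc i mod r))))) / n ^ k)
        \<le> \<dots>"
    proof (rule sum_mono)
      fix vs assume vs: "vs \<in> inj_lists r (length xs)"
      let ?\<kappa> = "\<lambda>i. \<kappa> (xs ! (vs ! i)) (xs ! (vs ! (Suc i mod r)))"
      have len: "length vs = r" "distinct vs" using vs by (auto simp: inj_lists_def)
      have ep: "edge_prob \<kappa> n xs (ordered_edge a b) = min (\<kappa> (xs ! a) (xs ! b) / n) 1" for a b
        using sym by (simp add: edge_prob_def ordered_edge_def min_def max_def)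
      have good: "?good (walk_edges k vs) \<longleftrightarrow> (\<forall>i<k. ?\<kappa> i < real B + 1)"
      proof -
        have "(case ordered_edge a b of (i, j) \<Rightarrow> \<kappa> (xs ! i) (xs ! j) < real B + 1)
          \<longleftrightarrow> \<kappa> (xs ! a) (xs ! b) < real B + 1" for a b
          using sym by (simp add: ordered_edge_def min_def max_def)
        then show ?thesis using len by (auto simp: walk_edges_def)
      qed
      show "(\<Prod>i<k. cutoff B (?\<kappa> i)) / n ^ k
        \<le> (if ?good (walk_edges k vs) then prod (edge_prob \<kappa> n xs) (walk_edges k vs) else 0)"
      proof (cases "\<forall>i<k. ?\<kappa> i < real B + 1")
        case True
        have "(\<Prod>i<k. cutoff B (?\<kappa> i)) / n ^ k = (\<Prod>i<k. cutoff B (?\<kappa> i) / n)"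
          by (simp add: prod_dividef)
        also have "\<dots> \<le> (\<Prod>i<k. min (?\<kappa> i / n) 1)"
        proof (rule prod_mono)
          fix i assume i: "i \<in> {..<k}"
          have "?\<kappa> i < real B + 1" using True i by blast
          then have "?\<kappa> i \<le> n" using n(1) by linarith
          then have "?\<kappa> i / n \<le> 1" using n(2) by simp
          then show "0 \<le> cutoff B (?\<kappa> i) / n \<and> cutoff B (?\<kappa> i) / n \<le> min (?\<kappa> i / n) 1"
            using n cutoff_nonneg cutoff_le_self[OF \<kappa>0] by (simp add: divide_right_mono)
        qed
        also have "\<dots> = prod (edge_prob \<kappa> n xs) (walk_edges k vs)"
          using prod_walk_edges[OF shape len, of "edge_prob \<kappa> n xs"] by (simp add: ep)
        finally show ?thesis using good True by simp
      next
        case False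
        \<comment> \<open>A single edge with too large a kernel value makes the truncated product
          vanish.\<close>
        then obtain i where i: "i < k" "real B + 1 \<le> ?\<kappa> i" by (auto simp: not_less)
        then have zero: "(\<Prod>i<k. cutoff B (?\<kappa> i)) = 0"
          by (intro prod_zero) (auto intro!: bexI[of _ i] cutoff_eq_0)
        have "\<not> ?good (walk_edges k vs)" using good False by blast
        then show ?thesis unfolding zero by (simp only: if_False div_0 order_refl)
      qed
    qed
    ultimately have ge: "(\<Sum>vs\<in>inj_lists r (length xs). \<Prod>i<k. cutoff B (\<kappa> (xs ! (vs ! i)) (xs ! (vs ! (Suc i mod r))))) / n ^ k
        \<le> real \<sigma> * (\<Sum>S\<in>good_copies r k \<kappa> xs B. prod (edge_prob \<kappa> n xs) S)"
      by (simp add: sum_divide_distrib)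
    have nr: "n ^ r = n ^ (r - k) * n ^ k" using shapeD(2)[OF shape] by (simp flip: power_add)
    have "c * real \<sigma> * n ^ (r - k) < (\<Sum>vs\<in>inj_lists r (length xs). \<Prod>i<k. cutoff B (\<kappa> (xs ! (vs ! i)) (xs ! (vs ! (Suc i mod r))))) / n ^ k"
      using elim z n by (simp add: nr field_simps)
    then have "real \<sigma> * (c * n ^ (r - k)) < real \<sigma> * (\<Sum>S\<in>good_copies r k \<kappa> xs B. prod (edge_prob \<kappa> n xs) S)"
      using ge by (simp add: mult_ac)
    then show ?case using \<sigma> z by simp
  qed
  then show ?thesis by blast
qed

end

section \<open>The counts given a good sample\<close>

lemma independent_edges_edge_prob:
  assumes "kernel \<kappa>" "0 < n"
  shows "independent_edges (pairs_below v) (edge_prob \<kappa> n xs)"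
  by standard (use assms in \<open>auto simp: kernel_def edge_prob_def\<close>)

lemma expectation_graph_given:
  fixes f :: "graph \<Rightarrow> real"
  shows "measure_pmf.expectation (graph_given \<kappa> n xs) f
    = measure_pmf.expectation (random_subset (pairs_below (length xs)) (edge_prob \<kappa> n xs))
        (\<lambda>E. f (to_graph (length xs) E))"
  by (simp add: graph_given_eq edge_prob_def)

lemma expectation_graph_given_copies:
  fixes f :: "graph \<Rightarrow> real"
  assumes "\<And>E. E \<subseteq> pairs_below (length xs) \<Longrightarrow> f (to_graph (length xs) E) = g E"
  shows "measure_pmf.expectation (graph_given \<kappa> n xs) f
    = measure_pmf.expectation (random_subset (pairs_below (length xs)) (edge_prob \<kappa> n xs)) g"
  unfolding expectation_graph_given
proof (rule integral_cong_AE)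
  have "E \<subseteq> pairs_below (length xs)"
    if "E \<in> set_pmf (random_subset (pairs_below (length xs)) (edge_prob \<kappa> n xs))" for E
    using that set_pmf_random_subset by blast
  then show "AE E in random_subset (pairs_below (length xs)) (edge_prob \<kappa> n xs). f (to_graph (length xs) E) = g E"
    using assms by (simp add: AE_measure_pmf_iff)
qed simp_all

lemma finite_set_pmf_graph_given [simp]: "finite (set_pmf (graph_given \<kappa> n xs))"
  by (simp add: graph_given_eq)

lemma integrable_graph_given [simp]:
  fixes f :: "graph \<Rightarrow> real"
  shows "integrable (measure_pmf (graph_given \<kappa> n xs)) f"
  by (rule integrable_measure_pmf_finite) simp

lemma mean_num_paths:
  assumes \<kappa>: "kernel \<kappa>" and k: "1 \<le> k" and n: "0 < n"
  shows "measure_pmf.expectation (graph_given \<kappa> n xs) (\<lambda>G. real (num_paths k G))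
    = mean_copies (Suc k) k \<kappa> n xs"
proof -
  interpret independent_edges "pairs_below (length xs)" "edge_prob \<kappa> n xs"
    by (rule independent_edges_edge_prob[OF \<kappa> n])
  have "measure_pmf.expectation (graph_given \<kappa> n xs) (\<lambda>G. real (num_paths k G))
      = expect (\<lambda>E. real (copies_in (copies (Suc k) k (length xs)) E))"
    by (rule expectation_graph_given_copies) (simp add: num_paths_eq[OF k] copies_in_def)
  also have "\<dots> = mean_copies (Suc k) k \<kappa> n xs"
    unfolding mean_copies_def by (rule expect_copies_in) (use copies_subset[OF shape_path[OF k]] in auto)
  finally show ?thesis .
qed

lemma mean_num_cycles:
  assumes \<kappa>: "kernel \<kappa>" and k: "3 \<le> k" and n: "0 < n"
  shows "measure_pmf.expectation (graph_given \<kappa> n xs) (\<lambda>G. real (num_cycles k G))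
    = mean_copies k k \<kappa> n xs"
proof -
  interpret independent_edges "pairs_below (length xs)" "edge_prob \<kappa> n xs"
    by (rule independent_edges_edge_prob[OF \<kappa> n])
  have "measure_pmf.expectation (graph_given \<kappa> n xs) (\<lambda>G. real (num_cycles k G))
      = expect (\<lambda>E. real (copies_in (copies k k (length xs)) E))"
    by (rule expectation_graph_given_copies) (simp add: num_cycles_eq[OF k] copies_in_def)
  also have "\<dots> = mean_copies k k \<kappa> n xs"
    unfolding mean_copies_def by (rule expect_copies_in) (use copies_subset[OF shape_cycle[OF k]] in auto)
  finally show ?thesis .
qed

lemma good_copies_subset: "good_copies r k \<kappa> xs B \<subseteq> copies r k (length xs)"
  by (auto simp: good_copies_def)

lemma finite_good_copies [simp]: "finite (good_copies r k \<kappa> xs B)"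
  by (rule finite_subset[OF good_copies_subset]) simp

text \<open>The parameter \<open>b\<close> lets cycle lengths with different truncation levels share
  one bound.\<close>

lemma good_copies_edge_prob:
  assumes "kernel \<kappa>" "0 < n" "S \<in> good_copies r k \<kappa> xs B" "e \<in> S" "real B + 1 \<le> b"
  shows "0 \<le> edge_prob \<kappa> n xs e \<and> edge_prob \<kappa> n xs e \<le> b / n"
proof -
  obtain i j where e: "e = (i, j)" by fastforce
  have "\<kappa> (xs ! i) (xs ! j) < real B + 1" using assms(3,4) e by (auto simp: good_copies_def)
  then have "\<kappa> (xs ! i) (xs ! j) / n \<le> b / n" using assms(2,5) by (intro divide_right_mono) auto
  then show ?thesis using assms(1,2) by (auto simp: e edge_prob_def kernel_def)
qed

lemma copies_in_mono: "F \<subseteq> F' \<Longrightarrow> finite F' \<Longrightarrow> copies_in F E \<le> copies_in F' E"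
  unfolding copies_in_def by (rule card_mono) auto

section \<open>Deviation bounds conditional on the points\<close>

context generalized_ground_space
begin

lemma eventually_length_le: "eventually (\<lambda>(xs, n). real (length xs) \<le> (measure \<mu> UNIV + 1) * n) (sample_filter \<mu>)"
proof -
  have "eventually (\<lambda>z. (\<lambda>(xs, n). real (length xs) / n) z < measure \<mu> UNIV + 1) (sample_filter \<mu>)"
    by (rule order_tendstoD[OF tendsto_length]) simp
  moreover have "eventually (\<lambda>(xs, n). 1 \<le> n) (sample_filter \<mu>)" by (rule eventually_parameter_ge)
  ultimately show ?thesis by eventually_elim (auto simp: field_simps split: prod.splits)
qed

text \<open>Chebyshev for the good paths: at a suitable truncation level their conditional mean
  exceeds \<open>c' * n\<close> with \<open>c' > c\<close>, and their variance is of order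
  \<open>n\<close>. Further paths can only make a low count less likely.\<close>

lemma paths_lower_tail:
  assumes \<kappa>: "kernel \<kappa>" "ae_continuous \<mu> \<kappa>" and k: "1 \<le> k"
    and a: "alpha \<mu> \<kappa> k = ennreal a" "c < a"
  shows "((\<lambda>(xs, n). measure_pmf.prob (graph_given \<kappa> n xs) {G. real (num_paths k G) / n \<le> c}) \<longlongrightarrow> 0)
    (sample_filter \<mu>)"
proof (cases "c < 0")
  \<comment> \<open>A negative level is never reached. For \<open>c \<ge> 0\<close> the level
    \<open>c'\<close> chosen below is nonnegative and embeds into \<open>ennreal\<close>.\<close>
  case True
  have "eventually (\<lambda>(xs, n). 1 \<le> n) (sample_filter \<mu>)" by (rule eventually_parameter_ge)
  then have "eventually (\<lambda>z. (\<lambda>(xs, n). measure_pmf.prob (graph_given \<kappa> n xs) {G. real (num_paths k G) / n \<le> c}) z = 0)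
      (sample_filter \<mu>)"
  proof eventually_elim
    case (elim z)
    obtain xs n where z: "z = (xs, n)" by fastforce
    have "0 \<le> real (num_paths k G) / n" for G using elim z by simp
    then have empty: "{G. real (num_paths k G) / n \<le> c} = {}" using True by (auto simp: not_le intro: less_le_trans)
    show ?case unfolding z prod.case empty by simp
  qed
  then show ?thesis by (rule tendsto_eventually)
next
  case False
  note shape = shape_path[OF k]
  define c' where "c' = (c + a) / 2"
  have c': "c < c'" "c' < a" "0 \<le> c'" using a False by (auto simp: c'_def)
  have "ennreal c' < walk_integral \<mu> \<kappa> (Suc k) k / of_nat 2"
    using a c' alpha_eq_walk_integral[OF k, of \<kappa>] by (simp add: ennreal_less_iff)
  from eventually_good_copies[OF \<kappa> shape this c'(3)] obtain B where
    B: "eventually (\<lambda>(xs, n). c' * n < (\<Sum>S\<in>good_copies (Suc k) k \<kappa> xs B. prod (edge_prob \<kappa> n xs) S)) (sample_filter \<mu>)"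
    by auto
  \<comment> \<open>\<open>L * n\<close> bounds the number of points, and \<open>C\<close> bounds
    \<open>p * v\<close> for the bound \<open>p = (real B + 1) / n\<close> on the edge probabilities
    of good copies.\<close>
  define L where "L = measure \<mu> UNIV + 1"
  define C where "C = (real B + 1) * L"
  have L: "0 < L" by (simp add: L_def add_nonneg_pos)
  have C: "0 \<le> C" using L by (simp add: C_def)
  define K where "K = (L * C ^ k + L * C ^ k * (real (Suc k) + C) ^ Suc k) / (c' - c)\<^sup>2"
  have "eventually (\<lambda>(xs, n). real B + 1 \<le> n) (sample_filter \<mu>)" by (rule eventually_parameter_ge)
  then have bound: "eventually (\<lambda>z. (\<lambda>(xs, n). measure_pmf.prob (graph_given \<kappa> n xs) {G. real (num_paths k G) / n \<le> c}) z
      \<le> K / snd z) (sample_filter \<mu>)"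
    using B eventually_length_le
  proof eventually_elim
    case (elim z)
    obtain xs n where z: "z = (xs, n)" by fastforce
    let ?v = "length xs"
    let ?F = "good_copies (Suc k) k \<kappa> xs B"
    define p where "p = (real B + 1) / n"
    have n: "real B + 1 \<le> n" "0 < n" and v: "real ?v \<le> L * n" using elim z by (auto simp: L_def)
    have p: "0 \<le> p" "p \<le> 1" using n by (auto simp: p_def)
    have pv: "p * real ?v \<le> C"
    proof -
      have "p * real ?v \<le> p * (L * n)" using v p by (intro mult_left_mono)
      then show ?thesis using n by (simp add: p_def C_def)
    qed
    interpret independent_edges "pairs_below ?v" "edge_prob \<kappa> n xs"
      by (rule independent_edges_edge_prob[OF \<kappa>(1) n(2)])
    let ?q = "edge_prob \<kappa> n xs"
    have q: "0 \<le> ?q e \<and> ?q e \<le> p" if "S \<in> ?F" "e \<in> S" for S e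
      unfolding p_def by (rule good_copies_edge_prob[OF \<kappa>(1) n(2) that]) simp
    have FU: "S \<subseteq> pairs_below ?v" if "S \<in> ?F" for S
      by (rule copies_subset[OF shape]) (use good_copies_subset[of "Suc k" k \<kappa> xs B] that in blast)
    note F = finite_good_copies[of "Suc k" k \<kappa> xs B] FU
    define m where "m = (\<Sum>S\<in>?F. prod ?q S)"
    have m: "c' * n < m" using elim z by (simp add: m_def)
    have fS: "finite S" if "S \<in> ?F" for S by (rule finite_subset[OF F(2)[OF that]]) simp
    have "m \<le> (\<Sum>S\<in>?F. p ^ card S)"
      unfolding m_def
    proof (rule sum_mono)
      fix S assume S: "S \<in> ?F"
      have "prod ?q S \<le> (\<Prod>e\<in>S. p)" by (rule prod_mono) (use q S in auto)
      then show "prod ?q S \<le> p ^ card S" by simp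
    qed
    also have "\<dots> \<le> real ?v * C ^ k"
      using sum_power_copies[OF p pv shape good_copies_subset] by simp
    finally have m_le: "m \<le> L * n * C ^ k" using v C mult_right_mono[OF v, of "C ^ k"] by simp
    have "overlap_sum ?q ?F \<le> real ?v ^ (Suc k - k) * C ^ k * (real (Suc k) + C) ^ Suc k"
      by (rule overlap_sum_copies[OF p pv shape good_copies_subset]) (use q in blast)
    then have "overlap_sum ?q ?F \<le> real ?v * C ^ k * (real (Suc k) + C) ^ Suc k" by simp
    also have "\<dots> \<le> L * n * C ^ k * (real (Suc k) + C) ^ Suc k"
      using v C by (intro mult_right_mono) auto
    finally have ov: "overlap_sum ?q ?F \<le> L * n * C ^ k * (real (Suc k) + C) ^ Suc k" .
    define t where "t = m - c * n"
    have t: "(c' - c) * n < t" using m by (simp add: t_def algebra_simps)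
    have t0: "0 < (c' - c) * n" using c' n by simp
    have "measure_pmf.prob (graph_given \<kappa> n xs) {G. real (num_paths k G) / n \<le> c}
        = measure_pmf.expectation (graph_given \<kappa> n xs) (\<lambda>G. of_bool (real (num_paths k G) / n \<le> c))"
    proof -
      have "(\<lambda>G. of_bool (real (num_paths k G) / n \<le> c)) = (indicator {G. real (num_paths k G) / n \<le> c} :: graph \<Rightarrow> real)"
        by (auto simp: indicator_def)
      then show ?thesis by simp
    qed
    also have "\<dots> = expect (\<lambda>E. of_bool (real (copies_in (copies (Suc k) k ?v) E) / n \<le> c))"
      by (rule expectation_graph_given_copies) (simp add: num_paths_eq[OF k] copies_in_def)
    also have "\<dots> \<le> expect (indicator {E. real (copies_in ?F E) \<le> m - t})"
    proof (rule integral_mono)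
      fix E
      have "real (copies_in ?F E) \<le> real (copies_in (copies (Suc k) k ?v) E)"
        using copies_in_mono[OF good_copies_subset finite_copies] by simp
      then show "of_bool (real (copies_in (copies (Suc k) k ?v) E) / n \<le> c) \<le> (indicator {E. real (copies_in ?F E) \<le> m - t} E :: real)"
        using n by (auto simp: indicator_def t_def field_simps)
    qed simp_all
    also have "\<dots> = measure_pmf.prob (random_subset (pairs_below ?v) ?q) {E. real (copies_in ?F E) \<le> m - t}" by simp
    also have "\<dots> \<le> (m + overlap_sum ?q ?F) / t\<^sup>2"
      unfolding m_def by (rule copies_in_lower_tail[OF F]) (use t t0 in auto)
    also have "\<dots> \<le> (L * n * C ^ k + L * n * C ^ k * (real (Suc k) + C) ^ Suc k) / ((c' - c) * n)\<^sup>2"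
    proof (rule frac_le)
      show "0 \<le> L * n * C ^ k + L * n * C ^ k * (real (Suc k) + C) ^ Suc k" using L C n by simp
      show "m + overlap_sum ?q ?F \<le> L * n * C ^ k + L * n * C ^ k * (real (Suc k) + C) ^ Suc k"
        using m_le ov by simp
      show "((c' - c) * n)\<^sup>2 \<le> t\<^sup>2" using t t0 by (intro power_mono) auto
      show "0 < ((c' - c) * n)\<^sup>2" using t0 by (rule zero_less_power)
    qed
    also have "\<dots> = n * (L * C ^ k + L * C ^ k * (real (Suc k) + C) ^ Suc k) / ((c' - c)\<^sup>2 * (n * n))"
      by (simp add: power_mult_distrib power2_eq_square algebra_simps)
    also have "\<dots> = K / n" using n by (simp add: K_def)
    finally show ?case by (simp add: z)
  qed
  have lim: "((\<lambda>z. K / snd z) \<longlongrightarrow> 0) (sample_filter \<mu>)"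
    by (rule real_tendsto_divide_at_top[OF tendsto_const filterlim_parameter])
  show ?thesis
    by (rule tendsto_sandwich[OF _ bound tendsto_const lim]) (auto intro!: always_eventually)
qed

text \<open>Only lower tails are known to be small. The upper deviation follows from Markov's
  inequality for \<open>X - a\<close>, which is made nonnegative by adding \<open>\<delta>\<close>
  and, on the rare event \<open>X \<le> a - \<delta>\<close>, also \<open>a\<close>. Its mean is the
  excess of the conditional mean plus small terms.\<close>

lemma paths_deviation:
  assumes \<kappa>: "kernel \<kappa>" "ae_continuous \<mu> \<kappa>" and k: "1 \<le> k"
    and a: "alpha \<mu> \<kappa> k = ennreal a" "0 \<le> a" and e0: "0 < e0"
  shows "\<exists>C\<ge>0. \<forall>\<epsilon>>0. eventually (\<lambda>(xs, n).
      measure_pmf.prob (graph_given \<kappa> n xs) {G. e0 < \<bar>real (num_paths k G) / n - a\<bar>}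
      \<le> C * ((mean_copies (Suc k) k \<kappa> n xs / n - a) + \<epsilon>)) (sample_filter \<mu>)"
proof (intro exI[of _ "1 / e0"] conjI allI impI)
  fix \<epsilon> :: real assume e: "0 < \<epsilon>"
  define \<delta> where "\<delta> = \<epsilon> / 2"
  \<comment> \<open>Chosen so that the error terms \<open>\<delta>\<close> and
    \<open>(a + e0) * \<delta>'\<close> of the final bound add up to
    \<open>\<epsilon>\<close>.\<close>
  define \<delta>' where "\<delta>' = \<epsilon> / (2 * (a + e0))"
  have \<delta>: "0 < \<delta>" "0 < \<delta>'" "(a + e0) * \<delta>' = \<delta>"
  proof -
    have "a + e0 \<noteq> 0" using e0 a by simp
    then have "(a + e0) * (\<epsilon> / (2 * (a + e0))) = \<epsilon> / 2" by (simp del: distrib_left_numeral)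
    then show "0 < \<delta>" "0 < \<delta>'" "(a + e0) * \<delta>' = \<delta>"
      using e e0 a by (simp_all add: \<delta>_def \<delta>'_def)
  qed
  have tail: "eventually (\<lambda>z. (\<lambda>(xs, n). measure_pmf.prob (graph_given \<kappa> n xs) {G. real (num_paths k G) / n \<le> c}) z < \<delta>')
      (sample_filter \<mu>)" if "c < a" for c
    by (rule order_tendstoD(2)[OF paths_lower_tail[OF \<kappa> k a(1) that] \<delta>(2)])
  have tail1: "eventually (\<lambda>z. (\<lambda>(xs, n). measure_pmf.prob (graph_given \<kappa> n xs) {G. real (num_paths k G) / n \<le> a - e0}) z < \<delta>')
      (sample_filter \<mu>)" by (rule tail) (use e0 in simp)
  have tail2: "eventually (\<lambda>z. (\<lambda>(xs, n). measure_pmf.prob (graph_given \<kappa> n xs) {G. real (num_paths k G) / n \<le> a - \<delta>}) z < \<delta>')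
      (sample_filter \<mu>)" by (rule tail) (use \<delta> in simp)
  have "eventually (\<lambda>(xs, n). 1 \<le> n) (sample_filter \<mu>)" by (rule eventually_parameter_ge)
  then show "eventually (\<lambda>(xs, n).
      measure_pmf.prob (graph_given \<kappa> n xs) {G. e0 < \<bar>real (num_paths k G) / n - a\<bar>}
      \<le> 1 / e0 * ((mean_copies (Suc k) k \<kappa> n xs / n - a) + \<epsilon>)) (sample_filter \<mu>)"
    using tail1 tail2
  proof eventually_elim
    case (elim z)
    obtain xs n where z: "z = (xs, n)" by fastforce
    let ?D = "graph_given \<kappa> n xs"
    define X where "X G = real (num_paths k G) / n" for G
    have n: "1 \<le> n" using elim z by simp
    have X0: "0 \<le> X G" for G using n by (simp add: X_def)
    have tails: "measure_pmf.prob ?D {G. X G \<le> a - e0} < \<delta>'" "measure_pmf.prob ?D {G. X G \<le> a - \<delta>} < \<delta>'"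
      using elim z e0 \<delta> by (auto simp: X_def)
    have EX: "measure_pmf.expectation ?D X = mean_copies (Suc k) k \<kappa> n xs / n"
      using mean_num_paths[OF \<kappa>(1) k, of n xs] n by (simp add: X_def[abs_def])
    have "measure_pmf.prob ?D {G. e0 < \<bar>X G - a\<bar>} = measure_pmf.expectation ?D (indicator {G. e0 < \<bar>X G - a\<bar>})"
      by simp
    also have "\<dots> \<le> measure_pmf.expectation ?D (\<lambda>G. indicator {G. X G \<le> a - e0} G
        + 1 / e0 * (X G + (\<delta> - a) + a * indicator {G. X G \<le> a - \<delta>} G))"
    proof (rule integral_mono)
      fix G
      have nn: "0 \<le> X G + (\<delta> - a) + a * indicator {G. X G \<le> a - \<delta>} G"
        using X0[of G] \<delta>(1) by (auto simp: indicator_def)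
      show "indicator {G. e0 < \<bar>X G - a\<bar>} G \<le> indicator {G. X G \<le> a - e0} G
        + 1 / e0 * (X G + (\<delta> - a) + a * indicator {G. X G \<le> a - \<delta>} G)"
      proof (cases "a + e0 < X G")
        case True
        have "e0 \<le> X G + (\<delta> - a) + a * indicator {G. X G \<le> a - \<delta>} G"
          using True a(2) \<delta>(1) by (auto simp: indicator_def)
        then have "1 \<le> 1 / e0 * (X G + (\<delta> - a) + a * indicator {G. X G \<le> a - \<delta>} G)"
          using e0 by (simp add: pos_le_divide_eq)
        then show ?thesis by (auto simp: indicator_def)
      next
        case False
        then have "e0 < \<bar>X G - a\<bar> \<longrightarrow> X G \<le> a - e0" by (auto simp: abs_if split: if_splits)
        then show ?thesis using mult_nonneg_nonneg[OF _ nn, of "1 / e0"] e0 by (auto simp: indicator_def)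
      qed
    qed simp_all
    also have "\<dots> = measure_pmf.prob ?D {G. X G \<le> a - e0}
        + 1 / e0 * (measure_pmf.expectation ?D X + (\<delta> - a) + a * measure_pmf.prob ?D {G. X G \<le> a - \<delta>})"
      by (subst Bochner_Integration.integral_add, simp, simp) simp
    also have "\<dots> \<le> \<delta>' + 1 / e0 * (measure_pmf.expectation ?D X + (\<delta> - a) + a * \<delta>')"
      using tails a(2) e0 by (intro add_mono mult_left_mono order_refl) auto
    also have "\<dots> = 1 / e0 * ((measure_pmf.expectation ?D X - a) + (\<delta> + (a + e0) * \<delta>'))"
      using e0 by (simp add: field_simps)
    also have "\<dots> = 1 / e0 * ((mean_copies (Suc k) k \<kappa> n xs / n - a) + \<epsilon>)"
      unfolding \<delta>(3) EX by (simp add: \<delta>_def)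
    finally show ?case by (simp add: z X_def)
  qed
qed (use e0 in simp)

text \<open>Replacing all cycles by the good ones costs at most \<open>2 * H\<close> times the mean
  number \<open>mm j - l j\<close> of the others, and the Stein-Chen step costs
  \<open>\<bar>b j - l j\<bar>\<close> plus an error of order \<open>1 / n\<close>. As
  \<open>l j\<close> lies between \<open>b j - \<delta>\<close> and \<open>mm j\<close>, both are
  controlled by the one-sided quantity \<open>mm j - b j\<close>.\<close>

lemma cycles_deviation:
  fixes ks :: "nat \<Rightarrow> nat" and b :: "nat \<Rightarrow> real" and f :: "(nat \<Rightarrow> nat) \<Rightarrow> real"
  assumes \<kappa>: "kernel \<kappa>" "ae_continuous \<mu> \<kappa>"
    and ks: "\<And>j. j < N \<Longrightarrow> 3 \<le> ks j" "inj_on ks {..<N}"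
    and b: "\<And>j. 0 \<le> b j" "\<And>j. j < N \<Longrightarrow> beta \<mu> \<kappa> (ks j) = ennreal (b j)"
    and f: "\<And>w. \<bar>f w\<bar> \<le> H"
  shows "\<exists>C\<ge>0. \<forall>\<epsilon>>0. eventually (\<lambda>(xs, n).
      \<bar>measure_pmf.expectation (graph_given \<kappa> n xs) (\<lambda>G. f (\<lambda>j\<in>{..<N}. num_cycles (ks j) G))
        - integral\<^sup>L (PiM {..<N} (\<lambda>j. measure_pmf (Po (b j)))) f\<bar>
      \<le> C * ((\<Sum>j<N. mean_copies (ks j) (ks j) \<kappa> n xs - b j) + \<epsilon>)) (sample_filter \<mu>)"
proof -
  have H: "0 \<le> H" using f[of undefined] by linarith
  \<comment> \<open>The coefficient of each coordinate is at most the whole sum, so one constant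
    serves all \<open>j\<close>.\<close>
  define C where "C = (\<Sum>j<N. 2 * H + 2 * H * exp (b j))"
  have C: "0 \<le> C" using H by (auto simp: C_def intro!: sum_nonneg)
  show ?thesis
  proof (intro exI[of _ C] conjI allI impI)
    fix \<epsilon> :: real assume e: "0 < \<epsilon>"
    \<comment> \<open>Each of the \<open>N\<close> coordinates costs \<open>3 * \<delta>\<close>;
      the \<open>+ 1\<close> keeps the denominator positive for \<open>N = 0\<close>.\<close>
    define \<delta> where "\<delta> = \<epsilon> / (3 * real N + 1)"
    have \<delta>: "0 < \<delta>" "3 * real N * \<delta> \<le> \<epsilon>" using e by (auto simp: \<delta>_def field_simps)
    let ?l = "\<lambda>B j xs n. \<Sum>S\<in>good_copies (ks j) (ks j) \<kappa> xs B. prod (edge_prob \<kappa> n xs) S"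
    have "\<exists>B. eventually (\<lambda>(xs, n). b j - \<delta> \<le> ?l B j xs n) (sample_filter \<mu>)" if j: "j < N" for j
    proof (cases "b j - \<delta> < 0")
      case True
      have "eventually (\<lambda>(xs, n). 1 \<le> n) (sample_filter \<mu>)" by (rule eventually_parameter_ge)
      then have "eventually (\<lambda>(xs, n). b j - \<delta> \<le> ?l 0 j xs n) (sample_filter \<mu>)"
      proof eventually_elim
        case (elim z)
        obtain xs n where z: "z = (xs, n)" by fastforce
        have n: "0 < n" using elim z by simp
        have "0 \<le> ?l 0 j xs n"
          by (intro sum_nonneg prod_nonneg) (use good_copies_edge_prob[OF \<kappa>(1) n] in blast)
        then show ?case using True z by simp
      qed
      then show ?thesis by blast
    next
      case False
      have "ennreal (b j - \<delta>) < walk_integral \<mu> \<kappa> (ks j) (ks j) / of_nat (2 * ks j)"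
      proof -
        have "ennreal (b j - \<delta>) < ennreal (b j)" using False \<delta>(1) by (intro ennreal_lessI) auto
        also have "ennreal (b j) = walk_integral \<mu> \<kappa> (ks j) (ks j) / of_nat (2 * ks j)"
          using beta_eq_walk_integral[OF \<kappa>(1), of "ks j"] ks(1)[OF j] b(2)[OF j] by simp
        finally show ?thesis .
      qed
      from eventually_good_copies[OF \<kappa> shape_cycle[OF ks(1)[OF j]] this] False obtain B where
        B: "eventually (\<lambda>(xs, n). (b j - \<delta>) * n ^ (ks j - ks j) < ?l B j xs n) (sample_filter \<mu>)" by auto
      have "eventually (\<lambda>(xs, n). b j - \<delta> \<le> ?l B j xs n) (sample_filter \<mu>)"
        using B by eventually_elim auto
      then show ?thesis by blast
    qed
    then have "\<forall>j. \<exists>B. j < N \<longrightarrow> eventually (\<lambda>(xs, n). b j - \<delta> \<le> ?l B j xs n) (sample_filter \<mu>)" by blast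
    from choice[OF this] obtain B where
      B: "\<forall>j. j < N \<longrightarrow> eventually (\<lambda>(xs, n). b j - \<delta> \<le> ?l (B j) j xs n) (sample_filter \<mu>)"
      by (rule exE)
    then have evl: "eventually (\<lambda>z. \<forall>j\<in>{..<N}. (\<lambda>(xs, n). b j - \<delta> \<le> ?l (B j) j xs n) z) (sample_filter \<mu>)"
      by (intro eventually_ball_finite) auto
    \<comment> \<open>One level above all \<open>B j\<close>, so that the edges of all good cycles
      share the probability bound \<open>p = Bm / n\<close>.\<close>
    define Bm where "Bm = real (\<Sum>j<N. B j) + 1"
    have Bm: "real (B j) + 1 \<le> Bm" if "j < N" for j
    proof -
      have "B j \<le> (\<Sum>j<N. B j)" by (rule member_le_sum) (use that in auto)
      then show ?thesis by (simp add: Bm_def del: of_nat_sum)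
    qed
    have Bm1: "1 \<le> Bm" by (simp add: Bm_def del: of_nat_sum)
    define L where "L = measure \<mu> UNIV + 1"
    have L: "0 < L" by (simp add: L_def add_nonneg_pos)
    define c where "c = Bm * L"
    have c: "0 \<le> c" using L Bm1 by (simp add: c_def)
    \<comment> \<open>\<open>K\<close> collects the coefficients of \<open>p\<close> in
      \<open>overlap_sum_cycles\<close>; the threshold for \<open>n\<close> below makes
      \<open>4 * (p * K)\<close> at most \<open>\<delta>\<close>.\<close>
    define K where "K = 2 * (\<Sum>i<N. \<Sum>j<N. c ^ ks i * (real (ks i) + c) ^ ks j) + (\<Sum>i<N. c ^ ks i)"
    have "eventually (\<lambda>(xs, n). max Bm (4 * Bm * K / \<delta>) \<le> n) (sample_filter \<mu>)" by (rule eventually_parameter_ge)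
    then show "eventually (\<lambda>(xs, n).
      \<bar>measure_pmf.expectation (graph_given \<kappa> n xs) (\<lambda>G. f (\<lambda>j\<in>{..<N}. num_cycles (ks j) G))
        - integral\<^sup>L (PiM {..<N} (\<lambda>j. measure_pmf (Po (b j)))) f\<bar>
      \<le> C * ((\<Sum>j<N. mean_copies (ks j) (ks j) \<kappa> n xs - b j) + \<epsilon>)) (sample_filter \<mu>)"
      using evl eventually_length_le
    proof eventually_elim
      case (elim z)
      obtain xs n where z: "z = (xs, n)" by fastforce
      let ?v = "length xs"
      define F where "F j = good_copies (ks j) (ks j) \<kappa> xs (B j)" for j
      define A where "A j = copies (ks j) (ks j) ?v" for j
      define p where "p = Bm / n"
      have n: "Bm \<le> n" "0 < n" "4 * Bm * K / \<delta> \<le> n" and v: "real ?v \<le> L * n"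
        using elim z Bm1 by (auto simp: L_def)
      have p: "0 \<le> p" "p \<le> 1" using n Bm1 by (auto simp: p_def)
      have pv: "p * real ?v \<le> c"
      proof -
        have "p * real ?v \<le> p * (L * n)" using v p by (intro mult_left_mono)
        then show ?thesis using n by (simp add: p_def c_def)
      qed
      interpret independent_edges "pairs_below ?v" "edge_prob \<kappa> n xs"
        by (rule independent_edges_edge_prob[OF \<kappa>(1) n(2)])
      let ?q = "edge_prob \<kappa> n xs"
      have q: "0 \<le> ?q e \<and> ?q e \<le> p" if "j < N" "S \<in> F j" "e \<in> S" for j S e
        unfolding p_def by (rule good_copies_edge_prob[OF \<kappa>(1) n(2) that(2)[unfolded F_def] that(3) Bm[OF that(1)]])
      have FA: "F j \<subseteq> A j" for j unfolding F_def A_def by (rule good_copies_subset)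
      have finA: "finite (A j)" for j by (simp add: A_def)
      have AU: "S \<subseteq> pairs_below ?v \<and> S \<noteq> {} \<and> card S = ks j" if "j < N" "S \<in> A j" for j S
        using that copies_subset[OF shape_cycle[OF ks(1)[OF that(1)]]]
          copies_nonempty[OF shape_cycle[OF ks(1)[OF that(1)]]] unfolding A_def by blast
      have FF: "finite (F j)" for j by (simp add: F_def)
      have FU: "S \<subseteq> pairs_below ?v \<and> S \<noteq> {}" if "j < N" "S \<in> F j" for j S
        using AU[OF that(1)] FA that(2) by blast
      \<comment> \<open>Cycles of different lengths have different numbers of edges.\<close>
      have disj: "F i \<inter> F j = {}" if "i < N" "j < N" "i \<noteq> j" for i j
      proof -
        have "ks i \<noteq> ks j" using ks(2) that by (auto simp: inj_on_def)
        moreover have "card S = ks i" if "S \<in> F i" for S using AU[OF \<open>i < N\<close>, of S] FA that by auto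
        moreover have "card S = ks j" if "S \<in> F j" for S using AU[OF \<open>j < N\<close>, of S] FA that by auto
        ultimately show ?thesis by (metis disjoint_iff)
      qed
      define l where "l j = (\<Sum>S\<in>F j. prod ?q S)" for j
      define mm where "mm j = mean_copies (ks j) (ks j) \<kappa> n xs" for j
      have l_ge: "b j - \<delta> \<le> l j" if "j < N" for j using elim z that by (simp add: l_def F_def)
      have mm_eq: "mm j = expect (\<lambda>E. real (copies_in (A j) E))" if "j < N" for j
        unfolding mm_def mean_copies_def A_def[symmetric]
        by (rule expect_copies_in[symmetric]) (use AU[OF that] finA in auto)
      have l_eq: "l j = expect (\<lambda>E. real (copies_in (F j) E))" if "j < N" for j
        unfolding l_def by (rule expect_copies_in[symmetric]) (use FU[OF that] FF in auto)
      have cle: "copies_in (F j) E \<le> copies_in (A j) E" for j E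
        by (rule copies_in_mono[OF FA finA])
      have lm: "l j \<le> mm j" if "j < N" for j
        unfolding l_eq[OF that] mm_eq[OF that] by (rule integral_mono) (use cle finite_U in auto)
      define err where "err = 4 * (overlap_sum ?q (\<Union>j<N. F j) + (\<Sum>S\<in>(\<Union>j<N. F j). (prod ?q S)\<^sup>2))"
      have err: "err \<le> \<delta>"
      proof -
        have FA': "\<And>j. j < N \<Longrightarrow> F j \<subseteq> copies (ks j) (ks j) ?v" using FA by (simp add: A_def)
        have "overlap_sum ?q (\<Union>j<N. F j) \<le> p * (2 * (\<Sum>i<N. \<Sum>j<N. c ^ ks i * (real (ks i) + c) ^ ks j))"
          "(\<Sum>S\<in>(\<Union>j<N. F j). (prod ?q S)\<^sup>2) \<le> p * (\<Sum>i<N. c ^ ks i)"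
          by (rule overlap_sum_cycles(1)[OF p pv ks(1) FA' q]; assumption)
            (rule overlap_sum_cycles(2)[OF p pv ks(1) FA' q]; assumption)
        then have "err \<le> 4 * (p * K)" by (simp add: err_def K_def distrib_left)
        also have "\<dots> \<le> \<delta>" using n(2,3) \<delta>(1) by (simp add: p_def field_simps)
        finally show ?thesis .
      qed
      have 1: "\<bar>expect (\<lambda>E. f (\<lambda>j\<in>{..<N}. copies_in (A j) E)) - expect (\<lambda>E. f (\<lambda>j\<in>{..<N}. copies_in (F j) E))\<bar>
          \<le> (\<Sum>j<N. 2 * H * (mm j - l j))"
      proof -
        have "\<bar>expect (\<lambda>E. f (\<lambda>j\<in>{..<N}. copies_in (A j) E)) - expect (\<lambda>E. f (\<lambda>j\<in>{..<N}. copies_in (F j) E))\<bar>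
            = \<bar>expect (\<lambda>E. f (\<lambda>j\<in>{..<N}. copies_in (A j) E) - f (\<lambda>j\<in>{..<N}. copies_in (F j) E))\<bar>"
          by (subst Bochner_Integration.integral_diff) (use finite_U in simp_all)
        also have "\<dots> \<le> expect (\<lambda>E. \<bar>f (\<lambda>j\<in>{..<N}. copies_in (A j) E) - f (\<lambda>j\<in>{..<N}. copies_in (F j) E)\<bar>)"
          using integral_norm_bound[of "random_subset (pairs_below ?v) ?q"
            "\<lambda>E. f (\<lambda>j\<in>{..<N}. copies_in (A j) E) - f (\<lambda>j\<in>{..<N}. copies_in (F j) E)"] by simp
        also have "\<dots> \<le> expect (\<lambda>E. \<Sum>j<N. 2 * H * (real (copies_in (A j) E) - real (copies_in (F j) E)))"
        proof (rule integral_mono)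
          fix E
          have nn: "0 \<le> 2 * H * (real (copies_in (A j) E) - real (copies_in (F j) E))" for j
            using H cle[of j E] by simp
          show "\<bar>f (\<lambda>j\<in>{..<N}. copies_in (A j) E) - f (\<lambda>j\<in>{..<N}. copies_in (F j) E)\<bar>
            \<le> (\<Sum>j<N. 2 * H * (real (copies_in (A j) E) - real (copies_in (F j) E)))"
          proof (cases "\<forall>j<N. copies_in (A j) E = copies_in (F j) E")
            case True
            then have "(\<lambda>j\<in>{..<N}. copies_in (A j) E) = (\<lambda>j\<in>{..<N}. copies_in (F j) E)"
              by (auto simp: restrict_def)
            then show ?thesis using nn by (simp add: sum_nonneg)
          next
            case False
            \<comment> \<open>Some cycle that is not good is present, so the counts differ by at
              least 1 and the trivial bound \<open>2 * H\<close> is covered.\<close>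
            then obtain j where j: "j < N" "copies_in (A j) E \<noteq> copies_in (F j) E" by blast
            then have "1 \<le> real (copies_in (A j) E) - real (copies_in (F j) E)" using cle[of j E] by linarith
            then have "2 * H * 1 \<le> 2 * H * (real (copies_in (A j) E) - real (copies_in (F j) E))"
              using H by (intro mult_left_mono) auto
            also have "\<dots> \<le> (\<Sum>j<N. 2 * H * (real (copies_in (A j) E) - real (copies_in (F j) E)))"
              by (rule member_le_sum) (use nn j in auto)
            finally show ?thesis
              using f[of "\<lambda>j\<in>{..<N}. copies_in (A j) E"] f[of "\<lambda>j\<in>{..<N}. copies_in (F j) E"] by linarith
          qed
        qed (use finite_U in simp_all)
        also have "\<dots> = (\<Sum>j<N. 2 * H * (mm j - l j))"
          using finite_U by (simp add: Bochner_Integration.integral_sum mm_eq l_eq)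
        finally show ?thesis .
      qed
      have 2: "\<bar>expect (\<lambda>E. f (\<lambda>j\<in>{..<N}. copies_in (F j) E))
          - integral\<^sup>L (PiM {..<N} (\<lambda>j. measure_pmf (Po (b j)))) f\<bar>
        \<le> (\<Sum>j<N. 2 * H * exp (b j) * (\<bar>b j - l j\<bar> + err))"
        unfolding l_def err_def by (rule stein_chen_joint[OF FF FU disj b(1) f order_refl]; assumption)
      have "measure_pmf.expectation (graph_given \<kappa> n xs) (\<lambda>G. f (\<lambda>j\<in>{..<N}. num_cycles (ks j) G))
          = expect (\<lambda>E. f (\<lambda>j\<in>{..<N}. copies_in (A j) E))"
      proof (rule expectation_graph_given_copies)
        fix E assume E: "E \<subseteq> pairs_below ?v"
        have "(\<lambda>j\<in>{..<N}. num_cycles (ks j) (to_graph ?v E)) = (\<lambda>j\<in>{..<N}. copies_in (A j) E)"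
          using num_cycles_eq[OF ks(1) E] by (auto simp: restrict_def A_def copies_in_def)
        then show "f (\<lambda>j\<in>{..<N}. num_cycles (ks j) (to_graph ?v E)) = f (\<lambda>j\<in>{..<N}. copies_in (A j) E)"
          by simp
      qed
      then have "\<bar>measure_pmf.expectation (graph_given \<kappa> n xs) (\<lambda>G. f (\<lambda>j\<in>{..<N}. num_cycles (ks j) G))
          - integral\<^sup>L (PiM {..<N} (\<lambda>j. measure_pmf (Po (b j)))) f\<bar>
        \<le> (\<Sum>j<N. 2 * H * (mm j - l j)) + (\<Sum>j<N. 2 * H * exp (b j) * (\<bar>b j - l j\<bar> + err))"
        using 1 2 by linarith
      also have "\<dots> = (\<Sum>j<N. 2 * H * (mm j - l j) + 2 * H * exp (b j) * (\<bar>b j - l j\<bar> + err))"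
        by (simp add: sum.distrib)
      also have "\<dots> \<le> (\<Sum>j<N. C * ((mm j - b j) + 3 * \<delta>))"
      proof (rule sum_mono)
        fix j assume "j \<in> {..<N}"
        then have j: "j < N" by simp
        \<comment> \<open>The shift by \<open>3 * \<delta>\<close> pays for a shortfall of
          \<open>l j\<close> below \<open>b j\<close>, for a possibly negative excess, and for
          \<open>err\<close>.\<close>
        have 3: "mm j - l j \<le> (mm j - b j) + 3 * \<delta>" "\<bar>b j - l j\<bar> + err \<le> (mm j - b j) + 3 * \<delta>"
          "0 \<le> (mm j - b j) + 3 * \<delta>"
          using l_ge[OF j] lm[OF j] err \<delta>(1) by linarith+
        have "2 * H * (mm j - l j) + 2 * H * exp (b j) * (\<bar>b j - l j\<bar> + err)
            \<le> 2 * H * ((mm j - b j) + 3 * \<delta>) + 2 * H * exp (b j) * ((mm j - b j) + 3 * \<delta>)"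
          by (rule add_mono[OF mult_left_mono[OF 3(1)] mult_left_mono[OF 3(2)]]) (use H in simp_all)
        also have "\<dots> = (2 * H + 2 * H * exp (b j)) * ((mm j - b j) + 3 * \<delta>)" by (simp add: algebra_simps)
        also have "\<dots> \<le> C * ((mm j - b j) + 3 * \<delta>)"
        proof (rule mult_right_mono)
          show "2 * H + 2 * H * exp (b j) \<le> C"
            unfolding C_def by (rule member_le_sum[of j]) (use j H in auto)
        qed (rule 3)
        finally show "2 * H * (mm j - l j) + 2 * H * exp (b j) * (\<bar>b j - l j\<bar> + err) \<le> C * ((mm j - b j) + 3 * \<delta>)" .
      qed
      also have "\<dots> = C * ((\<Sum>j<N. mm j - b j) + 3 * real N * \<delta>)"
        by (simp add: sum_distrib_left[symmetric] sum.distrib)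
      also have "\<dots> \<le> C * ((\<Sum>j<N. mm j - b j) + \<epsilon>)"
        using C \<delta>(2) by (intro mult_left_mono) auto
      finally show ?case by (simp add: z mm_def)
    qed
  qed (rule C)
qed

end

section \<open>From samples to the random graph\<close>

lemma eventually_at_top_in:
  "eventually P (at_top_in I) \<longleftrightarrow> (\<exists>N. \<forall>n\<in>I. N \<le> n \<longrightarrow> P n)"
  by (auto simp: at_top_in_def eventually_inf_principal eventually_at_top_linorder)

text \<open>Conditioning on one edge at a time shows that the expectation is a polynomial in the
  edge probabilities.\<close>

lemma measurable_expectation_random_subset:
  fixes q :: "'m \<Rightarrow> 'e \<Rightarrow> real" and f :: "'e set \<Rightarrow> real"
  assumes "finite U" "\<And>e. e \<in> U \<Longrightarrow> (\<lambda>y. q y e) \<in> borel_measurable N"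
    "\<And>y e. e \<in> U \<Longrightarrow> 0 \<le> q y e \<and> q y e \<le> 1"
  shows "(\<lambda>y. measure_pmf.expectation (random_subset U (q y)) f) \<in> borel_measurable N"
  using assms
proof (induction U arbitrary: f)
  case empty
  have "random_subset {} (q y) = return_pmf {}" for y
    by (simp add: random_subset_def)
  then show ?case by simp
next
  case (insert e U)
  have "measure_pmf.expectation (random_subset (insert e U) (q y)) f
    = q y e * measure_pmf.expectation (random_subset U (q y)) (\<lambda>E. f (insert e E))
      + (1 - q y e) * measure_pmf.expectation (random_subset U (q y)) f" for y
    using insert by (intro expectation_random_subset_insert) auto
  then show ?case using insert by simp
qed

section \<open>Measurability and conditioning on the points\<close>

context generalized_vertex_space
begin

lemma index_gt_0: "n \<in> I \<Longrightarrow> 0 < n"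
  using index_pos by auto

lemma at_top_in_neq_bot: "at_top_in I \<noteq> bot"
proof
  assume "at_top_in I = bot"
  then have "eventually (\<lambda>_. False) (at_top_in I)" by simp
  then obtain N where "\<forall>n\<in>I. \<not> N \<le> n" by (auto simp: eventually_at_top_in)
  then have "bdd_above I" by (intro bdd_aboveI[of _ N]) (auto simp: not_le less_imp_le)
  then show False using index_unbounded by simp
qed

lemma eventually_index: "eventually (\<lambda>n. n \<in> I) (at_top_in I)"
  by (auto simp: eventually_at_top_in)

text \<open>An entry of the list is a random variable only where the list is long enough. The space
  is therefore split into the countably many events of constant length, and on each of them the list
  is a random element of a finite product.\<close>

lemma measurable_sample:
  assumes n: "n \<in> I"
    and g: "\<And>v. g v \<in> measurable (PiM {..<v} (\<lambda>_. \<mu>)) N"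
    and G: "\<And>xs. G xs = g (length xs) (\<lambda>i\<in>{..<length xs}. xs ! i)"
  shows "(\<lambda>\<omega>. G (x n \<omega>)) \<in> measurable (M n) N"
proof (rule measurable_piecewise_restrict)
  let ?C = "range (\<lambda>v. {\<omega> \<in> space (M n). length (x n \<omega>) = v})"
  have rs: "(\<lambda>\<omega>. length (x n \<omega>)) \<in> measurable (M n) (count_space UNIV)"
    "\<And>i. (\<lambda>\<omega>. x n \<omega> ! i) \<in> measurable (restrict_space (M n) {\<omega> \<in> space (M n). i < length (x n \<omega>)}) borel"
    using random_sequence_x[OF n] by (auto simp: random_sequence_def)
  show "countable ?C" by simp
  show "space (M n) \<subseteq> \<Union>?C" by auto
  fix \<Omega> assume "\<Omega> \<in> ?C"
  then obtain v where v: "\<Omega> = {\<omega> \<in> space (M n). length (x n \<omega>) = v}" by auto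
  have "\<Omega> = (\<lambda>\<omega>. length (x n \<omega>)) -` {v} \<inter> space (M n)" by (auto simp: v)
  then have "\<Omega> \<in> sets (M n)" using measurable_sets[OF rs(1), of "{v}"] by simp
  then show "\<Omega> \<inter> space (M n) \<in> sets (M n)" by simp
  have "(\<lambda>\<omega>. \<lambda>i\<in>{..<v}. x n \<omega> ! i) \<in> measurable (restrict_space (M n) \<Omega>) (PiM {..<v} (\<lambda>_. \<mu>))"
  proof (rule measurable_restrict)
    fix i assume "i \<in> {..<v}"
    then have "\<Omega> \<subseteq> {\<omega> \<in> space (M n). i < length (x n \<omega>)}" by (auto simp: v)
    from measurable_restrict_mono[OF rs(2) this]
    show "(\<lambda>\<omega>. x n \<omega> ! i) \<in> measurable (restrict_space (M n) \<Omega>) \<mu>"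
      using measurable_cong_sets[OF refl sets_mu] by blast
  qed
  from measurable_compose[OF this g]
  have "(\<lambda>\<omega>. g v (\<lambda>i\<in>{..<v}. x n \<omega> ! i)) \<in> measurable (restrict_space (M n) \<Omega>) N" .
  moreover have "G (x n \<omega>) = g v (\<lambda>i\<in>{..<v}. x n \<omega> ! i)" if "\<omega> \<in> space (restrict_space (M n) \<Omega>)" for \<omega>
    using that by (simp add: G space_restrict_space v)
  ultimately show "(\<lambda>\<omega>. G (x n \<omega>)) \<in> measurable (restrict_space (M n) \<Omega>) N"
    by (subst measurable_cong) auto
qed

lemma measurable_hits:
  assumes "n \<in> I" "A \<in> sets borel"
  shows "(\<lambda>\<omega>. real (hits A (x n \<omega>))) \<in> borel_measurable (M n)"
proof (rule measurable_sample[OF assms(1), of "\<lambda>v y. \<Sum>i<v. indicator A (y i)"])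
  fix v
  show "(\<lambda>y. \<Sum>i<v. indicator A (y i) :: real) \<in> borel_measurable (PiM {..<v} (\<lambda>_. \<mu>))"
  proof (rule borel_measurable_sum)
    fix i assume "i \<in> {..<v}"
    then show "(\<lambda>y. indicator A (y i) :: real) \<in> borel_measurable (PiM {..<v} (\<lambda>_. \<mu>))"
      using assms(2) sets_mu
      by (intro measurable_compose[OF measurable_component_singleton borel_measurable_indicator]) auto
  qed
qed (simp add: hits_sum)

lemma measurable_edge_prob:
  assumes \<kappa>: "kernel \<kappa>" and e: "e \<in> pairs_below v"
  shows "(\<lambda>y. (\<lambda>(i, j). min (\<kappa> (y i) (y j) / n) 1) e) \<in> borel_measurable (PiM {..<v} (\<lambda>_. \<mu>))"
proof -
  obtain i j where ij: "e = (i, j)" "i \<in> {..<v}" "j \<in> {..<v}" using e by (auto simp: pairs_below_def)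
  show ?thesis unfolding ij(1) prod.case
    using measurable_kernel[OF \<kappa> ij(2,3)]
    by (intro borel_measurable_min borel_measurable_divide borel_measurable_const)
qed

lemma edge_prob_restrict:
  "e \<in> pairs_below (length xs) \<Longrightarrow> edge_prob \<kappa> n xs e
    = (\<lambda>(i, j). min (\<kappa> ((\<lambda>i\<in>{..<length xs}. xs ! i) i) ((\<lambda>i\<in>{..<length xs}. xs ! i) j) / n) 1) e"
  by (auto simp: edge_prob_def pairs_below_def)

lemma measurable_mean_copies:
  assumes "n \<in> I" "kernel \<kappa>" "shape r k \<sigma>"
  shows "(\<lambda>\<omega>. mean_copies r k \<kappa> m (x n \<omega>)) \<in> borel_measurable (M n)"
proof (rule measurable_sample[OF assms(1), of
    "\<lambda>v y. \<Sum>S\<in>copies r k v. \<Prod>e\<in>S. (\<lambda>(i, j). min (\<kappa> (y i) (y j) / m) 1) e"])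
  show "(\<lambda>y. \<Sum>S\<in>copies r k v. \<Prod>e\<in>S. (\<lambda>(i, j). min (\<kappa> (y i) (y j) / m) 1) e)
      \<in> borel_measurable (PiM {..<v} (\<lambda>_. \<mu>))" for v
    using copies_subset[OF assms(3)]
    by (intro borel_measurable_sum borel_measurable_prod measurable_edge_prob[OF assms(2)]) blast
  show "mean_copies r k \<kappa> m xs = (\<Sum>S\<in>copies r k (length xs). \<Prod>e\<in>S.
      (\<lambda>(i, j). min (\<kappa> ((\<lambda>i\<in>{..<length xs}. xs ! i) i) ((\<lambda>i\<in>{..<length xs}. xs ! i) j) / m) 1) e)" for xs
    unfolding mean_copies_def
  proof (intro sum.cong prod.cong refl edge_prob_restrict)
    fix S e assume "S \<in> copies r k (length xs)" "e \<in> S"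
    then show "e \<in> pairs_below (length xs)" using copies_subset[OF assms(3)] by blast
  qed
qed

lemma random_subset_cong:
  assumes "finite U" "\<And>e. e \<in> U \<Longrightarrow> q e = q' e"
  shows "random_subset U q = random_subset U q'"
  unfolding random_subset_def
  by (intro map_pmf_cong Pi_pmf_cong refl) (use assms in auto)

lemma measurable_expectation_graph_given:
  fixes f :: "graph \<Rightarrow> real"
  assumes n: "n \<in> I" and \<kappa>: "kernel \<kappa>"
  shows "(\<lambda>\<omega>. measure_pmf.expectation (graph_given \<kappa> n (x n \<omega>)) f) \<in> borel_measurable (M n)"
proof (rule measurable_sample[OF n, of "\<lambda>v y. measure_pmf.expectation
    (random_subset (pairs_below v) (\<lambda>(i, j). min (\<kappa> (y i) (y j) / n) 1)) (\<lambda>E. f (to_graph v E))"])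
  show "(\<lambda>y. measure_pmf.expectation (random_subset (pairs_below v) (\<lambda>(i, j). min (\<kappa> (y i) (y j) / n) 1))
      (\<lambda>E. f (to_graph v E))) \<in> borel_measurable (PiM {..<v} (\<lambda>_. \<mu>))" for v
    by (rule measurable_expectation_random_subset[OF finite_pairs_below measurable_edge_prob[OF \<kappa>]])
      (use \<kappa> index_gt_0[OF n] in \<open>auto simp: kernel_def\<close>)
  show "measure_pmf.expectation (graph_given \<kappa> n xs) f = measure_pmf.expectation
    (random_subset (pairs_below (length xs))
      (\<lambda>(i, j). min (\<kappa> ((\<lambda>i\<in>{..<length xs}. xs ! i) i) ((\<lambda>i\<in>{..<length xs}. xs ! i) j) / n) 1))
    (\<lambda>E. f (to_graph (length xs) E))" for xs
    unfolding expectation_graph_given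
    by (intro arg_cong2[where f = "\<lambda>D f. measure_pmf.expectation D f"] refl random_subset_cong
        finite_pairs_below edge_prob_restrict)
qed

text \<open>Makes the bind in \<open>random_graph\<close> a genuine mixture, so that integrals may
  be computed conditionally on the points.\<close>

lemma measurable_graph_given:
  assumes n: "n \<in> I" and \<kappa>: "kernel \<kappa>"
  shows "(\<lambda>\<omega>. measure_pmf (graph_given \<kappa> n (x n \<omega>))) \<in> measurable (M n) (subprob_algebra (count_space UNIV))"
proof (rule measurable_subprob_algebra)
  fix A :: "graph set"
  have "emeasure (measure_pmf (graph_given \<kappa> n (x n \<omega>))) A
      = ennreal (measure_pmf.expectation (graph_given \<kappa> n (x n \<omega>)) (indicator A))" for \<omega>
    by (simp add: measure_pmf.emeasure_eq_measure)
  then show "(\<lambda>\<omega>. emeasure (measure_pmf (graph_given \<kappa> n (x n \<omega>))) A) \<in> borel_measurable (M n)"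
    using measurable_expectation_graph_given[OF n \<kappa>, of "indicator A"] by simp
qed (simp_all add: measure_pmf.subprob_space_axioms)

lemma space_M_nonempty: "n \<in> I \<Longrightarrow> space (M n) \<noteq> {}"
  using prob_space_M prob_space.not_empty by blast

lemma space_random_graph: "n \<in> I \<Longrightarrow> space (random_graph M x \<kappa> n) = UNIV"
  unfolding random_graph_def using space_M_nonempty[of n]
  by (subst space_bind[where N = "count_space UNIV"]) auto

lemma nn_integral_random_graph:
  assumes "n \<in> I" "kernel \<kappa>"
  shows "(\<integral>\<^sup>+ G. f G \<partial>random_graph M x \<kappa> n) = (\<integral>\<^sup>+ \<omega>. (\<integral>\<^sup>+ G. f G \<partial>graph_given \<kappa> n (x n \<omega>)) \<partial>M n)"
  unfolding random_graph_def
  by (rule nn_integral_bind[OF _ measurable_graph_given[OF assms]]) simp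

lemma integral_random_graph:
  fixes f :: "graph \<Rightarrow> real"
  assumes n: "n \<in> I" "kernel \<kappa>" and f: "\<And>G. \<bar>f G\<bar> \<le> H"
  shows "(\<integral>G. f G \<partial>random_graph M x \<kappa> n)
    = (\<integral>\<omega>. measure_pmf.expectation (graph_given \<kappa> n (x n \<omega>)) f \<partial>M n)"
proof -
  interpret prob_space "M n" by (rule prob_space_M[OF n(1)])
  show ?thesis unfolding random_graph_def
    by (rule integral_bind[where K = "count_space UNIV" and B = H and B' = 1, OF _ _ measurable_graph_given[OF n]])
      (use f in \<open>auto simp: finite_measure_axioms measure_pmf.emeasure_space_1[simplified]\<close>)
qed

lemma measure_random_graph:
  assumes n: "n \<in> I" "kernel \<kappa>"
  shows "measure (random_graph M x \<kappa> n) A = (\<integral>\<omega>. measure_pmf.prob (graph_given \<kappa> n (x n \<omega>)) A \<partial>M n)"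
proof -
  have "measure (random_graph M x \<kappa> n) A = (\<integral>G. indicator A G \<partial>random_graph M x \<kappa> n)"
    using space_random_graph[OF n(1)] by simp
  also have "\<dots> = (\<integral>\<omega>. measure_pmf.expectation (graph_given \<kappa> n (x n \<omega>)) (indicator A) \<partial>M n)"
    by (rule integral_random_graph[OF n, of _ 1]) (simp add: indicator_def)
  finally show ?thesis by simp
qed

lemma mean_count_random_graph:
  assumes n: "n \<in> I" "kernel \<kappa>"
    and mean: "\<And>xs. measure_pmf.expectation (graph_given \<kappa> n xs) (\<lambda>G. real (X G)) = m xs"
  shows "mean_count (random_graph M x \<kappa> n) X = (\<integral>\<^sup>+ \<omega>. ennreal (m (x n \<omega>)) \<partial>M n)"
proof -
  have "(\<integral>\<^sup>+ G. of_nat (X G) \<partial>graph_given \<kappa> n xs) = ennreal (m xs)" for xs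
    unfolding mean[symmetric] ennreal_of_nat_eq_real_of_nat
    by (rule nn_integral_eq_integral) auto
  then show ?thesis unfolding mean_count_def nn_integral_random_graph[OF n] by simp
qed

lemma mean_count_num_paths:
  assumes "n \<in> I" "kernel \<kappa>" "1 \<le> k"
  shows "mean_count (random_graph M x \<kappa> n) (num_paths k) / ennreal n
    = (\<integral>\<^sup>+ \<omega>. ennreal (mean_copies (Suc k) k \<kappa> n (x n \<omega>) / n) \<partial>M n)"
proof -
  have "mean_count (random_graph M x \<kappa> n) (num_paths k) = (\<integral>\<^sup>+ \<omega>. ennreal (mean_copies (Suc k) k \<kappa> n (x n \<omega>)) \<partial>M n)"
    by (rule mean_count_random_graph[OF assms(1,2) mean_num_paths[OF assms(2,3) index_gt_0[OF assms(1)]]])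
  also have "\<dots> / ennreal n = (\<integral>\<^sup>+ \<omega>. ennreal (mean_copies (Suc k) k \<kappa> n (x n \<omega>)) / ennreal n \<partial>M n)"
    by (rule nn_integral_divide[symmetric])
      (use measurable_mean_copies[OF assms(1,2) shape_path[OF assms(3)]] in simp)
  also have "\<dots> = (\<integral>\<^sup>+ \<omega>. ennreal (mean_copies (Suc k) k \<kappa> n (x n \<omega>) / n) \<partial>M n)"
  proof (rule nn_integral_cong, rule divide_ennreal)
    fix \<omega>
    show "0 \<le> mean_copies (Suc k) k \<kappa> n (x n \<omega>)"
      using assms(2) index_gt_0[OF assms(1)] unfolding mean_copies_def
      by (intro sum_nonneg prod_nonneg) (auto simp: edge_prob_def kernel_def)
  qed (rule index_gt_0[OF assms(1)])
  finally show ?thesis .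
qed

lemma mean_count_num_cycles:
  assumes "n \<in> I" "kernel \<kappa>" "3 \<le> k"
  shows "mean_count (random_graph M x \<kappa> n) (num_cycles k)
    = (\<integral>\<^sup>+ \<omega>. ennreal (mean_copies k k \<kappa> n (x n \<omega>)) \<partial>M n)"
  by (rule mean_count_random_graph[OF assms(1,2) mean_num_cycles[OF assms(2,3) index_gt_0[OF assms(1)]]])

lemma mean_copies_nonneg:
  assumes "kernel \<kappa>" "0 < n"
  shows "0 \<le> mean_copies r k \<kappa> n xs"
  unfolding mean_copies_def
  by (intro sum_nonneg prod_nonneg) (use assms in \<open>auto simp: edge_prob_def kernel_def\<close>)

text \<open>The bridge from deterministic limits to probability: the finitely many continuity sets
  behind an eventual property are handled by a union bound.\<close>

lemma with_high_probability:
  assumes "eventually P (sample_filter \<mu>)"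
  shows "\<exists>E. (\<forall>n\<in>I. E n \<in> sets (M n) \<and> (\<forall>\<omega>\<in>E n. P (x n \<omega>, n))) \<and>
    ((\<lambda>n. measure (M n) (E n)) \<longlongrightarrow> 1) (at_top_in I)"
proof -
  obtain \<A> d N where \<A>: "finite \<A>" "\<And>A. A \<in> \<A> \<Longrightarrow> continuity_set \<mu> A" "\<And>A. A \<in> \<A> \<Longrightarrow> 0 < d A"
    "\<And>xs n. N \<le> n \<Longrightarrow> (\<And>A. A \<in> \<A> \<Longrightarrow> \<bar>real (hits A xs) / n - measure \<mu> A\<bar> \<le> d A) \<Longrightarrow> P (xs, n)"
    by (rule eventually_sample_filterD[OF assms]) blast
  define bad where "bad n A = {\<omega> \<in> space (M n). d A < \<bar>real (hits A (x n \<omega>)) / n - measure \<mu> A\<bar>}" for n A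
  \<comment> \<open>Below \<open>N\<close> the event is empty, so that membership implies
    \<open>P\<close> for every index, not only for large ones.\<close>
  define E where "E n = (if N \<le> n then space (M n) - (\<Union>A\<in>\<A>. bad n A) else {})" for n
  have bad: "bad n A \<in> sets (M n)" if "n \<in> I" "A \<in> \<A>" for n A
  proof -
    have "A \<in> sets borel" using \<A>(2)[OF that(2)] by (simp add: continuity_set_def)
    from measurable_hits[OF that(1) this]
    have "(\<lambda>\<omega>. \<bar>real (hits A (x n \<omega>)) / n - measure \<mu> A\<bar>) \<in> borel_measurable (M n)" by simp
    then show ?thesis unfolding bad_def by (intro borel_measurable_less) auto
  qed
  have E: "E n \<in> sets (M n)" if "n \<in> I" for n
    using bad[OF that] \<A>(1) by (auto simp: E_def intro!: sets.Diff sets.finite_UN)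
  have PE: "P (x n \<omega>, n)" if "\<omega> \<in> E n" for n \<omega>
  proof (rule \<A>(4))
    show "N \<le> n" using that by (auto simp: E_def split: if_splits)
    fix A assume "A \<in> \<A>"
    then show "\<bar>real (hits A (x n \<omega>)) / n - measure \<mu> A\<bar> \<le> d A"
      using that by (auto simp: E_def bad_def not_less split: if_splits)
  qed
  have badlim: "((\<lambda>n. measure (M n) (bad n A)) \<longlongrightarrow> 0) (at_top_in I)" if "A \<in> \<A>" for A
    using empirical_conv[OF \<A>(2)[OF that]] \<A>(3)[OF that]
    unfolding conv_in_prob_def bad_def hits_def by blast
  then have "((\<lambda>n. 1 - (\<Sum>A\<in>\<A>. measure (M n) (bad n A))) \<longlongrightarrow> 1 - (\<Sum>A\<in>\<A>. 0)) (at_top_in I)"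
    by (intro tendsto_intros)
  then have low: "((\<lambda>n. 1 - (\<Sum>A\<in>\<A>. measure (M n) (bad n A))) \<longlongrightarrow> 1) (at_top_in I)" by simp
  have ge: "eventually (\<lambda>n. 1 - (\<Sum>A\<in>\<A>. measure (M n) (bad n A)) \<le> measure (M n) (E n)) (at_top_in I)"
    unfolding eventually_at_top_in
  proof (intro exI[of _ N] ballI impI)
    fix n assume n: "n \<in> I" "N \<le> n"
    interpret pr: prob_space "M n" by (rule prob_space_M[OF n(1)])
    have "pr.prob (\<Union>A\<in>\<A>. bad n A) \<le> (\<Sum>A\<in>\<A>. pr.prob (bad n A))"
      using bad[OF n(1)] \<A>(1) by (intro pr.finite_measure_subadditive_finite) auto
    moreover have "pr.prob (E n) = 1 - pr.prob (\<Union>A\<in>\<A>. bad n A)"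
      using n(2) bad[OF n(1)] \<A>(1) unfolding E_def
      by (simp add: pr.prob_compl sets.finite_UN)
    ultimately show "1 - (\<Sum>A\<in>\<A>. pr.prob (bad n A)) \<le> pr.prob (E n)" by linarith
  qed
  have le: "eventually (\<lambda>n. measure (M n) (E n) \<le> 1) (at_top_in I)"
    using eventually_index by eventually_elim (simp add: prob_space.prob_le_1 prob_space_M)
  have "((\<lambda>n. measure (M n) (E n)) \<longlongrightarrow> 1) (at_top_in I)"
    by (rule tendsto_sandwich[OF ge le low tendsto_const])
  then show ?thesis using E PE by blast
qed

text \<open>As \<open>m\<close> is nonnegative, integrating the constant \<open>c\<close> over an
  event of probability near 1 already gives the bound. Every finite \<open>c\<close> below
  \<open>T\<close> is treated, so \<open>T\<close> may be infinite.\<close>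

lemma Liminf_mean_ge:
  assumes meas: "\<And>n. n \<in> I \<Longrightarrow> (\<lambda>\<omega>. m (x n \<omega>, n)) \<in> borel_measurable (M n)"
    and m0: "\<And>xs n. 0 < n \<Longrightarrow> 0 \<le> m (xs, n)"
    and ev: "\<And>c. 0 \<le> c \<Longrightarrow> ennreal c < T \<Longrightarrow> eventually (\<lambda>z. c \<le> m z) (sample_filter \<mu>)"
  shows "T \<le> Liminf (at_top_in I) (\<lambda>n. \<integral>\<^sup>+ \<omega>. ennreal (m (x n \<omega>, n)) \<partial>M n)"
  unfolding le_Liminf_iff
proof (intro allI impI)
  fix y :: ennreal assume "y < T"
  then obtain y' where y': "y < y'" "y' < T" using dense by blast
  then obtain c where c: "y' = ennreal c" "0 \<le> c"
    by (metis ennreal_cases top.not_eq_extremum not_less_iff_gr_or_eq order_less_trans)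
  obtain E where E: "\<And>n. n \<in> I \<Longrightarrow> E n \<in> sets (M n)" "\<And>n \<omega>. n \<in> I \<Longrightarrow> \<omega> \<in> E n \<Longrightarrow> c \<le> m (x n \<omega>, n)"
    "((\<lambda>n. measure (M n) (E n)) \<longlongrightarrow> 1) (at_top_in I)"
    using with_high_probability[OF ev[OF c(2)]] y'(2) c(1) by blast
  have "((\<lambda>n. ennreal (c * measure (M n) (E n))) \<longlongrightarrow> ennreal (c * 1)) (at_top_in I)"
    by (intro tendsto_intros E(3))
  then have "eventually (\<lambda>n. y < ennreal (c * measure (M n) (E n))) (at_top_in I)"
    using y'(1) c(1) by (intro order_tendstoD(1)) auto
  then show "eventually (\<lambda>n. y < (\<integral>\<^sup>+ \<omega>. ennreal (m (x n \<omega>, n)) \<partial>M n)) (at_top_in I)"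
    using eventually_index
  proof eventually_elim
    case (elim n)
    interpret pr: prob_space "M n" by (rule prob_space_M[OF elim(2)])
    have "ennreal (c * pr.prob (E n)) = (\<integral>\<^sup>+ \<omega>. ennreal c * indicator (E n) \<omega> \<partial>M n)"
      using E(1)[OF elim(2)] c(2) by (simp add: nn_integral_cmult_indicator pr.emeasure_eq_measure ennreal_mult)
    also have "\<dots> \<le> (\<integral>\<^sup>+ \<omega>. ennreal (m (x n \<omega>, n)) \<partial>M n)"
      using E(2)[OF elim(2)] by (intro nn_integral_mono) (auto simp: indicator_def intro: ennreal_leI)
    finally show ?case using elim(1) by simp
  qed
qed

text \<open>The finishing step: a bounded quantity that is eventually controlled by the excess of the
  conditional means over their limits tends to \<open>0\<close> in mean, since the excess does.\<close>

lemma expectation_tendsto_0: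
  fixes u :: "'a list \<times> real \<Rightarrow> real" and m :: "nat \<Rightarrow> 'a list \<times> real \<Rightarrow> real"
  assumes u: "\<And>n. n \<in> I \<Longrightarrow> (\<lambda>\<omega>. u (x n \<omega>, n)) \<in> borel_measurable (M n)" "\<And>z. 0 \<le> u z" "\<And>z. u z \<le> H"
    and m: "\<And>j n. j < N \<Longrightarrow> n \<in> I \<Longrightarrow> (\<lambda>\<omega>. m j (x n \<omega>, n)) \<in> borel_measurable (M n)"
      "\<And>j n xs. j < N \<Longrightarrow> 0 < n \<Longrightarrow> 0 \<le> m j (xs, n)"
    and b: "\<And>j. j < N \<Longrightarrow> 0 \<le> b j"
    and lim: "\<And>j. j < N \<Longrightarrow> ((\<lambda>n. \<integral>\<^sup>+ \<omega>. ennreal (m j (x n \<omega>, n)) \<partial>M n) \<longlongrightarrow> ennreal (b j)) (at_top_in I)"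
    and bound: "\<exists>C\<ge>0. \<forall>\<epsilon>>0. eventually (\<lambda>z. u z \<le> C * ((\<Sum>j<N. m j z - b j) + \<epsilon>)) (sample_filter \<mu>)"
  shows "((\<lambda>n. \<integral>\<omega>. u (x n \<omega>, n) \<partial>M n) \<longlongrightarrow> 0) (at_top_in I)"
proof -
  obtain C where C: "0 \<le> C" "\<And>\<epsilon>. 0 < \<epsilon> \<Longrightarrow> eventually (\<lambda>z. u z \<le> C * ((\<Sum>j<N. m j z - b j) + \<epsilon>)) (sample_filter \<mu>)"
    using bound by blast
  have H: "0 \<le> H" using u(2,3)[of undefined] by linarith
  have fin: "eventually (\<lambda>n. \<forall>j\<in>{..<N}. (\<integral>\<^sup>+ \<omega>. ennreal (m j (x n \<omega>, n)) \<partial>M n) < \<infinity>) (at_top_in I)"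
    by (rule eventually_ball_finite) (use order_tendstoD(2)[OF lim] in auto)
  have limr: "((\<lambda>n. enn2real (\<integral>\<^sup>+ \<omega>. ennreal (m j (x n \<omega>, n)) \<partial>M n)) \<longlongrightarrow> b j) (at_top_in I)" if "j < N" for j
    by (rule tendsto_enn2real[OF lim[OF that] b[OF that]])
  show ?thesis
  proof (rule order_tendstoI)
    fix e :: real assume "e < 0"
    moreover have "0 \<le> (\<integral>\<omega>. u (x n \<omega>, n) \<partial>M n)" for n by (rule integral_nonneg_AE) (simp add: u)
    ultimately show "eventually (\<lambda>n. e < (\<integral>\<omega>. u (x n \<omega>, n) \<partial>M n)) (at_top_in I)"
      by (intro always_eventually allI) (meson less_le_trans)
  next
    fix e :: real assume e: "0 < e"
    define \<epsilon> where "\<epsilon> = e / (C + 1)"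
    have \<epsilon>: "0 < \<epsilon>" "C * \<epsilon> < e" using e C(1) by (auto simp: \<epsilon>_def field_simps)
    obtain E where E: "\<And>n. n \<in> I \<Longrightarrow> E n \<in> sets (M n)"
      "\<And>n \<omega>. n \<in> I \<Longrightarrow> \<omega> \<in> E n \<Longrightarrow> u (x n \<omega>, n) \<le> C * ((\<Sum>j<N. m j (x n \<omega>, n) - b j) + \<epsilon>)"
      "((\<lambda>n. measure (M n) (E n)) \<longlongrightarrow> 1) (at_top_in I)"
      using with_high_probability[OF C(2)[OF \<epsilon>(1)]] by blast
    \<comment> \<open>On \<open>E n\<close> the controlled bound applies, off it the bound
      \<open>H\<close>. The limits \<open>b j\<close> are subtracted only on \<open>E n\<close>,
      while the \<open>m j\<close> are integrated over the whole space, which is harmless because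
      they are nonnegative.\<close>
    define R where "R n = C * ((\<Sum>j<N. enn2real (\<integral>\<^sup>+ \<omega>. ennreal (m j (x n \<omega>, n)) \<partial>M n)
        - b j * measure (M n) (E n)) + \<epsilon>) + H * (1 - measure (M n) (E n))" for n
    have "(R \<longlongrightarrow> C * ((\<Sum>j<N. b j - b j * 1) + \<epsilon>) + H * (1 - 1)) (at_top_in I)"
      unfolding R_def by (intro tendsto_intros E(3) limr) auto
    then have "eventually (\<lambda>n. R n < e) (at_top_in I)"
      by (rule order_tendstoD(2)) (use \<epsilon> in simp)
    then show "eventually (\<lambda>n. (\<integral>\<omega>. u (x n \<omega>, n) \<partial>M n) < e) (at_top_in I)"
      using eventually_index fin
    proof eventually_elim
      case (elim n)
      interpret pr: prob_space "M n" by (rule prob_space_M[OF elim(2)])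
      have n0: "0 < n" by (rule index_gt_0[OF elim(2)])
      have mi: "integrable (M n) (\<lambda>\<omega>. m j (x n \<omega>, n))"
        "(\<integral>\<omega>. m j (x n \<omega>, n) \<partial>M n) = enn2real (\<integral>\<^sup>+ \<omega>. ennreal (m j (x n \<omega>, n)) \<partial>M n)" if "j < N" for j
        using m(1)[OF that elim(2)] m(2)[OF that n0] elim(3) that
        by (auto intro!: integrableI_nonneg integral_eq_nn_integral)
      have Ei: "integrable (M n) (indicator (E n) :: _ \<Rightarrow> real)" "E n \<subseteq> space (M n)"
        using E(1)[OF elim(2)] sets.sets_into_space by (auto simp: pr.emeasure_eq_measure)
      let ?rhs = "\<lambda>\<omega>. C * ((\<Sum>j<N. m j (x n \<omega>, n) - b j * indicator (E n) \<omega>) + \<epsilon>) + H * (1 - indicator (E n) \<omega>)"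
      have ui: "integrable (M n) (\<lambda>\<omega>. u (x n \<omega>, n))"
        by (rule pr.integrable_const_bound[where B = H]) (use u elim(2) in auto)
      have "(\<integral>\<omega>. u (x n \<omega>, n) \<partial>M n) \<le> (\<integral>\<omega>. ?rhs \<omega> \<partial>M n)"
      proof (rule integral_mono[OF ui])
        show "integrable (M n) ?rhs"
          by (intro Bochner_Integration.integrable_add Bochner_Integration.integrable_diff
              Bochner_Integration.integrable_sum integrable_mult_right mi(1) Ei(1) pr.integrable_const) simp
        fix \<omega>
        show "u (x n \<omega>, n) \<le> ?rhs \<omega>"
        proof (cases "\<omega> \<in> E n")
          case False
          have "0 \<le> C * ((\<Sum>j<N. m j (x n \<omega>, n)) + \<epsilon>)"
            using C(1) \<epsilon>(1) m(2)[OF _ n0] by (intro mult_nonneg_nonneg add_nonneg_nonneg sum_nonneg) auto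
          then show ?thesis using False u(3)[of "(x n \<omega>, n)"] by simp
        qed (use E(2)[OF elim(2)] in simp)
      qed
      also have "\<dots> = R n"
      proof -
        have d: "integrable (M n) (\<lambda>\<omega>. m j (x n \<omega>, n) - b j * indicator (E n) \<omega>)"
          "(\<integral>\<omega>. m j (x n \<omega>, n) - b j * indicator (E n) \<omega> \<partial>M n)
            = enn2real (\<integral>\<^sup>+ \<omega>. ennreal (m j (x n \<omega>, n)) \<partial>M n) - b j * pr.prob (E n)" if "j < N" for j
          using mi[OF that] Ei by (simp_all add: Int_absorb2)
        have s: "integrable (M n) (\<lambda>\<omega>. \<Sum>j<N. m j (x n \<omega>, n) - b j * indicator (E n) \<omega>)"
          by (intro Bochner_Integration.integrable_sum d(1)) simp
        have "(\<integral>\<omega>. (\<Sum>j<N. m j (x n \<omega>, n) - b j * indicator (E n) \<omega>) \<partial>M n)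
            = (\<Sum>j<N. \<integral>\<omega>. m j (x n \<omega>, n) - b j * indicator (E n) \<omega> \<partial>M n)"
          by (intro Bochner_Integration.integral_sum d(1)) simp
        also have "\<dots> = (\<Sum>j<N. enn2real (\<integral>\<^sup>+ \<omega>. ennreal (m j (x n \<omega>, n)) \<partial>M n) - b j * pr.prob (E n))"
          by (intro sum.cong refl d(2)) simp
        finally show ?thesis using s Ei by (simp add: R_def Int_absorb2 pr.prob_space)
      qed
      finally show ?case using elim(1) by simp
    qed
  qed
qed

end

section \<open>Convergence of the means\<close>

context generalized_vertex_space
begin

lemma eventually_mean_copies_ge:
  assumes \<kappa>: "kernel \<kappa>" "ae_continuous \<mu> \<kappa>" and shape: "shape r k \<sigma>"
    and c: "0 \<le> c" "ennreal c < walk_integral \<mu> \<kappa> r k / of_nat \<sigma>"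
  shows "eventually (\<lambda>(xs, n). c \<le> mean_copies r k \<kappa> n xs / n ^ (r - k)) (sample_filter \<mu>)"
proof -
  from eventually_good_copies[OF \<kappa> shape c(2,1)] obtain B where
    B: "eventually (\<lambda>(xs, n). c * n ^ (r - k) < (\<Sum>S\<in>good_copies r k \<kappa> xs B. prod (edge_prob \<kappa> n xs) S)) (sample_filter \<mu>)"
    by blast
  have "eventually (\<lambda>(xs, n). 1 \<le> n) (sample_filter \<mu>)" by (rule eventually_parameter_ge)
  then show ?thesis using B
  proof eventually_elim
    case (elim z)
    obtain xs n where z: "z = (xs, n)" by fastforce
    have n: "0 < n" using elim z by simp
    have "(\<Sum>S\<in>good_copies r k \<kappa> xs B. prod (edge_prob \<kappa> n xs) S) \<le> mean_copies r k \<kappa> n xs"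
      unfolding mean_copies_def
    proof (rule sum_mono2)
      fix S
      show "0 \<le> prod (edge_prob \<kappa> n xs) S"
        using \<kappa>(1) n by (intro prod_nonneg) (auto simp: edge_prob_def kernel_def)
    qed (use good_copies_subset[of r k \<kappa> xs B] in auto)
    then have "c * n ^ (r - k) \<le> mean_copies r k \<kappa> n xs" using elim z by simp
    then show ?case using n z by (simp add: pos_le_divide_eq)
  qed
qed

lemma Liminf_mean_copies:
  assumes \<kappa>: "kernel \<kappa>" "ae_continuous \<mu> \<kappa>" and shape: "shape r k \<sigma>"
  shows "walk_integral \<mu> \<kappa> r k / of_nat \<sigma>
    \<le> Liminf (at_top_in I) (\<lambda>n. \<integral>\<^sup>+ \<omega>. ennreal (mean_copies r k \<kappa> n (x n \<omega>) / n ^ (r - k)) \<partial>M n)"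
proof -
  have "walk_integral \<mu> \<kappa> r k / of_nat \<sigma> \<le> Liminf (at_top_in I)
      (\<lambda>n. \<integral>\<^sup>+ \<omega>. ennreal ((\<lambda>(xs, n). mean_copies r k \<kappa> n xs / n ^ (r - k)) (x n \<omega>, n)) \<partial>M n)"
  proof (rule Liminf_mean_ge)
    show "eventually (\<lambda>z. c \<le> (\<lambda>(xs, n). mean_copies r k \<kappa> n xs / n ^ (r - k)) z) (sample_filter \<mu>)"
      if "0 \<le> c" "ennreal c < walk_integral \<mu> \<kappa> r k / of_nat \<sigma>" for c
      using eventually_mean_copies_ge[OF \<kappa> shape that] by (simp add: case_prod_unfold)
  qed (use measurable_mean_copies[OF _ \<kappa>(1) shape] mean_copies_nonneg[OF \<kappa>(1)] in simp_all)
  then show ?thesis by simp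
qed

lemma Liminf_at_top_in_cong:
  fixes f g :: "real \<Rightarrow> ennreal"
  assumes "\<And>n. n \<in> I \<Longrightarrow> f n = g n"
  shows "Liminf (at_top_in I) f = Liminf (at_top_in I) g"
  by (rule Liminf_eq) (use eventually_index assms in \<open>auto elim: eventually_mono\<close>)

lemma tendsto_at_top_in_cong:
  assumes "\<And>n. n \<in> I \<Longrightarrow> f n = g n"
  shows "(f \<longlongrightarrow> l) (at_top_in I) \<longleftrightarrow> (g \<longlongrightarrow> l) (at_top_in I)"
  by (rule tendsto_cong) (use eventually_index assms in \<open>auto elim: eventually_mono\<close>)

end

section \<open>Upper bounds for the means on a vertex space\<close>

context vertex_space
begin

lemma tendsto_mean_copies:
  assumes \<kappa>: "kernel \<kappa>" "ae_continuous \<mu> \<kappa>" and shape: "shape r k \<sigma>"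
    and up: "Limsup (at_top_in I) (\<lambda>n. \<integral>\<^sup>+ \<omega>. ennreal (mean_copies r k \<kappa> n (x n \<omega>) / n ^ (r - k)) \<partial>M n)
      \<le> walk_integral \<mu> \<kappa> r k / of_nat \<sigma>"
  shows "((\<lambda>n. \<integral>\<^sup>+ \<omega>. ennreal (mean_copies r k \<kappa> n (x n \<omega>) / n ^ (r - k)) \<partial>M n)
      \<longlongrightarrow> walk_integral \<mu> \<kappa> r k / of_nat \<sigma>) (at_top_in I)"
proof -
  let ?f = "\<lambda>n. \<integral>\<^sup>+ \<omega>. ennreal (mean_copies r k \<kappa> n (x n \<omega>) / n ^ (r - k)) \<partial>M n"
  have "walk_integral \<mu> \<kappa> r k / of_nat \<sigma> \<le> Liminf (at_top_in I) ?f"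
    by (rule Liminf_mean_copies[OF \<kappa> shape])
  moreover have "Liminf (at_top_in I) ?f \<le> Limsup (at_top_in I) ?f"
    by (rule Liminf_le_Limsup[OF at_top_in_neq_bot])
  ultimately show ?thesis
    using up by (subst tendsto_iff_Liminf_eq_Limsup[OF at_top_in_neq_bot]) (auto intro: antisym order_trans)
qed

lemma sum_edge_prob_le:
  assumes \<kappa>: "kernel \<kappa>" and shape: "shape r k \<sigma>" and n: "0 < n"
  shows "mean_copies r k \<kappa> n xs / n ^ (r - k)
    \<le> (\<Sum>vs\<in>inj_lists r (length xs). \<Prod>i<k. \<kappa> (xs ! (vs ! i)) (xs ! (vs ! (Suc i mod r)))) / (real \<sigma> * n ^ r)"
proof -
  let ?P = "\<lambda>vs. \<Prod>i<k. \<kappa> (xs ! (vs ! i)) (xs ! (vs ! (Suc i mod r)))"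
  have \<sigma>: "0 < real \<sigma>" using shapeD(5)[OF shape] by simp
  have nr: "n ^ r = n ^ (r - k) * n ^ k" using shapeD(2)[OF shape] by (simp flip: power_add)
  have "real \<sigma> * mean_copies r k \<kappa> n xs \<le> (\<Sum>vs\<in>inj_lists r (length xs). ?P vs / n ^ k)"
    unfolding sum_inj_lists_edge_prob[OF \<kappa> shape]
  proof (rule sum_mono)
    fix vs
    have "(\<Prod>i<k. min (\<kappa> (xs ! (vs ! i)) (xs ! (vs ! (Suc i mod r))) / n) 1)
        \<le> (\<Prod>i<k. \<kappa> (xs ! (vs ! i)) (xs ! (vs ! (Suc i mod r))) / n)"
      using \<kappa> n by (intro prod_mono) (auto simp: kernel_def)
    then show "(\<Prod>i<k. min (\<kappa> (xs ! (vs ! i)) (xs ! (vs ! (Suc i mod r))) / n) 1) \<le> ?P vs / n ^ k"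
      by (simp add: prod_dividef)
  qed
  also have "\<dots> = (\<Sum>vs\<in>inj_lists r (length xs). ?P vs) / n ^ k" by (simp add: sum_divide_distrib)
  finally have "real \<sigma> * mean_copies r k \<kappa> n xs / real \<sigma>
      \<le> (\<Sum>vs\<in>inj_lists r (length xs). ?P vs) / n ^ k / real \<sigma>"
    using \<sigma> by (intro divide_right_mono) auto
  then have "mean_copies r k \<kappa> n xs \<le> (\<Sum>vs\<in>inj_lists r (length xs). ?P vs) / n ^ k / real \<sigma>"
    using \<sigma> by simp
  then have "mean_copies r k \<kappa> n xs / n ^ (r - k)
      \<le> (\<Sum>vs\<in>inj_lists r (length xs). ?P vs) / n ^ k / real \<sigma> / n ^ (r - k)"
    using n by (intro divide_right_mono) auto
  then show ?thesis by (simp add: nr mult_ac)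
qed

text \<open>The law of the whole sample is a product measure, and selecting coordinates along the
  injective index map given by \<open>vs\<close> preserves the product form.\<close>

lemma distr_sample_iid:
  assumes n: "n \<in> I" and iid: "iid_points \<mu> n (M n) (x n)" and vs: "vs \<in> inj_lists r v" and v: "real v = n"
  shows "(\<lambda>\<omega>. \<lambda>i\<in>{..<r}. x n \<omega> ! (vs ! i)) \<in> measurable (M n) (PiM {..<r} (\<lambda>_. \<mu>))"
    "distr (M n) (PiM {..<r} (\<lambda>_. \<mu>)) (\<lambda>\<omega>. \<lambda>i\<in>{..<r}. x n \<omega> ! (vs ! i)) = PiM {..<r} (\<lambda>_. \<mu>)"
proof -
  interpret pr: prob_space "M n" by (rule prob_space_M[OF n])
  have idx: "{i. real i < n} = {..<v}" using v by auto
  have v0: "0 < v" using index_gt_0[OF n] v by simp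
  have ind: "pr.indep_vars (\<lambda>_. borel) (\<lambda>i \<omega>. x n \<omega> ! i) {..<v}"
    and dist: "\<And>i. i < v \<Longrightarrow> distr (M n) borel (\<lambda>\<omega>. x n \<omega> ! i) = \<mu>"
    using iid v by (auto simp: iid_points_def idx)
  have rv: "(\<lambda>\<omega>. x n \<omega> ! i) \<in> borel_measurable (M n)" if "i < v" for i
    using ind that by (auto simp: pr.indep_vars_def)
  have rv': "(\<lambda>\<omega>. x n \<omega> ! i) \<in> measurable (M n) \<mu>" if "i < v" for i
    using rv[OF that] measurable_cong_sets[OF refl sets_mu] by blast
  have len: "length vs = r" "distinct vs" "set vs \<subseteq> {..<v}" using vs by (auto simp: inj_lists_def)
  have vsv: "vs ! i < v" if "i < r" for i
  proof -
    have "vs ! i \<in> set vs" using len(1) that by simp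
    then show ?thesis using len(3) by blast
  qed
  show meas: "(\<lambda>\<omega>. \<lambda>i\<in>{..<r}. x n \<omega> ! (vs ! i)) \<in> measurable (M n) (PiM {..<r} (\<lambda>_. \<mu>))"
    by (rule measurable_restrict) (use rv' vsv in auto)
  have meas_v: "(\<lambda>\<omega>. \<lambda>i\<in>{..<v}. x n \<omega> ! i) \<in> measurable (M n) (PiM {..<v} (\<lambda>_. \<mu>))"
    by (rule measurable_restrict) (use rv' in auto)
  have "distr (M n) (PiM {..<v} (\<lambda>_. borel)) (\<lambda>\<omega>. \<lambda>i\<in>{..<v}. x n \<omega> ! i)
      = PiM {..<v} (\<lambda>i. distr (M n) borel (\<lambda>\<omega>. x n \<omega> ! i))"
    using pr.indep_vars_iff_distr_eq_PiM'[of "{..<v}" "\<lambda>i \<omega>. x n \<omega> ! i" "\<lambda>_. borel"] ind rv v0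
    by (simp add: lessThan_empty_iff)
  also have "\<dots> = PiM {..<v} (\<lambda>_. \<mu>)" by (rule PiM_cong) (use dist in auto)
  finally have "distr (M n) (PiM {..<v} (\<lambda>_. borel)) (\<lambda>\<omega>. \<lambda>i\<in>{..<v}. x n \<omega> ! i) = PiM {..<v} (\<lambda>_. \<mu>)" .
  moreover have "distr (M n) (PiM {..<v} (\<lambda>_. borel)) (\<lambda>\<omega>. \<lambda>i\<in>{..<v}. x n \<omega> ! i)
      = distr (M n) (PiM {..<v} (\<lambda>_. \<mu>)) (\<lambda>\<omega>. \<lambda>i\<in>{..<v}. x n \<omega> ! i)"
    by (rule distr_cong[OF refl sets_PiM_cong[OF refl] refl]) (simp add: sets_mu)
  ultimately have Dv: "distr (M n) (PiM {..<v} (\<lambda>_. \<mu>)) (\<lambda>\<omega>. \<lambda>i\<in>{..<v}. x n \<omega> ! i) = PiM {..<v} (\<lambda>_. \<mu>)" by simp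
  have proj: "(\<lambda>y. \<lambda>i\<in>{..<r}. y (vs ! i)) \<in> measurable (PiM {..<v} (\<lambda>_. \<mu>)) (PiM {..<r} (\<lambda>_. \<mu>))"
    by (rule measurable_restrict) (rule measurable_component_singleton, use vsv in auto)
  have "distr (PiM {..<v} (\<lambda>_. \<mu>)) (PiM {..<r} (\<lambda>_. \<mu>)) (\<lambda>y. \<lambda>i\<in>{..<r}. y (vs ! i)) = PiM {..<r} (\<lambda>_. \<mu>)"
    by (rule distr_PiM_reindex[of "{..<v}" "\<lambda>_. \<mu>" "\<lambda>i. vs ! i" "{..<r}"])
      (use prob_space_mu len vsv in \<open>auto simp: inj_on_def nth_eq_iff_index_eq\<close>)
  then have "PiM {..<r} (\<lambda>_. \<mu>) = distr (distr (M n) (PiM {..<v} (\<lambda>_. \<mu>)) (\<lambda>\<omega>. \<lambda>i\<in>{..<v}. x n \<omega> ! i))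
      (PiM {..<r} (\<lambda>_. \<mu>)) (\<lambda>y. \<lambda>i\<in>{..<r}. y (vs ! i))"
    by (simp add: Dv)
  also have "\<dots> = distr (M n) (PiM {..<r} (\<lambda>_. \<mu>)) ((\<lambda>y. \<lambda>i\<in>{..<r}. y (vs ! i)) \<circ> (\<lambda>\<omega>. \<lambda>i\<in>{..<v}. x n \<omega> ! i))"
    by (rule distr_distr[OF proj meas_v])
  also have "(\<lambda>y. \<lambda>i\<in>{..<r}. y (vs ! i)) \<circ> (\<lambda>\<omega>. \<lambda>i\<in>{..<v}. x n \<omega> ! i) = (\<lambda>\<omega>. \<lambda>i\<in>{..<r}. x n \<omega> ! (vs ! i))"
    using vsv by (auto simp: fun_eq_iff restrict_def)
  finally show "distr (M n) (PiM {..<r} (\<lambda>_. \<mu>)) (\<lambda>\<omega>. \<lambda>i\<in>{..<r}. x n \<omega> ! (vs ! i)) = PiM {..<r} (\<lambda>_. \<mu>)"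
    by (rule sym)
qed

text \<open>Once the minimum in the edge probabilities is dropped, each injective tuple contributes
  exactly the walk integral, and there are at most \<open>n ^ r\<close> tuples. So the bound holds
  for every \<open>n\<close>, also with infinite values.\<close>

lemma mean_copies_le_iid:
  assumes \<kappa>: "kernel \<kappa>" and shape: "shape r k \<sigma>" and n: "n \<in> I" and iid: "iid_points \<mu> n (M n) (x n)"
  shows "(\<integral>\<^sup>+ \<omega>. ennreal (mean_copies r k \<kappa> n (x n \<omega>) / n ^ (r - k)) \<partial>M n) \<le> walk_integral \<mu> \<kappa> r k / of_nat \<sigma>"
proof -
  interpret pr: prob_space "M n" by (rule prob_space_M[OF n])
  obtain v where v: "n = real v" using n index_nat by (auto elim: Nats_cases)
  have n0: "0 < n" by (rule index_gt_0[OF n])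
  have \<sigma>: "0 < real \<sigma>" using shapeD(5)[OF shape] by simp
  have \<kappa>0: "0 \<le> \<kappa> s t" for s t using \<kappa> by (simp add: kernel_def)
  let ?P = "\<lambda>y. \<Prod>i<k. ennreal (\<kappa> (y i) (y (Suc i mod r)))"
  have Pm: "?P \<in> borel_measurable (PiM {..<r} (\<lambda>_. \<mu>))"
    by (intro borel_measurable_prod_ennreal measurable_compose[OF measurable_kernel[OF \<kappa>] measurable_ennreal])
      (use walk_step(1,2)[OF shape] in auto)
  let ?X = "\<lambda>vs \<omega>. \<lambda>i\<in>{..<r}. x n \<omega> ! (vs ! i)"
  have X: "?X vs \<in> measurable (M n) (PiM {..<r} (\<lambda>_. \<mu>))" "(\<integral>\<^sup>+ \<omega>. ?P (?X vs \<omega>) \<partial>M n) = walk_integral \<mu> \<kappa> r k"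
    if "vs \<in> inj_lists r v" for vs
  proof -
    note D = distr_sample_iid[OF n iid that v[symmetric]]
    show "?X vs \<in> measurable (M n) (PiM {..<r} (\<lambda>_. \<mu>))" by (rule D(1))
    have "walk_integral \<mu> \<kappa> r k = integral\<^sup>N (distr (M n) (PiM {..<r} (\<lambda>_. \<mu>)) (?X vs)) ?P"
      by (simp only: D(2) walk_integral_def)
    also have "\<dots> = (\<integral>\<^sup>+ \<omega>. ?P (?X vs \<omega>) \<partial>M n)" by (rule nn_integral_distr[OF D(1)]) (use Pm in simp)
    finally show "(\<integral>\<^sup>+ \<omega>. ?P (?X vs \<omega>) \<partial>M n) = walk_integral \<mu> \<kappa> r k" by simp
  qed
  let ?c = "1 / (real \<sigma> * n ^ r)"
  have "(\<integral>\<^sup>+ \<omega>. ennreal (mean_copies r k \<kappa> n (x n \<omega>) / n ^ (r - k)) \<partial>M n)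
      \<le> (\<integral>\<^sup>+ \<omega>. ennreal ?c * (\<Sum>vs\<in>inj_lists r v. ?P (?X vs \<omega>)) \<partial>M n)"
  proof (rule nn_integral_mono)
    fix \<omega> assume "\<omega> \<in> space (M n)"
    then have len: "length (x n \<omega>) = v" using length_x[OF n] v by simp
    have "?P (?X vs \<omega>) = ennreal (\<Prod>i<k. \<kappa> (x n \<omega> ! (vs ! i)) (x n \<omega> ! (vs ! (Suc i mod r))))" for vs
    proof -
      have "(\<Prod>i<k. ennreal (\<kappa> (?X vs \<omega> i) (?X vs \<omega> (Suc i mod r))))
          = (\<Prod>i<k. ennreal (\<kappa> (x n \<omega> ! (vs ! i)) (x n \<omega> ! (vs ! (Suc i mod r)))))"
        by (rule prod.cong) (use walk_step(1,2)[OF shape] in auto)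
      then show ?thesis by (simp add: prod_ennreal \<kappa>0)
    qed
    then have sum: "(\<Sum>vs\<in>inj_lists r v. ?P (?X vs \<omega>))
        = ennreal (\<Sum>vs\<in>inj_lists r v. \<Prod>i<k. \<kappa> (x n \<omega> ! (vs ! i)) (x n \<omega> ! (vs ! (Suc i mod r))))"
      by (simp only: sum_ennreal[OF prod_nonneg[OF \<kappa>0]])
    have "ennreal ?c * (\<Sum>vs\<in>inj_lists r v. ?P (?X vs \<omega>))
        = ennreal (?c * (\<Sum>vs\<in>inj_lists r v. \<Prod>i<k. \<kappa> (x n \<omega> ! (vs ! i)) (x n \<omega> ! (vs ! (Suc i mod r)))))"
      unfolding sum by (rule ennreal_mult'[symmetric]) (use \<sigma> n0 in simp)
    then show "ennreal (mean_copies r k \<kappa> n (x n \<omega>) / n ^ (r - k)) \<le> ennreal ?c * (\<Sum>vs\<in>inj_lists r v. ?P (?X vs \<omega>))"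
      using sum_edge_prob_le[OF \<kappa> shape n0, of "x n \<omega>"] len by (auto intro!: ennreal_leI)
  qed
  also have "\<dots> = ennreal ?c * (\<Sum>vs\<in>inj_lists r v. \<integral>\<^sup>+ \<omega>. ?P (?X vs \<omega>) \<partial>M n)"
    using measurable_compose[OF X(1) Pm] by (subst nn_integral_cmult) (simp_all add: nn_integral_sum)
  also have "\<dots> = ennreal ?c * (of_nat (card (inj_lists r v)) * walk_integral \<mu> \<kappa> r k)"
  proof -
    have "(\<Sum>vs\<in>inj_lists r v. \<integral>\<^sup>+ \<omega>. ?P (?X vs \<omega>) \<partial>M n) = (\<Sum>vs\<in>inj_lists r v. walk_integral \<mu> \<kappa> r k)"
      by (intro sum.cong refl X(2))
    then show ?thesis by (simp only: sum_constant)
  qed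
  also have "\<dots> = ennreal (?c * real (card (inj_lists r v))) * walk_integral \<mu> \<kappa> r k"
    using \<sigma> n0 by (simp add: ennreal_mult ennreal_of_nat_eq_real_of_nat mult.assoc del: times_divide_eq_left mult_1)
  also have "\<dots> \<le> ennreal (1 / real \<sigma>) * walk_integral \<mu> \<kappa> r k"
  proof (intro mult_right_mono ennreal_leI)
    have "real (card (inj_lists r v)) \<le> n ^ r" using card_inj_lists_le[of r v] v by simp
    then have "?c * real (card (inj_lists r v)) \<le> ?c * n ^ r" using \<sigma> n0 by (intro mult_left_mono) auto
    then show "?c * real (card (inj_lists r v)) \<le> 1 / real \<sigma>" using n0 by simp
  qed simp
  also have "\<dots> = walk_integral \<mu> \<kappa> r k / of_nat \<sigma>"
    using \<sigma> by (simp add: divide_ennreal_def inverse_ennreal ennreal_of_nat_eq_real_of_nat mult.commute inverse_eq_divide)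
  finally show ?thesis .
qed

text \<open>The lower bound for empirical sums is applied to \<open>B ^ k - \<Phi>\<close>, which is
  again nonnegative, bounded and almost everywhere continuous. It becomes an upper bound for
  \<open>\<Phi>\<close> because \<open>\<mu>\<close> has mass 1 and there are exactly
  \<open>n\<close> points, so the constant \<open>B ^ k\<close> contributes at most itself.\<close>

lemma Limsup_mean_copies_bounded:
  assumes \<kappa>: "kernel \<kappa>" "ae_continuous \<mu> \<kappa>" and shape: "shape r k \<sigma>" and bounded: "\<And>s t. \<kappa> s t \<le> B"
  shows "Limsup (at_top_in I) (\<lambda>n. \<integral>\<^sup>+ \<omega>. ennreal (mean_copies r k \<kappa> n (x n \<omega>) / n ^ (r - k)) \<partial>M n)
      \<le> walk_integral \<mu> \<kappa> r k / of_nat \<sigma>"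
proof -
  interpret P: prob_space "PiM {..<r} (\<lambda>_. \<mu>)" by (rule prob_space_PiM) (rule prob_space_mu)
  have \<sigma>: "0 < real \<sigma>" using shapeD(5)[OF shape] by simp
  have \<kappa>0: "0 \<le> \<kappa> s t" for s t using \<kappa> by (simp add: kernel_def)
  have B: "0 \<le> B" using \<kappa>0 bounded order_trans by blast
  define \<Phi> where "\<Phi> y = (\<Prod>i<k. \<kappa> (y i) (y (Suc i mod r)))" for y :: "nat \<Rightarrow> 'a"
  have \<Phi>0: "0 \<le> \<Phi> y" and \<Phi>B: "\<Phi> y \<le> B ^ k" for y
    using \<kappa>0 bounded prod_mono[of "{..<k}" "\<lambda>i. \<kappa> (y i) (y (Suc i mod r))" "\<lambda>_. B"]
    by (auto simp: \<Phi>_def prod_nonneg)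
  have \<Phi>m: "\<Phi> \<in> borel_measurable (PiM {..<r} (\<lambda>_. \<mu>))"
    unfolding \<Phi>_def by (intro borel_measurable_prod measurable_kernel[OF \<kappa>(1)]) (use walk_step(1,2)[OF shape] in auto)
  have \<Phi>i: "integrable (PiM {..<r} (\<lambda>_. \<mu>)) \<Phi>"
    by (rule P.integrable_const_bound[where B = "B ^ k"]) (use \<Phi>0 \<Phi>B \<Phi>m in auto)
  define w where "w = (\<integral>y. \<Phi> y \<partial>PiM {..<r} (\<lambda>_. \<mu>))"
  have w0: "0 \<le> w" unfolding w_def by (rule integral_nonneg_AE) (simp add: \<Phi>0)
  have W: "walk_integral \<mu> \<kappa> r k = ennreal w"
    unfolding w_def walk_integral_def nn_integral_eq_integral[OF \<Phi>i AE_I2[OF \<Phi>0], symmetric]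
    by (rule nn_integral_cong) (simp add: \<Phi>_def prod_ennreal \<kappa>0)
  have comp: "(\<integral>\<^sup>+ y. ennreal (B ^ k - \<Phi> y) \<partial>PiM {..<r} (\<lambda>_. \<mu>)) = ennreal (B ^ k - w)"
    using \<Phi>i \<Phi>B by (subst nn_integral_eq_integral) (auto simp: w_def P.prob_space)
  let ?f = "\<lambda>n. \<integral>\<^sup>+ \<omega>. ennreal (mean_copies r k \<kappa> n (x n \<omega>) / n ^ (r - k)) \<partial>M n"
  let ?S = "\<lambda>xs. \<Sum>vs\<in>inj_lists r (length xs). \<Phi> (\<lambda>i. xs ! (vs ! i))"
  \<comment> \<open>This crude bound covers the samples outside the typical event.\<close>
  have Sbound: "?S xs / n ^ r \<le> B ^ k" if "real (length xs) = n" "0 < n" for xs and n :: real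
  proof -
    have "?S xs \<le> real (card (inj_lists r (length xs))) * B ^ k"
      using sum_bounded_above[of "inj_lists r (length xs)" "\<lambda>vs. \<Phi> (\<lambda>i. xs ! (vs ! i))" "B ^ k"] \<Phi>B by simp
    also have "\<dots> \<le> n ^ r * B ^ k"
      using card_inj_lists_le[of r "length xs"] that B by (intro mult_right_mono) auto
    finally show ?thesis using that by (simp add: pos_divide_le_eq mult.commute)
  qed
  have mean_le: "mean_copies r k \<kappa> n xs / n ^ (r - k) \<le> ?S xs / n ^ r / real \<sigma>" if "0 < n" for xs n
    using sum_edge_prob_le[OF \<kappa>(1) shape that, of xs] by (simp add: \<Phi>_def mult.commute)
  have "Limsup (at_top_in I) ?f \<le> ennreal (w / real \<sigma>)"
  proof (rule ennreal_le_epsilon)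
    fix e :: real assume e: "0 < e"
    \<comment> \<open>The factor compensates for the later division by
      \<open>\<sigma>\<close>.\<close>
    define \<epsilon> where "\<epsilon> = e * real \<sigma>"
    have \<epsilon>: "0 < \<epsilon>" using e \<sigma> by (simp add: \<epsilon>_def)
    have "eventually (\<lambda>(xs, n). real (length xs) = n \<longrightarrow> ?S xs / n ^ r \<le> w + \<epsilon>) (sample_filter \<mu>)"
    proof (cases "B ^ k - w - \<epsilon> < 0")
      \<comment> \<open>Then \<open>w + \<epsilon>\<close> exceeds the crude bound
        \<open>B ^ k\<close>.\<close>
      case True
      have "eventually (\<lambda>(xs, n). 1 \<le> n) (sample_filter \<mu>)" by (rule eventually_parameter_ge)
      then show ?thesis
      proof eventually_elim
        case (elim z)
        then show ?case using Sbound[of "fst z" "snd z"] True by (auto split: prod.splits)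
      qed
    next
      case False
      have "eventually (\<lambda>(xs, n). B ^ k - w - \<epsilon> <
          (\<Sum>vs\<in>inj_lists r (length xs). B ^ k - \<Phi> (\<lambda>i. xs ! (vs ! i))) / n ^ r) (sample_filter \<mu>)"
      proof (rule eventually_sum_inj_lists[where \<Psi> = "\<lambda>y. B ^ k - \<Phi> y" and H = "B ^ k"])
        show "0 \<le> B ^ k - \<Phi> y" "B ^ k - \<Phi> y \<le> B ^ k" for y using \<Phi>0 \<Phi>B by auto
        show "B ^ k - \<Phi> y = B ^ k - \<Phi> z" if *: "\<And>i. i < r \<Longrightarrow> y i = z i" for y z
          unfolding \<Phi>_def
          by (intro arg_cong2[where f = "(-)"] refl prod.cong) (use * walk_step(1,2)[OF shape] in auto)
        show "AE y in PiM {..<r} (\<lambda>_. \<mu>). isCont (\<lambda>y. B ^ k - \<Phi> y) y"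
          using AE_isCont_walk[OF \<kappa>(2) shape]
        proof (rule AE_mp, intro AE_I2 impI)
          fix y :: "nat \<Rightarrow> 'a" assume "\<forall>i<k. isCont (\<lambda>y. \<kappa> (y i) (y (Suc i mod r))) y"
          then show "isCont (\<lambda>y. B ^ k - \<Phi> y) y"
            unfolding \<Phi>_def by (intro continuous_diff continuous_const continuous_prod) auto
        qed
        show "ennreal (B ^ k - w - \<epsilon>) < (\<integral>\<^sup>+ y. ennreal (B ^ k - \<Phi> y) \<partial>PiM {..<r} (\<lambda>_. \<mu>))"
          unfolding comp using False \<epsilon> by (intro ennreal_lessI) auto
        show "0 \<le> B ^ k - w - \<epsilon>" using False by simp
      qed
      moreover have "eventually (\<lambda>(xs, n). 1 \<le> n) (sample_filter \<mu>)" by (rule eventually_parameter_ge)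
      ultimately show ?thesis
      proof eventually_elim
        case (elim z)
        obtain xs n where z: "z = (xs, n)" by fastforce
        have n: "0 < n" using elim z by simp
        have "?S xs / n ^ r \<le> w + \<epsilon>" if "real (length xs) = n"
        proof -
          have "(\<Sum>vs\<in>inj_lists r (length xs). B ^ k - \<Phi> (\<lambda>i. xs ! (vs ! i))) / n ^ r
              = real (card (inj_lists r (length xs))) * B ^ k / n ^ r - ?S xs / n ^ r"
            by (simp add: sum_subtractf diff_divide_distrib)
          moreover have "real (card (inj_lists r (length xs))) * B ^ k / n ^ r \<le> n ^ r * B ^ k / n ^ r"
            using card_inj_lists_le[of r "length xs"] that B n by (intro divide_right_mono mult_right_mono) auto
          moreover have "n ^ r * B ^ k / n ^ r = B ^ k" using n by simp
          ultimately show ?thesis using elim z by simp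
        qed
        then show ?case using z by simp
      qed
    qed
    from with_high_probability[OF this] obtain E where E: "\<And>n. n \<in> I \<Longrightarrow> E n \<in> sets (M n)"
      "\<And>n \<omega>. n \<in> I \<Longrightarrow> \<omega> \<in> E n \<Longrightarrow> real (length (x n \<omega>)) = n \<Longrightarrow> ?S (x n \<omega>) / n ^ r \<le> w + \<epsilon>"
      "((\<lambda>n. measure (M n) (E n)) \<longlongrightarrow> 1) (at_top_in I)" by auto
    let ?g = "\<lambda>n. (w + \<epsilon>) / real \<sigma> + B ^ k / real \<sigma> * (1 - measure (M n) (E n))"
    have "?f n \<le> ennreal (?g n)" if n: "n \<in> I" for n
    proof -
      interpret pr: prob_space "M n" by (rule prob_space_M[OF n])
      have n0: "0 < n" by (rule index_gt_0[OF n])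
      let ?h = "\<lambda>\<omega>. (w + \<epsilon>) / real \<sigma> + B ^ k / real \<sigma> * (1 - indicator (E n) \<omega>)"
      have Es: "E n \<subseteq> space (M n)" using E(1)[OF n] sets.sets_into_space by blast
      have "?f n \<le> (\<integral>\<^sup>+ \<omega>. ennreal (?h \<omega>) \<partial>M n)"
      proof (intro nn_integral_mono ennreal_leI)
        fix \<omega> assume "\<omega> \<in> space (M n)"
        then have len: "real (length (x n \<omega>)) = n" by (rule length_x[OF n])
        have "?S (x n \<omega>) / n ^ r \<le> (w + \<epsilon>) + B ^ k * (1 - indicator (E n) \<omega>)"
          using E(2)[OF n _ len] Sbound[OF len n0] w0 \<epsilon> by (auto simp: indicator_def)
        then have "?S (x n \<omega>) / n ^ r / real \<sigma> \<le> ((w + \<epsilon>) + B ^ k * (1 - indicator (E n) \<omega>)) / real \<sigma>"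
          using \<sigma> by (intro divide_right_mono) auto
        then show "mean_copies r k \<kappa> n (x n \<omega>) / n ^ (r - k) \<le> ?h \<omega>"
          using mean_le[OF n0, of "x n \<omega>"] by (simp add: add_divide_distrib)
      qed
      also have "\<dots> = ennreal (\<integral>\<omega>. ?h \<omega> \<partial>M n)"
      proof (rule nn_integral_eq_integral)
        show "integrable (M n) ?h" using E(1)[OF n] by (simp add: pr.emeasure_eq_measure)
        show "AE \<omega> in M n. 0 \<le> ?h \<omega>" using w0 \<epsilon> \<sigma> B by (auto simp: indicator_def)
      qed
      also have "(\<integral>\<omega>. ?h \<omega> \<partial>M n) = ?g n"
        using E(1)[OF n] Es by (simp add: pr.emeasure_eq_measure pr.prob_space Int_absorb2)
      finally show ?thesis .
    qed
    then have "eventually (\<lambda>n. ?f n \<le> ennreal (?g n)) (at_top_in I)"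
      using eventually_index by (auto elim: eventually_mono)
    then have "Limsup (at_top_in I) ?f \<le> Limsup (at_top_in I) (\<lambda>n. ennreal (?g n))" by (rule Limsup_mono)
    also have "\<dots> = ennreal ((w + \<epsilon>) / real \<sigma> + B ^ k / real \<sigma> * (1 - 1))"
      by (intro lim_imp_Limsup at_top_in_neq_bot tendsto_intros E(3))
    also have "\<dots> = ennreal (w / real \<sigma>) + ennreal e"
      using w0 e \<sigma> by (simp add: \<epsilon>_def add_divide_distrib flip: ennreal_plus)
    finally show "Limsup (at_top_in I) ?f \<le> ennreal (w / real \<sigma>) + ennreal e" .
  qed
  then show ?thesis
    unfolding W using \<sigma> w0 by (simp add: ennreal_of_nat_eq_real_of_nat divide_ennreal)
qed

lemma tendsto_mean_copies_vertex_space: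
  assumes \<kappa>: "kernel \<kappa>" "ae_continuous \<mu> \<kappa>" and shape: "shape r k \<sigma>"
    and "bounded_kernel \<kappa> \<or> (\<forall>n\<in>I. iid_points \<mu> n (M n) (x n))"
  shows "((\<lambda>n. \<integral>\<^sup>+ \<omega>. ennreal (mean_copies r k \<kappa> n (x n \<omega>) / n ^ (r - k)) \<partial>M n)
      \<longlongrightarrow> walk_integral \<mu> \<kappa> r k / of_nat \<sigma>) (at_top_in I)"
proof (rule tendsto_mean_copies[OF \<kappa> shape])
  show "Limsup (at_top_in I) (\<lambda>n. \<integral>\<^sup>+ \<omega>. ennreal (mean_copies r k \<kappa> n (x n \<omega>) / n ^ (r - k)) \<partial>M n)
      \<le> walk_integral \<mu> \<kappa> r k / of_nat \<sigma>"
    using assms(4)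
  proof
    assume "bounded_kernel \<kappa>"
    then obtain B where "\<And>s t. \<kappa> s t \<le> B" by (auto simp: bounded_kernel_def)
    then show ?thesis by (rule Limsup_mean_copies_bounded[OF \<kappa> shape])
  next
    assume "\<forall>n\<in>I. iid_points \<mu> n (M n) (x n)"
    then show ?thesis
      using mean_copies_le_iid[OF \<kappa>(1) shape] eventually_index
      by (intro Limsup_bounded) (auto elim: eventually_mono)
  qed
qed

end

section \<open>Convergence of the counts\<close>

context generalized_vertex_space
begin

lemma paths_conv_in_prob:
  assumes \<kappa>: "kernel \<kappa>" "ae_continuous \<mu> \<kappa>" and k: "1 \<le> k"
    and conv: "paths_mean_conv \<mu> I M x \<kappa> k" and fin: "alpha \<mu> \<kappa> k < \<infinity>"
  shows "conv_in_prob (random_graph M x \<kappa>) (\<lambda>n G. real (num_paths k G) / n)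
    (enn2real (alpha \<mu> \<kappa> k)) (at_top_in I)"
  unfolding conv_in_prob_def
proof (intro allI impI)
  fix e :: real assume e: "0 < e"
  define a where "a = enn2real (alpha \<mu> \<kappa> k)"
  have a: "alpha \<mu> \<kappa> k = ennreal a" "0 \<le> a" using fin by (auto simp: a_def)
  let ?A = "\<lambda>n. {G. e < \<bar>real (num_paths k G) / n - a\<bar>}"
  let ?u = "\<lambda>z. measure_pmf.prob (graph_given \<kappa> (snd z) (fst z)) (?A (snd z))"
  have "((\<lambda>n. \<integral>\<omega>. ?u (x n \<omega>, n) \<partial>M n) \<longlongrightarrow> 0) (at_top_in I)"
  proof (rule expectation_tendsto_0[where H = 1 and N = 1 and b = "\<lambda>_. a"
        and m = "\<lambda>_ z. mean_copies (Suc k) k \<kappa> (snd z) (fst z) / snd z"])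
    show "(\<lambda>\<omega>. ?u (x n \<omega>, n)) \<in> borel_measurable (M n)" if "n \<in> I" for n
      using measurable_expectation_graph_given[OF that \<kappa>(1), of "indicator (?A n)"] by simp
    show "(\<lambda>\<omega>. mean_copies (Suc k) k \<kappa> (snd (x n \<omega>, n)) (fst (x n \<omega>, n)) / snd (x n \<omega>, n)) \<in> borel_measurable (M n)"
      if "n \<in> I" for n
      using measurable_mean_copies[OF that \<kappa>(1) shape_path[OF k]] by simp
    show "0 \<le> mean_copies (Suc k) k \<kappa> (snd (xs, n)) (fst (xs, n)) / snd (xs, n)" if "0 < n" for xs and n :: real
      using mean_copies_nonneg[OF \<kappa>(1) that] that by simp
    show "((\<lambda>n. \<integral>\<^sup>+ \<omega>. ennreal (mean_copies (Suc k) k \<kappa> (snd (x n \<omega>, n)) (fst (x n \<omega>, n)) / snd (x n \<omega>, n)) \<partial>M n)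
        \<longlongrightarrow> ennreal a) (at_top_in I)"
      using conv tendsto_at_top_in_cong[OF mean_count_num_paths[OF _ \<kappa>(1) k]] a(1)
      by (simp add: paths_mean_conv_def)
    show "\<exists>C\<ge>0. \<forall>\<epsilon>>0. eventually (\<lambda>z. ?u z
        \<le> C * ((\<Sum>j<(1::nat). mean_copies (Suc k) k \<kappa> (snd z) (fst z) / snd z - a) + \<epsilon>)) (sample_filter \<mu>)"
      using paths_deviation[OF \<kappa> k a e] by (simp add: case_prod_unfold)
  qed (use a(2) in simp_all)
  then have "((\<lambda>n. measure (random_graph M x \<kappa> n) (?A n)) \<longlongrightarrow> 0) (at_top_in I)"
    using tendsto_at_top_in_cong[OF measure_random_graph[OF _ \<kappa>(1)]] by simp
  moreover have "measure (random_graph M x \<kappa> n) {G \<in> space (random_graph M x \<kappa> n). e < \<bar>real (num_paths k G) / n - a\<bar>}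
      = measure (random_graph M x \<kappa> n) (?A n)" if "n \<in> I" for n
    using space_random_graph[OF that] by simp
  ultimately show "((\<lambda>n. measure (random_graph M x \<kappa> n) {G \<in> space (random_graph M x \<kappa> n).
      e < \<bar>real (num_paths k G) / n - enn2real (alpha \<mu> \<kappa> k)\<bar>}) \<longlongrightarrow> 0) (at_top_in I)"
    unfolding a_def[symmetric] by (subst tendsto_at_top_in_cong)
qed

lemma cycles_finite_joint:
  fixes ks :: "nat \<Rightarrow> nat" and b :: "nat \<Rightarrow> real" and f :: "(nat \<Rightarrow> nat) \<Rightarrow> real"
  assumes \<kappa>: "kernel \<kappa>" "ae_continuous \<mu> \<kappa>"
    and ks: "\<And>j. j < N \<Longrightarrow> 3 \<le> ks j" "inj_on ks {..<N}"
    and b: "\<And>j. 0 \<le> b j" "\<And>j. j < N \<Longrightarrow> beta \<mu> \<kappa> (ks j) = ennreal (b j)"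
    and conv: "\<And>j. j < N \<Longrightarrow> cycles_mean_conv \<mu> I M x \<kappa> (ks j)"
    and f: "\<And>w. \<bar>f w\<bar> \<le> H"
  shows "((\<lambda>n. \<integral>G. f (\<lambda>j\<in>{..<N}. num_cycles (ks j) G) \<partial>random_graph M x \<kappa> n)
    \<longlongrightarrow> integral\<^sup>L (PiM {..<N} (\<lambda>j. measure_pmf (Po (b j)))) f) (at_top_in I)"
proof -
  let ?L = "integral\<^sup>L (PiM {..<N} (\<lambda>j. measure_pmf (Po (b j)))) f"
  let ?Q = "\<lambda>G. f (\<lambda>j\<in>{..<N}. num_cycles (ks j) G)"
  let ?E = "\<lambda>n xs. measure_pmf.expectation (graph_given \<kappa> n xs) ?Q"
  let ?u = "\<lambda>z. \<bar>?E (snd z) (fst z) - ?L\<bar>"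
  have bound: "\<bar>?E n xs\<bar> \<le> H" for n xs
  proof -
    have "\<bar>?E n xs\<bar> \<le> measure_pmf.expectation (graph_given \<kappa> n xs) (\<lambda>G. \<bar>?Q G\<bar>)"
      using integral_norm_bound[of "graph_given \<kappa> n xs" ?Q] by simp
    also have "\<dots> \<le> measure_pmf.expectation (graph_given \<kappa> n xs) (\<lambda>G. H)"
      by (rule integral_mono) (use f in auto)
    finally show ?thesis by simp
  qed
  have meas: "(\<lambda>\<omega>. ?E n (x n \<omega>)) \<in> borel_measurable (M n)" if "n \<in> I" for n
    by (rule measurable_expectation_graph_given[OF that \<kappa>(1)])
  have "((\<lambda>n. \<integral>\<omega>. ?u (x n \<omega>, n) \<partial>M n) \<longlongrightarrow> 0) (at_top_in I)"
  proof (rule expectation_tendsto_0[where H = "H + \<bar>?L\<bar>" and N = N and b = b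
        and m = "\<lambda>j z. mean_copies (ks j) (ks j) \<kappa> (snd z) (fst z)"])
    show "(\<lambda>\<omega>. ?u (x n \<omega>, n)) \<in> borel_measurable (M n)" if "n \<in> I" for n
      using meas[OF that] by simp
    show "?u z \<le> H + \<bar>?L\<bar>" for z using bound[of "snd z" "fst z"] by linarith
    show "(\<lambda>\<omega>. mean_copies (ks j) (ks j) \<kappa> (snd (x n \<omega>, n)) (fst (x n \<omega>, n))) \<in> borel_measurable (M n)"
      if "j < N" "n \<in> I" for n j
      using measurable_mean_copies[OF that(2) \<kappa>(1) shape_cycle[OF ks(1)[OF that(1)]]] by simp
    show "0 \<le> mean_copies (ks j) (ks j) \<kappa> (snd (xs, n)) (fst (xs, n))" if "0 < n" for j xs and n :: real
      using mean_copies_nonneg[OF \<kappa>(1) that] by simp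
    show "((\<lambda>n. \<integral>\<^sup>+ \<omega>. ennreal (mean_copies (ks j) (ks j) \<kappa> (snd (x n \<omega>, n)) (fst (x n \<omega>, n))) \<partial>M n)
        \<longlongrightarrow> ennreal (b j)) (at_top_in I)" if "j < N" for j
      using conv[OF that] tendsto_at_top_in_cong[OF mean_count_num_cycles[OF _ \<kappa>(1) ks(1)[OF that]]] b(2)[OF that]
      by (simp add: cycles_mean_conv_def)
    show "\<exists>C\<ge>0. \<forall>\<epsilon>>0. eventually (\<lambda>z. ?u z
        \<le> C * ((\<Sum>j<N. mean_copies (ks j) (ks j) \<kappa> (snd z) (fst z) - b j) + \<epsilon>)) (sample_filter \<mu>)"
      using cycles_deviation[OF \<kappa> ks b f] by (simp add: case_prod_unfold)
  qed (use b(1) in simp_all)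
  then have lim: "((\<lambda>n. \<integral>\<omega>. \<bar>?E n (x n \<omega>) - ?L\<bar> \<partial>M n) \<longlongrightarrow> 0) (at_top_in I)" by simp
  have le: "norm ((\<integral>\<omega>. ?E n (x n \<omega>) \<partial>M n) - ?L) \<le> (\<integral>\<omega>. \<bar>?E n (x n \<omega>) - ?L\<bar> \<partial>M n)" if n: "n \<in> I" for n
  proof -
    interpret pr: prob_space "M n" by (rule prob_space_M[OF n])
    have i: "integrable (M n) (\<lambda>\<omega>. ?E n (x n \<omega>))"
      by (rule pr.integrable_const_bound[where B = H]) (use bound meas[OF n] in auto)
    have "(\<integral>\<omega>. ?E n (x n \<omega>) \<partial>M n) - ?L = (\<integral>\<omega>. ?E n (x n \<omega>) - ?L \<partial>M n)"
      using i by (simp add: pr.prob_space)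
    then show ?thesis using integral_norm_bound[of "M n" "\<lambda>\<omega>. ?E n (x n \<omega>) - ?L"] by simp
  qed
  have "((\<lambda>n. (\<integral>\<omega>. ?E n (x n \<omega>) \<partial>M n) - ?L) \<longlongrightarrow> 0) (at_top_in I)"
  proof (rule Lim_null_comparison[OF _ lim])
    show "eventually (\<lambda>n. norm ((\<integral>\<omega>. ?E n (x n \<omega>) \<partial>M n) - ?L) \<le> (\<integral>\<omega>. \<bar>?E n (x n \<omega>) - ?L\<bar> \<partial>M n)) (at_top_in I)"
      using eventually_index le by (rule eventually_mono)
  qed
  then have "((\<lambda>n. \<integral>\<omega>. ?E n (x n \<omega>) \<partial>M n) \<longlongrightarrow> ?L) (at_top_in I)" by (rule LIM_zero_cancel)
  moreover have "(\<integral>G. ?Q G \<partial>random_graph M x \<kappa> n) = (\<integral>\<omega>. ?E n (x n \<omega>) \<partial>M n)" if "n \<in> I" for n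
    by (rule integral_random_graph[OF that \<kappa>(1)]) (rule f)
  ultimately show ?thesis by (subst tendsto_at_top_in_cong)
qed

lemma cycles_conv_in_distr:
  assumes \<kappa>: "kernel \<kappa>" "ae_continuous \<mu> \<kappa>" and k: "3 \<le> k"
    and conv: "cycles_mean_conv \<mu> I M x \<kappa> k" and fin: "beta \<mu> \<kappa> k < \<infinity>"
  shows "conv_in_distr (random_graph M x \<kappa>) (\<lambda>n G. num_cycles k G)
    (measure_pmf (Po (enn2real (beta \<mu> \<kappa> k)))) (at_top_in I)"
  unfolding conv_in_distr_def
proof (intro allI impI)
  fix f :: "nat \<Rightarrow> real" assume f: "continuous_on UNIV f \<and> bounded (range f)"
  then obtain H where H: "\<And>w. \<bar>f w\<bar> \<le> H" by (auto simp: bounded_iff)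
  let ?b = "\<lambda>_::nat. enn2real (beta \<mu> \<kappa> k)"
  interpret product_prob_space "\<lambda>j::nat. measure_pmf (Po (?b j))" UNIV by (rule Po_product_prob_space)
  have "((\<lambda>n. \<integral>G. (\<lambda>w. f (w 0)) (\<lambda>j\<in>{..<(1::nat)}. num_cycles k G) \<partial>random_graph M x \<kappa> n)
    \<longlongrightarrow> integral\<^sup>L (PiM {..<1} (\<lambda>j. measure_pmf (Po (?b j)))) (\<lambda>w. f (w 0))) (at_top_in I)"
    by (rule cycles_finite_joint[where f = "\<lambda>w. f (w 0)" and H = H and ks = "\<lambda>_. k" and b = ?b and N = 1, OF \<kappa>])
      (use k conv fin H in \<open>auto simp: inj_on_def\<close>)
  moreover have "integral\<^sup>L (PiM {..<1} (\<lambda>j. measure_pmf (Po (?b j)))) (\<lambda>w. f (w 0))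
      = measure_pmf.expectation (Po (?b 0)) f"
    using product_integral_singleton[of f 0] by (simp add: lessThan_Suc)
  ultimately show "((\<lambda>n. \<integral>G. f (num_cycles k G) \<partial>random_graph M x \<kappa> n)
      \<longlongrightarrow> measure_pmf.expectation (Po (enn2real (beta \<mu> \<kappa> k))) f) (at_top_in I)"
    by simp
qed

text \<open>A bounded continuous function on sequences is the pointwise limit of its infima over
  cylinders, which depend on finitely many coordinates only.\<close>

lemma cycles_joint_liminf:
  fixes f :: "(nat \<Rightarrow> nat) \<Rightarrow> real" and b :: "nat \<Rightarrow> real"
  assumes \<kappa>: "kernel \<kappa>" "ae_continuous \<mu> \<kappa>"
    and b: "\<And>j. 0 \<le> b j" "\<And>j. beta \<mu> \<kappa> (j + 3) = ennreal (b j)"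
    and conv: "\<And>j. cycles_mean_conv \<mu> I M x \<kappa> (j + 3)"
    and f: "continuous_on UNIV f" "\<And>w. \<bar>f w\<bar> \<le> H" and e: "0 < e"
  shows "eventually (\<lambda>n. (\<integral>w. f w \<partial>(\<Pi>\<^sub>M j\<in>UNIV. measure_pmf (Po (b j)))) - e
    < (\<integral>G. f (\<lambda>j. num_cycles (j + 3) G) \<partial>random_graph M x \<kappa> n)) (at_top_in I)"
    and "f \<in> borel_measurable (\<Pi>\<^sub>M j\<in>UNIV. measure_pmf (Po (b j)))"
proof -
  interpret product_prob_space "\<lambda>j::nat. measure_pmf (Po (b j))" UNIV by (rule Po_product_prob_space)
  let ?L = "\<Pi>\<^sub>M j\<in>UNIV. measure_pmf (Po (b j))"
  interpret L: prob_space ?L by (rule prob_space_PiM) (simp add: measure_pmf.prob_space_axioms)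
  define g where "g K w = Inf {f w' | w'. \<forall>j<K. w' j = w j}" for K w
  have bdd: "bdd_below {f w' | w'. \<forall>j<K. w' j = w j}" for K w
  proof (rule bdd_belowI[of _ "- H"])
    fix t assume "t \<in> {f w' | w'. \<forall>j<K. w' j = w j}"
    then obtain w' where "t = f w'" by blast
    then show "- H \<le> t" using f(2)[of w'] by (simp add: abs_le_iff)
  qed
  have g_le: "g K w \<le> f w" for K w
    unfolding g_def by (rule cInf_lower[OF _ bdd]) auto
  have g_ge: "c \<le> g K w" if "\<And>w'. \<forall>j<K. w' j = w j \<Longrightarrow> c \<le> f w'" for c K w
    unfolding g_def by (rule cInf_greatest) (use that in auto)
  have gH: "\<bar>g K w\<bar> \<le> H" for K w
  proof -
    have "- H \<le> f w'" for w' using f(2)[of w'] by (simp add: abs_le_iff)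
    then have "- H \<le> g K w" by (rule g_ge)
    then show ?thesis using g_le[of K w] f(2)[of w] by (simp add: abs_le_iff)
  qed
  have g_restrict: "g K w = g K (restrict w {..<K})" for K w
    by (simp add: g_def)
  have restrict: "(\<lambda>w. restrict w {..<K}) \<in> measurable ?L (PiM {..<K} (\<lambda>j. measure_pmf (Po (b j))))" for K
    by (rule measurable_restrict_subset) simp
  have gm: "g K \<in> borel_measurable ?L" for K
  proof -
    have "(\<lambda>w. g K (restrict w {..<K})) \<in> borel_measurable ?L"
      by (rule measurable_compose[OF restrict measurable_PiM_Po]) simp
    then show ?thesis using g_restrict[of K] by (simp add: fun_eq_iff[symmetric])
  qed
  have lim: "(\<lambda>K. g K w) \<longlonglongrightarrow> f w" for w
  proof (rule LIMSEQ_I)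
    fix d :: real assume d: "0 < d"
    have "(f \<longlongrightarrow> f w) (at w)" using f(1) by (simp add: continuous_on_def)
    then have "eventually (\<lambda>z. dist (f z) (f w) < d / 2) (at w)"
      by (rule tendstoD) (use d in simp)
    then obtain W where W: "open W" "w \<in> W" "\<forall>z\<in>W. z \<noteq> w \<longrightarrow> z \<in> UNIV \<longrightarrow> dist (f z) (f w) < d / 2"
      unfolding eventually_at_topological by blast
    have "openin (product_topology (\<lambda>_. euclidean) UNIV) W" using W(1) by (simp add: open_fun_def)
    from product_topology_open_contains_basis[OF this W(2)]
    obtain X where X': "w \<in> (\<Pi>\<^sub>E i\<in>UNIV. X i) \<and> (\<forall>i. openin euclidean (X i)) \<and>
        finite {i. X i \<noteq> topspace euclidean} \<and> (\<Pi>\<^sub>E i\<in>UNIV. X i) \<subseteq> W" by (rule exE)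
    then have X: "\<And>i. w i \<in> X i" "finite {i. X i \<noteq> UNIV}" "(\<Pi>\<^sub>E i\<in>UNIV. X i) \<subseteq> W"
      by (auto simp: PiE_def Pi_def)
    \<comment> \<open>An open box restricts only finitely many coordinates, so it contains every
      cylinder around \<open>w\<close> that fixes at least the first \<open>K0\<close> of
      them.\<close>
    obtain K0 where K0: "\<And>i. X i \<noteq> UNIV \<Longrightarrow> i < K0"
      using finite_nat_bounded[OF X(2)] by auto
    have "norm (g K w - f w) < d" if K: "K0 \<le> K" for K
    proof -
      have "f w - d / 2 \<le> g K w"
      proof (rule g_ge)
        fix w' assume w': "\<forall>j<K. w' j = w j"
        have "w' i \<in> X i" for i
        proof (cases "X i = UNIV")
          case False
          then have "i < K" using K0 K by force
          then show ?thesis using w' X(1)[of i] by simp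
        qed simp
        then have "w' \<in> W" using X(3) by auto
        then have "dist (f w') (f w) < d / 2 \<or> w' = w" using W(3) by blast
        then have "\<bar>f w' - f w\<bar> \<le> d / 2" using d by (elim disjE) (simp_all add: dist_real_def)
        then show "f w - d / 2 \<le> f w'" by linarith
      qed
      then show ?thesis using g_le[of K w] d by (simp add: abs_if)
    qed
    then show "\<exists>no. \<forall>K\<ge>no. norm (g K w - f w) < d" by blast
  qed
  \<comment> \<open>As a pointwise limit of functions of finitely many discrete coordinates,
    \<open>f\<close> is measurable for the product sigma-algebra.\<close>
  show fm: "f \<in> borel_measurable ?L"
    by (rule borel_measurable_LIMSEQ_real[OF _ gm]) (rule lim)
  have "(\<lambda>K. \<integral>w. g K w \<partial>?L) \<longlonglongrightarrow> (\<integral>w. f w \<partial>?L)"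
    by (rule integral_dominated_convergence[where w = "\<lambda>_. H"]) (use fm gm lim gH in auto)
  then have "eventually (\<lambda>K. (\<integral>w. f w \<partial>?L) - e < (\<integral>w. g K w \<partial>?L)) sequentially"
    by (rule order_tendstoD(1)) (use e in simp)
  then obtain K where K: "(\<integral>w. f w \<partial>?L) - e < (\<integral>w. g K w \<partial>?L)" by (auto simp: eventually_sequentially)
  have "(\<integral>w. g K w \<partial>?L) = integral\<^sup>L (distr ?L (PiM {..<K} (\<lambda>j. measure_pmf (Po (b j)))) (\<lambda>w. restrict w {..<K})) (g K)"
    by (subst integral_distr[OF restrict measurable_PiM_Po]) (simp_all flip: g_restrict)
  also have "\<dots> = integral\<^sup>L (PiM {..<K} (\<lambda>j. measure_pmf (Po (b j)))) (g K)"
    by (subst distr_PiM_restrict_finite) auto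
  finally have K': "(\<integral>w. f w \<partial>?L) - e < integral\<^sup>L (PiM {..<K} (\<lambda>j. measure_pmf (Po (b j)))) (g K)"
    using K by simp
  have "((\<lambda>n. \<integral>G. g K (\<lambda>j\<in>{..<K}. num_cycles (j + 3) G) \<partial>random_graph M x \<kappa> n)
    \<longlongrightarrow> integral\<^sup>L (PiM {..<K} (\<lambda>j. measure_pmf (Po (b j)))) (g K)) (at_top_in I)"
    by (rule cycles_finite_joint[where ks = "\<lambda>j. j + 3", OF \<kappa> _ _ b(1) b(2) conv gH]) (auto simp: inj_on_def)
  then have "eventually (\<lambda>n. (\<integral>w. f w \<partial>?L) - e < (\<integral>G. g K (\<lambda>j\<in>{..<K}. num_cycles (j + 3) G) \<partial>random_graph M x \<kappa> n)) (at_top_in I)"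
    using K' by (rule order_tendstoD(1))
  then show "eventually (\<lambda>n. (\<integral>w. f w \<partial>?L) - e < (\<integral>G. f (\<lambda>j. num_cycles (j + 3) G) \<partial>random_graph M x \<kappa> n)) (at_top_in I)"
    using eventually_index
  proof eventually_elim
    case (elim n)
    interpret pr: prob_space "M n" by (rule prob_space_M[OF elim(2)])
    have int: "integrable (random_graph M x \<kappa> n) h" if h: "\<And>G. \<bar>h G\<bar> \<le> H" for h :: "graph \<Rightarrow> real"
      unfolding random_graph_def
      by (rule integrable_bind[where K = "count_space UNIV" and B = H and B' = 1, OF _ _ measurable_graph_given[OF elim(2) \<kappa>(1)]])
        (use h in \<open>auto simp: pr.finite_measure_axioms measure_pmf.emeasure_space_1[simplified]\<close>)
    have "(\<integral>G. g K (\<lambda>j\<in>{..<K}. num_cycles (j + 3) G) \<partial>random_graph M x \<kappa> n)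
        \<le> (\<integral>G. f (\<lambda>j. num_cycles (j + 3) G) \<partial>random_graph M x \<kappa> n)"
    proof (rule integral_mono)
      show "g K (\<lambda>j\<in>{..<K}. num_cycles (j + 3) G) \<le> f (\<lambda>j. num_cycles (j + 3) G)" for G
        using g_le[of K "\<lambda>j. num_cycles (j + 3) G"] g_restrict[of K "\<lambda>j. num_cycles (j + 3) G"] by simp
    qed (rule int, rule gH, rule int, rule f(2))
    then show ?case using elim(1) by simp
  qed
qed

text \<open>The one-sided estimate is applied to \<open>f\<close> and to \<open>- f\<close>.\<close>

lemma cycles_joint_conv_in_distr:
  assumes \<kappa>: "kernel \<kappa>" "ae_continuous \<mu> \<kappa>"
    and conv: "\<And>k. 3 \<le> k \<Longrightarrow> cycles_mean_conv \<mu> I M x \<kappa> k" and fin: "\<And>k. 3 \<le> k \<Longrightarrow> beta \<mu> \<kappa> k < \<infinity>"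
  shows "conv_in_distr (random_graph M x \<kappa>) (\<lambda>n G j. num_cycles (j + 3) G)
    (\<Pi>\<^sub>M j\<in>UNIV. measure_pmf (Po (enn2real (beta \<mu> \<kappa> (j + 3))))) (at_top_in I)"
  unfolding conv_in_distr_def
proof (intro allI impI)
  fix f :: "(nat \<Rightarrow> nat) \<Rightarrow> real" assume f: "continuous_on UNIV f \<and> bounded (range f)"
  then obtain H where H: "\<And>w. \<bar>f w\<bar> \<le> H" by (auto simp: bounded_iff)
  define b where "b j = enn2real (beta \<mu> \<kappa> (j + 3))" for j
  have b: "0 \<le> b j" "beta \<mu> \<kappa> (j + 3) = ennreal (b j)" for j
    using fin[of "j + 3"] by (auto simp: b_def)
  have conv': "cycles_mean_conv \<mu> I M x \<kappa> (j + 3)" for j using conv by simp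
  let ?L = "\<Pi>\<^sub>M j\<in>UNIV. measure_pmf (Po (b j))"
  note liminf = cycles_joint_liminf(1)[OF \<kappa> b conv']
  show "((\<lambda>n. \<integral>G. f (\<lambda>j. num_cycles (j + 3) G) \<partial>random_graph M x \<kappa> n)
      \<longlongrightarrow> (\<integral>w. f w \<partial>(\<Pi>\<^sub>M j\<in>UNIV. measure_pmf (Po (enn2real (beta \<mu> \<kappa> (j + 3))))))) (at_top_in I)"
    unfolding b_def[symmetric]
  proof (rule tendstoI)
    fix e :: real assume e: "0 < e"
    have 1: "eventually (\<lambda>n. (\<integral>w. f w \<partial>?L) - e < (\<integral>G. f (\<lambda>j. num_cycles (j + 3) G) \<partial>random_graph M x \<kappa> n)) (at_top_in I)"
      by (rule liminf[OF _ H e]) (use f in simp)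
    have 2: "eventually (\<lambda>n. (\<integral>w. - f w \<partial>?L) - e < (\<integral>G. - f (\<lambda>j. num_cycles (j + 3) G) \<partial>random_graph M x \<kappa> n)) (at_top_in I)"
      by (rule liminf[where f = "\<lambda>w. - f w" and H = H, OF _ _ e]) (use f H in \<open>auto intro: continuous_intros\<close>)
    from 1 2 show "eventually (\<lambda>n. dist (\<integral>G. f (\<lambda>j. num_cycles (j + 3) G) \<partial>random_graph M x \<kappa> n) (\<integral>w. f w \<partial>?L) < e) (at_top_in I)"
      by eventually_elim (simp add: dist_real_def abs_less_iff)
  qed
qed

lemma paths_mean_conv_iff:
  assumes "kernel \<kappa>" "1 \<le> k"
  shows "paths_mean_conv \<mu> I M x \<kappa> k \<longleftrightarrow>
    ((\<lambda>n. \<integral>\<^sup>+ \<omega>. ennreal (mean_copies (Suc k) k \<kappa> n (x n \<omega>) / n ^ (Suc k - k)) \<partial>M n)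
      \<longlongrightarrow> walk_integral \<mu> \<kappa> (Suc k) k / of_nat 2) (at_top_in I)"
  unfolding paths_mean_conv_def alpha_eq_walk_integral[OF assms(2)]
  using tendsto_at_top_in_cong[OF mean_count_num_paths[OF _ assms]] by simp

lemma cycles_mean_conv_iff:
  assumes "kernel \<kappa>" "3 \<le> k"
  shows "cycles_mean_conv \<mu> I M x \<kappa> k \<longleftrightarrow>
    ((\<lambda>n. \<integral>\<^sup>+ \<omega>. ennreal (mean_copies k k \<kappa> n (x n \<omega>) / n ^ (k - k)) \<partial>M n)
      \<longlongrightarrow> walk_integral \<mu> \<kappa> k k / of_nat (2 * k)) (at_top_in I)"
  using tendsto_at_top_in_cong[OF mean_count_num_cycles[OF _ assms]] beta_eq_walk_integral[OF assms(1), of k] assms(2)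
  by (simp add: cycles_mean_conv_def)

end

theorem theorem17p1:
  fixes \<mu> :: "'a::{metric_space, second_countable_topology} measure"
    and I :: "real set"
    and M :: "real \<Rightarrow> 'w measure"
    and x :: "real \<Rightarrow> 'w \<Rightarrow> 'a list"
    and \<kappa> :: "'a \<Rightarrow> 'a \<Rightarrow> real"
  assumes "generalized_vertex_space \<mu> I M x"
    and "kernel \<kappa>"
    and "ae_continuous \<mu> \<kappa>"
  shows
    "(\<forall>k\<ge>1. alpha \<mu> \<kappa> k \<le>
        Liminf (at_top_in I)
          (\<lambda>n. mean_count (random_graph M x \<kappa> n) (num_paths k) / ennreal n)) \<and>
     (\<forall>k\<ge>3. beta \<mu> \<kappa> k \<le>
        Liminf (at_top_in I) (\<lambda>n. mean_count (random_graph M x \<kappa> n) (num_cycles k))) \<and>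
     (vertex_space \<mu> I M x \<and>
        (bounded_kernel \<kappa> \<or> (\<forall>n\<in>I. iid_points \<mu> n (M n) (x n))) \<longrightarrow>
        (\<forall>k\<ge>1. paths_mean_conv \<mu> I M x \<kappa> k) \<and>
        (\<forall>k\<ge>3. cycles_mean_conv \<mu> I M x \<kappa> k)) \<and>
     (\<forall>k\<ge>1. paths_mean_conv \<mu> I M x \<kappa> k \<and> alpha \<mu> \<kappa> k < \<infinity> \<longrightarrow>
        conv_in_prob (random_graph M x \<kappa>) (\<lambda>n G. real (num_paths k G) / n)
          (enn2real (alpha \<mu> \<kappa> k)) (at_top_in I)) \<and>
     (\<forall>k\<ge>3. cycles_mean_conv \<mu> I M x \<kappa> k \<and> beta \<mu> \<kappa> k < \<infinity> \<longrightarrow>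
        conv_in_distr (random_graph M x \<kappa>) (\<lambda>n G. num_cycles k G)
          (measure_pmf (Po (enn2real (beta \<mu> \<kappa> k)))) (at_top_in I)) \<and>
     ((\<forall>k\<ge>3. cycles_mean_conv \<mu> I M x \<kappa> k \<and> beta \<mu> \<kappa> k < \<infinity>) \<longrightarrow>
        conv_in_distr (random_graph M x \<kappa>) (\<lambda>n G j. num_cycles (j + 3) G)
          (\<Pi>\<^sub>M j\<in>UNIV. measure_pmf (Po (enn2real (beta \<mu> \<kappa> (j + 3))))) (at_top_in I))"
proof -
  interpret generalized_vertex_space \<mu> I M x by fact
  note \<kappa> = assms(2,3)
  have "alpha \<mu> \<kappa> k \<le> Liminf (at_top_in I)
      (\<lambda>n. mean_count (random_graph M x \<kappa> n) (num_paths k) / ennreal n)" if k: "1 \<le> k" for k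
    using Liminf_mean_copies[OF \<kappa> shape_path[OF k]] alpha_eq_walk_integral[OF k, of \<kappa>]
      Liminf_at_top_in_cong[OF mean_count_num_paths[OF _ \<kappa>(1) k]] by simp
  moreover have "beta \<mu> \<kappa> k \<le> Liminf (at_top_in I)
      (\<lambda>n. mean_count (random_graph M x \<kappa> n) (num_cycles k))" if k: "3 \<le> k" for k
    using Liminf_mean_copies[OF \<kappa> shape_cycle[OF k]] beta_eq_walk_integral[OF \<kappa>(1), of k] k
      Liminf_at_top_in_cong[OF mean_count_num_cycles[OF _ \<kappa>(1) k]] by simp
  moreover have "(\<forall>k\<ge>1. paths_mean_conv \<mu> I M x \<kappa> k) \<and> (\<forall>k\<ge>3. cycles_mean_conv \<mu> I M x \<kappa> k)"
    if V: "vertex_space \<mu> I M x" and c: "bounded_kernel \<kappa> \<or> (\<forall>n\<in>I. iid_points \<mu> n (M n) (x n))"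
  proof -
    interpret V: vertex_space \<mu> I M x by (rule V)
    show ?thesis
      using V.tendsto_mean_copies_vertex_space[OF \<kappa> shape_path c]
        V.tendsto_mean_copies_vertex_space[OF \<kappa> shape_cycle c]
        paths_mean_conv_iff[OF \<kappa>(1)] cycles_mean_conv_iff[OF \<kappa>(1)] by blast
  qed
  ultimately show ?thesis
    using paths_conv_in_prob[OF \<kappa>] cycles_conv_in_distr[OF \<kappa>] cycles_joint_conv_in_distr[OF \<kappa>] by blast
qed

end
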